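(* Let $(N^{2n},\Omega)$ be a symplectic manifold and $H\colon N\to\mathbb{R}$ a smooth proper function which reaches its minimum, normalized to be $0$, at a compact, symplectic, Bott-nondegenerate submanifold $M^{2m}$. Let $E=(TM)^{\Omega}$, with a neighborhood $W$ of its zero section identified with a tubular neighborhood of $M$ in $N$ as described in the context, and for $\epsilon>0$ let $\Phi=\Phi_\epsilon\colon E\to E$ be the fibrewise dilation by the factor $\epsilon$. Set $$X_1=(\Phi^{-1})_*X_H,\qquad \tilde\Omega=\epsilon^{-2}\Phi^*\Omega,\qquad \tilde\Omega^F=\epsilon^{-2}\Phi^*\Omega^F ,$$ so that $i_{X_1}\tilde\Omega=d(\epsilon^{-2}\Phi^*H)$. Then, as $\epsilon\to0$, $X_1$ approaches a fibrewise, quasiperiodic vector field $X_0$ on $E$. In particular, in each fibre $E_x$, $X_0$ is the Hamiltonian vector field of $d^2_N H|_{E_x}$ with respect to $\tilde\Omega^F$.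
   Context: Hamiltonian vector fields are defined by $i_{X_H}\Omega=dH$. "$H$ reaches its minimum at $M$" means that $M$ is the set of minimum points of $H$; $M$ is Bott-nondegenerate if at every $x\in M$ the Hessian of $H$ is nondegenerate on directions transversal to $M$. Setting: $E=(TM)^{\Omega}\subset TN|_M$ is the symplectic orthogonal complement of $TM$, used as normal bundle of $M$. By Weinstein's symplectic neighborhood theorem a neighborhood $W$ of the zero section in $E$ is identified with a neighborhood of $M$ in $N$ (zero section identified with $M$) so that $\Omega$ restricts to each fibre of $E$, within $W$, as a constant linear symplectic form, denoted $\Omega^F$; $\Omega^F$ is extended to the whole fibre as a constant form. $H$, $\Omega$ and $X_H$ are regarded as defined on $W$, so $X_1$ and $\tilde\Omega$ are defined on $\Phi_\epsilon^{-1}(W)$, which contains any given compact subset of $E$ for $\epsilon$ small. On each fibre $\tilde\Omega^F=\Omega^F$. $d^2_N H$ is the fibrewise positive-definite quadratic form on $E$ given by the quadratic part of $H$ in the fibre directions along $M$, i.e. the fibrewise quadratic form that is the limit of $\epsilon^{-2}\Phi_\epsilon^*H$ as $\epsilon\to0$. A vector field on $E$ is fibrewise if it is tangent to the fibres of $E\to M$; it is quasiperiodic if its flow in each fibre is quasiperiodic (here: a product of planar rotations in suitable linear coordinates). "Approaches" means $C^k$-convergence on compact subsets of $E$, for every $k$. *)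

theory Defs
  imports "HOL-Analysis.Analysis"
begin

section \<open>Smooth maps between open subsets of Euclidean spaces\<close>

primrec Ck_on :: "nat \<Rightarrow> ('a::euclidean_space \<Rightarrow> 'b::real_normed_vector) \<Rightarrow> 'a set \<Rightarrow> bool" where
  "Ck_on 0 f U \<longleftrightarrow> continuous_on U f"
| "Ck_on (Suc k) f U \<longleftrightarrow> (\<forall>x\<in>U. f differentiable (at x)) \<and>
     (\<forall>v. Ck_on k (\<lambda>x. frechet_derivative f (at x) v) U)"

text \<open>Only used for open \<^term>\<open>U\<close>.\<close>

definition smooth_on :: "'a::euclidean_space set \<Rightarrow> ('a \<Rightarrow> 'b::real_normed_vector) \<Rightarrow> bool" where
  "smooth_on U f \<longleftrightarrow> (\<forall>k. Ck_on k f U)"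

primrec iter_deriv :: "'a::euclidean_space list \<Rightarrow> ('a \<Rightarrow> 'b::real_normed_vector) \<Rightarrow> 'a \<Rightarrow> 'b" where
  "iter_deriv [] f = f"
| "iter_deriv (v # vs) f = iter_deriv vs (\<lambda>x. frechet_derivative f (at x) v)"


section \<open>Smooth manifolds\<close>

text \<open>A chart is a pair of its domain and a coordinate map, whose values outside the domain are
  irrelevant. All manifolds are sets with an atlas, and carry the topology induced by the atlas.\<close>

type_synonym ('p, 'e) chart = "'p set \<times> ('p \<Rightarrow> 'e)"

abbreviation chart_inv :: "('p, 'e) chart \<Rightarrow> 'e \<Rightarrow> 'p" where
  "chart_inv c \<equiv> inv_into (fst c) (snd c)"

definition is_chart :: "('p, 'e::euclidean_space) chart \<Rightarrow> bool" where
  "is_chart c \<longleftrightarrow> inj_on (snd c) (fst c) \<and> open (snd c ` fst c)"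

definition smooth_transition :: "('p, 'e::euclidean_space) chart \<Rightarrow> ('p, 'e) chart \<Rightarrow> bool" where
  "smooth_transition c d \<longleftrightarrow> open (snd c ` (fst c \<inter> fst d)) \<and>
     smooth_on (snd c ` (fst c \<inter> fst d)) (snd d \<circ> chart_inv c)"

definition carrier :: "('p, 'e) chart set \<Rightarrow> 'p set" where
  "carrier A = (\<Union>c\<in>A. fst c)"

definition atlas_topology :: "('p, 'e::euclidean_space) chart set \<Rightarrow> 'p topology" where
  "atlas_topology A =
     topology_generated_by {{p \<in> fst c. snd c p \<in> U} | c U. c \<in> A \<and> open U}"

definition smooth_manifold :: "'p set \<Rightarrow> ('p, 'e::euclidean_space) chart set \<Rightarrow> bool" where
  "smooth_manifold X A \<longleftrightarrow> carrier A = X \<and> (\<forall>c\<in>A. is_chart c) \<and>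
     (\<forall>c\<in>A. \<forall>d\<in>A. smooth_transition c d) \<and>
     Hausdorff_space (atlas_topology A) \<and> second_countable (atlas_topology A)"

definition max_atlas :: "('p, 'e::euclidean_space) chart set \<Rightarrow> ('p, 'e) chart set" where
  "max_atlas A = {c. is_chart c \<and> fst c \<subseteq> carrier A \<and>
     (\<forall>d\<in>A. smooth_transition c d \<and> smooth_transition d c)}"

definition smooth_function :: "('p, 'e::euclidean_space) chart set \<Rightarrow> ('p \<Rightarrow> real) \<Rightarrow> bool" where
  "smooth_function A f \<longleftrightarrow> (\<forall>c\<in>A. smooth_on (snd c ` fst c) (f \<circ> chart_inv c))"

definition proper_function :: "('p, 'e::euclidean_space) chart set \<Rightarrow> ('p \<Rightarrow> real) \<Rightarrow> bool" where
  "proper_function A f \<longleftrightarrow>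
     (\<forall>K. compact K \<longrightarrow> compactin (atlas_topology A) {p \<in> carrier A. f p \<in> K})"

text \<open>In the next definition, openness of all the sets amounts to openness of \<^term>\<open>S\<close>
  and continuity of \<^term>\<open>f\<close> on it.\<close>

definition smooth_map ::
  "('p, 'e::euclidean_space) chart set \<Rightarrow> ('q, 'f::euclidean_space) chart set \<Rightarrow> 'p set \<Rightarrow> ('p \<Rightarrow> 'q) \<Rightarrow> bool" where
  "smooth_map A B S f \<longleftrightarrow> S \<subseteq> carrier A \<and> f ` S \<subseteq> carrier B \<and>
     (\<forall>c\<in>A. \<forall>d\<in>B. open (snd c ` {p \<in> S \<inter> fst c. f p \<in> fst d}) \<and>
        smooth_on (snd c ` {p \<in> S \<inter> fst c. f p \<in> fst d}) (snd d \<circ> f \<circ> chart_inv c))"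

definition diffeomorphism ::
  "('p, 'e::euclidean_space) chart set \<Rightarrow> ('q, 'f::euclidean_space) chart set \<Rightarrow>
    'p set \<Rightarrow> 'q set \<Rightarrow> ('p \<Rightarrow> 'q) \<Rightarrow> bool" where
  "diffeomorphism A B S T f \<longleftrightarrow>
     openin (atlas_topology A) S \<and> openin (atlas_topology B) T \<and> bij_betw f S T \<and>
     smooth_map A B S f \<and> smooth_map B A T (inv_into S f)"


section \<open>Tangent vectors, vector fields and forms\<close>

text \<open>Every point has a preferred chart, and the tangent space at a point is the model space:
  a tangent vector is represented by its coordinates in the preferred chart of its base point.
  Neither vector fields nor forms are therefore expected to depend smoothly on the point as
  functions into the model space; smoothness is expressed in charts.\<close>

definition chart_at :: "('p, 'e) chart set \<Rightarrow> 'p \<Rightarrow> ('p, 'e) chart" where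
  "chart_at A p = (SOME c. c \<in> A \<and> p \<in> fst c)"

abbreviation pref :: "('p, 'e) chart set \<Rightarrow> 'p \<Rightarrow> 'p \<Rightarrow> 'e" where
  "pref A p \<equiv> snd (chart_at A p)"

text \<open>\<^term>\<open>vec_to_chart A c p\<close> is the differential at \<^term>\<open>p\<close> of the coordinate map of
  \<^term>\<open>c\<close>; \<^term>\<open>vec_from_chart A c p\<close> is its inverse.\<close>

definition vec_to_chart ::
  "('p, 'e::euclidean_space) chart set \<Rightarrow> ('p, 'e) chart \<Rightarrow> 'p \<Rightarrow> 'e \<Rightarrow> 'e" where
  "vec_to_chart A c p v =
     frechet_derivative (snd c \<circ> chart_inv (chart_at A p)) (at (pref A p p)) v"

definition vec_from_chart ::
  "('p, 'e::euclidean_space) chart set \<Rightarrow> ('p, 'e) chart \<Rightarrow> 'p \<Rightarrow> 'e \<Rightarrow> 'e" where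
  "vec_from_chart A c p v =
     frechet_derivative (pref A p \<circ> chart_inv c) (at (snd c p)) v"

definition tangent_map ::
  "('p, 'e::euclidean_space) chart set \<Rightarrow> ('q, 'f::euclidean_space) chart set \<Rightarrow>
    ('p \<Rightarrow> 'q) \<Rightarrow> 'p \<Rightarrow> 'e \<Rightarrow> 'f" where
  "tangent_map A B f p v =
     frechet_derivative (pref B (f p) \<circ> f \<circ> chart_inv (chart_at A p)) (at (pref A p p)) v"

definition differential ::
  "('p, 'e::euclidean_space) chart set \<Rightarrow> ('p \<Rightarrow> real) \<Rightarrow> 'p \<Rightarrow> 'e \<Rightarrow> real" where
  "differential A f p v =
     frechet_derivative (f \<circ> chart_inv (chart_at A p)) (at (pref A p p)) v"

definition field_in_chart ::
  "('p, 'e::euclidean_space) chart set \<Rightarrow> ('p, 'e) chart \<Rightarrow> ('p \<Rightarrow> 'e) \<Rightarrow> 'e \<Rightarrow> 'e" where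
  "field_in_chart A c X z = vec_to_chart A c (chart_inv c z) (X (chart_inv c z))"

definition smooth_field ::
  "('p, 'e::euclidean_space) chart set \<Rightarrow> 'p set \<Rightarrow> ('p \<Rightarrow> 'e) \<Rightarrow> bool" where
  "smooth_field A S X \<longleftrightarrow> openin (atlas_topology A) S \<and>
     (\<forall>c\<in>A. smooth_on (snd c ` (fst c \<inter> S)) (field_in_chart A c X))"

definition pushforward ::
  "('p, 'e::euclidean_space) chart set \<Rightarrow> ('q, 'f::euclidean_space) chart set \<Rightarrow>
    ('p \<Rightarrow> 'q) \<Rightarrow> 'p set \<Rightarrow> ('p \<Rightarrow> 'e) \<Rightarrow> 'q \<Rightarrow> 'f" where
  "pushforward A B f S X q = tangent_map A B f (inv_into S f q) (X (inv_into S f q))"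

definition pullback_form ::
  "('p, 'e::euclidean_space) chart set \<Rightarrow> ('q, 'f::euclidean_space) chart set \<Rightarrow>
    ('p \<Rightarrow> 'q) \<Rightarrow> ('q \<Rightarrow> 'f \<Rightarrow> 'f \<Rightarrow> real) \<Rightarrow> 'p \<Rightarrow> 'e \<Rightarrow> 'e \<Rightarrow> real" where
  "pullback_form A B f \<omega> p u w = \<omega> (f p) (tangent_map A B f p u) (tangent_map A B f p w)"

definition integral_curve ::
  "('p, 'e::euclidean_space) chart set \<Rightarrow> ('p \<Rightarrow> 'e) \<Rightarrow> (real \<Rightarrow> 'p) \<Rightarrow> bool" where
  "integral_curve A X \<gamma> \<longleftrightarrow> (\<forall>t. \<gamma> t \<in> carrier A \<and>
     (\<forall>\<^sub>F s in nhds t. \<gamma> s \<in> fst (chart_at A (\<gamma> t))) \<and>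
     ((\<lambda>s. pref A (\<gamma> t) (\<gamma> s)) has_vector_derivative X (\<gamma> t)) (at t))"

text \<open>Convergence in \<open>C\<^sup>k\<close> on compact subsets, as \<open>\<epsilon>\<close> decreases to 0, of vector fields
  \<^term>\<open>X \<epsilon>\<close> which are only defined on open sets \<^term>\<open>D \<epsilon>\<close>.\<close>

definition Ck_converges ::
  "('p, 'e::euclidean_space) chart set \<Rightarrow> nat \<Rightarrow> (real \<Rightarrow> 'p set) \<Rightarrow> (real \<Rightarrow> 'p \<Rightarrow> 'e) \<Rightarrow>
    ('p \<Rightarrow> 'e) \<Rightarrow> bool" where
  "Ck_converges A k D X X0 \<longleftrightarrow>
     (\<forall>c\<in>A. \<forall>K. compact K \<and> K \<subseteq> snd c ` fst c \<longrightarrow>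
        (\<forall>\<^sub>F \<epsilon> in at_right 0. K \<subseteq> snd c ` (fst c \<inter> D \<epsilon>)) \<and>
        (\<forall>vs. length vs \<le> k \<longrightarrow>
           uniform_limit K (\<lambda>\<epsilon>. iter_deriv vs (field_in_chart A c (X \<epsilon>)))
             (iter_deriv vs (field_in_chart A c X0)) (at_right 0)))"


section \<open>Symplectic forms\<close>

definition linear_symplectic :: "'e::real_vector set \<Rightarrow> ('e \<Rightarrow> 'e \<Rightarrow> real) \<Rightarrow> bool" where
  "linear_symplectic V \<omega> \<longleftrightarrow> subspace V \<and>
     (\<forall>u\<in>V. \<forall>v\<in>V. \<forall>w\<in>V. \<forall>a b.
        \<omega> (a *\<^sub>R u + b *\<^sub>R v) w = a * \<omega> u w + b * \<omega> v w \<and>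
        \<omega> w (a *\<^sub>R u + b *\<^sub>R v) = a * \<omega> w u + b * \<omega> w v) \<and>
     (\<forall>u\<in>V. \<omega> u u = 0) \<and>
     (\<forall>u\<in>V. (\<forall>w\<in>V. \<omega> u w = 0) \<longrightarrow> u = 0)"

definition form_in_chart ::
  "('p, 'e::euclidean_space) chart set \<Rightarrow> ('p, 'e) chart \<Rightarrow> ('p \<Rightarrow> 'e \<Rightarrow> 'e \<Rightarrow> real) \<Rightarrow>
    'e \<Rightarrow> 'e \<Rightarrow> 'e \<Rightarrow> real" where
  "form_in_chart A c \<omega> z u w =
     \<omega> (chart_inv c z) (vec_from_chart A c (chart_inv c z) u) (vec_from_chart A c (chart_inv c z) w)"

text \<open>Closedness is \<open>d\<omega> = 0\<close> evaluated on constant vector fields in a chart.\<close>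

definition symplectic_form ::
  "('p, 'e::euclidean_space) chart set \<Rightarrow> ('p \<Rightarrow> 'e \<Rightarrow> 'e \<Rightarrow> real) \<Rightarrow> bool" where
  "symplectic_form A \<omega> \<longleftrightarrow>
     (\<forall>p\<in>carrier A. linear_symplectic UNIV (\<omega> p)) \<and>
     (\<forall>c\<in>A. \<forall>u w. smooth_on (snd c ` fst c) (\<lambda>z. form_in_chart A c \<omega> z u w)) \<and>
     (\<forall>c\<in>A. \<forall>z\<in>snd c ` fst c. \<forall>u v w.
        frechet_derivative (\<lambda>z. form_in_chart A c \<omega> z v w) (at z) u +
        frechet_derivative (\<lambda>z. form_in_chart A c \<omega> z w u) (at z) v +
        frechet_derivative (\<lambda>z. form_in_chart A c \<omega> z u v) (at z) w = 0)"


section \<open>Submanifolds\<close>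

definition slice_chart ::
  "('p, 'e::euclidean_space) chart set \<Rightarrow> 'p set \<Rightarrow> nat \<Rightarrow> ('p, 'e) chart \<Rightarrow> 'e set \<Rightarrow> bool" where
  "slice_chart A M d c S \<longleftrightarrow> c \<in> max_atlas A \<and> subspace S \<and> dim S = d \<and>
     snd c ` (fst c \<inter> M) = snd c ` fst c \<inter> S"

definition submanifold :: "('p, 'e::euclidean_space) chart set \<Rightarrow> 'p set \<Rightarrow> nat \<Rightarrow> bool" where
  "submanifold A M d \<longleftrightarrow> M \<subseteq> carrier A \<and> (\<forall>x\<in>M. \<exists>c S. slice_chart A M d c S \<and> x \<in> fst c)"

text \<open>Velocities at \<^term>\<open>x\<close> of smooth curves in \<^term>\<open>M\<close>.\<close>

definition tangent_space :: "('p, 'e::euclidean_space) chart set \<Rightarrow> 'p set \<Rightarrow> 'p \<Rightarrow> 'e set" where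
  "tangent_space A M x = {v. \<exists>\<gamma> \<delta>. 0 < \<delta> \<and> \<gamma> 0 = x \<and>
     (\<forall>t\<in>{-\<delta><..<\<delta>}. \<gamma> t \<in> M \<inter> fst (chart_at A x)) \<and>
     smooth_on {-\<delta><..<\<delta>::real} (\<lambda>t. pref A x (\<gamma> t)) \<and>
     ((\<lambda>t. pref A x (\<gamma> t)) has_vector_derivative v) (at 0)}"

definition symplectic_submanifold ::
  "('p, 'e::euclidean_space) chart set \<Rightarrow> ('p \<Rightarrow> 'e \<Rightarrow> 'e \<Rightarrow> real) \<Rightarrow> 'p set \<Rightarrow> nat \<Rightarrow> bool" where
  "symplectic_submanifold A \<Omega> M d \<longleftrightarrow> submanifold A M d \<and>
     (\<forall>x\<in>M. linear_symplectic (tangent_space A M x) (\<Omega> x))"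

text \<open>The Hessian is computed in the preferred chart; at critical points, the only place where it
  is used, it does not depend on the chart. For a critical submanifold it descends to
  the normal space \<open>T\<^sub>xN / T\<^sub>xM\<close>, and Bott nondegeneracy says that it is nondegenerate there.\<close>

definition hessian ::
  "('p, 'e::euclidean_space) chart set \<Rightarrow> ('p \<Rightarrow> real) \<Rightarrow> 'p \<Rightarrow> 'e \<Rightarrow> 'e \<Rightarrow> real" where
  "hessian A f x u w = frechet_derivative
     (\<lambda>z. frechet_derivative (f \<circ> chart_inv (chart_at A x)) (at z) u) (at (pref A x x)) w"

definition bott_nondegenerate ::
  "('p, 'e::euclidean_space) chart set \<Rightarrow> ('p \<Rightarrow> real) \<Rightarrow> 'p set \<Rightarrow> bool" where
  "bott_nondegenerate A f M \<longleftrightarrow>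
     (\<forall>x\<in>M. \<forall>u. u \<notin> tangent_space A M x \<longrightarrow> (\<exists>w. hessian A f x u w \<noteq> 0))"


section \<open>The symplectic normal bundle\<close>

definition symplectic_normal_bundle ::
  "('p, 'e::euclidean_space) chart set \<Rightarrow> ('p \<Rightarrow> 'e \<Rightarrow> 'e \<Rightarrow> real) \<Rightarrow> 'p set \<Rightarrow> ('p \<times> 'e) set" where
  "symplectic_normal_bundle A \<Omega> M =
     {(x, v). x \<in> M \<and> (\<forall>w\<in>tangent_space A M x. \<Omega> x v w = 0)}"

abbreviation fibre :: "('p \<times> 'e) set \<Rightarrow> 'p \<Rightarrow> 'e set" where
  "fibre E x \<equiv> {v. (x, v) \<in> E}"

text \<open>The smooth structure of the total space of a vector bundle \<^term>\<open>E\<close> over \<^term>\<open>M\<close>, each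
  fibre being a subspace of the tangent space of the ambient manifold: the charts come from the local
  trivializations. Over a slice chart of \<^term>\<open>M\<close> with slice \<open>S\<close>, the base point gives the
  component in \<open>S\<close>, the fibre coordinates \<open>\<tau>\<close> give the component in the orthogonal complement of \<open>S\<close>
  (so the bundle has rank the codimension of \<^term>\<open>M\<close>). The last condition is smoothness of the
  inverse trivialization as a map into the tangent bundle of the ambient manifold.\<close>

definition bundle_atlas ::
  "('p, 'e::euclidean_space) chart set \<Rightarrow> 'p set \<Rightarrow> nat \<Rightarrow> ('p \<times> 'e) set \<Rightarrow> ('p \<times> 'e, 'e) chart set" where
  "bundle_atlas A M d E = {(V, \<psi>). \<exists>c S \<tau>. slice_chart A M d c S \<and>
     V = {(x, v). (x, v) \<in> E \<and> x \<in> fst c} \<and>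
     (\<forall>x\<in>fst c \<inter> M. linear (\<tau> x) \<and> bij_betw (\<tau> x) (fibre E x) (S\<^sup>\<bottom>)) \<and>
     (\<forall>(x, v)\<in>V. \<psi> (x, v) = snd c x + \<tau> x v) \<and>
     smooth_on (\<psi> ` V) (\<lambda>z. case inv_into V \<psi> z of (x, v) \<Rightarrow> vec_to_chart A c x v)}"

definition dilation :: "real \<Rightarrow> 'p \<times> 'e::real_vector \<Rightarrow> 'p \<times> 'e" where
  "dilation \<epsilon> = (\<lambda>(x, v). (x, \<epsilon> *\<^sub>R v))"

text \<open>The tangent vector at a point of \<^term>\<open>E\<close> to the fibre, in the direction \<open>u\<close> of that fibre.\<close>

definition vertical ::
  "('p \<times> 'e, 'e::euclidean_space) chart set \<Rightarrow> 'p \<times> 'e \<Rightarrow> 'e \<Rightarrow> 'e" where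
  "vertical B e u = vector_derivative (\<lambda>t. pref B e (fst e, snd e + t *\<^sub>R u)) (at 0)"

text \<open>The identification of a neighbourhood \<open>W\<close> of the zero section with a neighbourhood of \<open>M\<close>
  by \<open>\<Psi>\<close>. As for any tubular neighbourhood, the identification is the identity on the zero section and
  its differential there restricts to the identity on the normal bundle.\<close>

definition weinstein_neighbourhood ::
  "('p, 'e::euclidean_space) chart set \<Rightarrow> ('p \<Rightarrow> 'e \<Rightarrow> 'e \<Rightarrow> real) \<Rightarrow> 'p set \<Rightarrow>
    ('p \<times> 'e, 'e) chart set \<Rightarrow> ('p \<times> 'e) set \<Rightarrow> ('p \<times> 'e) set \<Rightarrow> ('p \<times> 'e \<Rightarrow> 'p) \<Rightarrow>
    ('p \<Rightarrow> 'e \<Rightarrow> 'e \<Rightarrow> real) \<Rightarrow> bool" where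
  "weinstein_neighbourhood A \<Omega> M B E W \<Psi> \<Omega>F \<longleftrightarrow>
     diffeomorphism B A W (\<Psi> ` W) \<Psi> \<and>
     (\<forall>x\<in>M. (x, 0) \<in> W \<and> \<Psi> (x, 0) = x \<and>
        (\<forall>u\<in>fibre E x. tangent_map B A \<Psi> (x, 0) (vertical B (x, 0) u) = u)) \<and>
     (\<forall>x\<in>M. linear_symplectic (fibre E x) (\<Omega>F x)) \<and>
     (\<forall>(x, v)\<in>W. \<forall>u\<in>fibre E x. \<forall>w\<in>fibre E x.
        pullback_form B A \<Psi> \<Omega> (x, v) (vertical B (x, v) u) (vertical B (x, v) w) = \<Omega>F x u w)"

text \<open>The quadratic part of \<open>H\<close> in the fibre directions, as the limit of \<open>\<epsilon>\<^sup>-\<^sup>2 \<Phi>\<^sub>\<epsilon>\<^sup>* H\<close>; it is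
  half of the second derivative at the zero section.\<close>

definition normal_hessian ::
  "('p \<Rightarrow> real) \<Rightarrow> ('p \<times> 'e::real_vector \<Rightarrow> 'p) \<Rightarrow> 'p \<times> 'e \<Rightarrow> real" where
  "normal_hessian H \<Psi> e = Lim (at_right 0) (\<lambda>\<epsilon>. H (\<Psi> (dilation \<epsilon> e)) / \<epsilon>\<^sup>2)"

definition fibrewise_field ::
  "('p \<times> 'e, 'e::euclidean_space) chart set \<Rightarrow> ('p \<times> 'e) set \<Rightarrow> ('p \<times> 'e \<Rightarrow> 'e) \<Rightarrow> bool" where
  "fibrewise_field B E X \<longleftrightarrow> (\<forall>(x, v)\<in>E. X (x, v) \<in> vertical B (x, v) ` fibre E x)"

text \<open>In each fibre, the flow \<open>\<theta>\<close> is the product of the rotations by \<open>\<omega> i * t\<close> in the planes with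
  complex coordinates \<open>\<zeta> i\<close>.\<close>

definition quasiperiodic_field ::
  "('p \<times> 'e, 'e::euclidean_space) chart set \<Rightarrow> ('p \<times> 'e) set \<Rightarrow> 'p set \<Rightarrow> ('p \<times> 'e \<Rightarrow> 'e) \<Rightarrow> bool" where
  "quasiperiodic_field B E M X \<longleftrightarrow>
     (\<forall>x\<in>M. \<exists>(k::nat) (\<zeta> :: nat \<Rightarrow> 'e \<Rightarrow> complex) (\<omega> :: nat \<Rightarrow> real) (\<theta> :: real \<Rightarrow> 'e \<Rightarrow> 'e).
        (\<forall>i<k. linear (\<zeta> i)) \<and>
        bij_betw (\<lambda>v. \<lambda>i\<in>{..<k}. \<zeta> i v) (fibre E x) ({..<k} \<rightarrow>\<^sub>E UNIV) \<and>
        (\<forall>v\<in>fibre E x. \<theta> 0 v = v \<and> (\<forall>t. \<theta> t v \<in> fibre E x) \<and>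
           integral_curve B X (\<lambda>t. (x, \<theta> t v)) \<and>
           (\<forall>t. \<forall>i<k. \<zeta> i (\<theta> t v) = cis (\<omega> i * t) * \<zeta> i v)))"

text \<open>\<open>X\<close> is tangent to the fibre over \<open>x\<close> and is there the Hamiltonian vector field of \<open>Q\<close>
  with respect to the constant form \<open>\<omega>\<close> on the vector space \<^term>\<open>fibre E x\<close>.\<close>

definition fibre_hamiltonian ::
  "('p \<times> 'e, 'e::euclidean_space) chart set \<Rightarrow> ('p \<times> 'e) set \<Rightarrow> 'p \<Rightarrow> ('e \<Rightarrow> 'e \<Rightarrow> real) \<Rightarrow>
    ('p \<times> 'e \<Rightarrow> real) \<Rightarrow> ('p \<times> 'e \<Rightarrow> 'e) \<Rightarrow> bool" where
  "fibre_hamiltonian B E x \<omega> Q X \<longleftrightarrow>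
     (\<forall>v\<in>fibre E x. \<exists>y\<in>fibre E x. X (x, v) = vertical B (x, v) y \<and>
        (\<forall>w\<in>fibre E x. ((\<lambda>t. Q (x, v + t *\<^sub>R w)) has_real_derivative \<omega> y w) (at 0)))"

end

theory Submission
  imports Defs
begin

text \<open>In a bundle chart over a slice chart of \<open>M\<close> the dilation \<open>\<Phi>\<^sub>\<epsilon>\<close> is linear: it fixes the slice
  \<open>S\<close> and multiplies its complement by \<open>\<epsilon>\<close>. Since \<open>X\<^sub>H\<close> vanishes on \<open>M\<close>, a smooth field \<open>F\<close> vanishing
  on \<open>S\<close> represents it, and the conjugate \<open>\<Phi>\<^sub>\<epsilon>\<^sup>-\<^sup>1 \<circ> F \<circ> \<Phi>\<^sub>\<epsilon>\<close> converges in every \<open>C\<^sup>k\<close> to the vertical part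
  of the linearization of \<open>F\<close> along \<open>S\<close>, applied to the vertical coordinate.

  At a point \<open>x\<close> of \<open>M\<close>, differentiating \<open>i\<^sub>X\<Omega> = dH\<close> gives \<open>\<Omega> (J u) w = Hess H (w, u)\<close> for the
  linearization \<open>J\<close> of \<open>X\<^sub>H\<close>. As \<open>E\<^sub>x\<close> is the symplectic complement of \<open>T\<^sub>xM\<close>, the horizontal part
  of \<open>J v\<close> is not seen by \<open>\<Omega>\<close> on \<open>E\<^sub>x\<close>, so the limit is the linear Hamiltonian field \<open>Y\<close> of the
  Hessian on \<open>E\<^sub>x\<close>. The Hessian is positive definite there, and \<open>Y\<close> is skew for it, hence a
  sum of infinitesimal rotations.\<close>

section \<open>Calculus of smooth maps\<close>

text \<open>Two facts that are usually taken for granted shape the development. The field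
  \<open>X\<^sub>H\<close> is given only pointwise, as the solution of a linear equation, so its
  smoothness has to come from the smooth dependence of solutions of nondegenerate linear systems on
  a parameter. The bundle charts are local trivializations whose compatibility must be proved: near
  the zero section it is inherited from the diffeomorphism \<Psi>, and because dilations are linear
  in every bundle chart, conjugating with them spreads it over all of \<open>E\<close>.

  Only the vertical component of the conjugated field is divided by \<epsilon>; the horizontal one
  tends to its value on the slice, which is 0. This is why the limit is fibrewise. All
  linearizations are taken at zeros of the field, where a product rule that asks mere continuity of
  the other factor applies; derivatives of the form and second derivatives of coordinate changes
  then contribute nothing.

  The quadratic part in \<open>normal_hessian\<close> is half the Hessian, and differentiating it
  restores the Hessian, so the factors agree with those of the linearized equation.\<close>

abbreviation fderiv :: "('a::real_normed_vector \<Rightarrow> 'b::real_normed_vector) \<Rightarrow> 'a \<Rightarrow> 'a \<Rightarrow> 'b" where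
  "fderiv f x \<equiv> frechet_derivative f (at x)"

lemma fderiv_works: "f differentiable at x \<Longrightarrow> (f has_derivative fderiv f x) (at x)"
  by (simp add: frechet_derivative_works)

lemma fderiv_eq: "(f has_derivative f') (at x) \<Longrightarrow> fderiv f x = f'"
  using frechet_derivative_at by metis

lemma fderiv_cong_open:
  assumes "open U" "x \<in> U" "\<And>y. y \<in> U \<Longrightarrow> f y = g y" "f differentiable at x"
  shows "g differentiable at x" "fderiv g x = fderiv f x"
proof -
  have "(g has_derivative fderiv f x) (at x)"
    using has_derivative_transform_within_open[OF fderiv_works] assms by blast
  then show "g differentiable at x" "fderiv g x = fderiv f x"
    using fderiv_eq differentiableI by blast+
qed

lemma Ck_on_cong:
  assumes "open U" "\<And>x. x \<in> U \<Longrightarrow> f x = g x" "Ck_on k f U"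
  shows "Ck_on k g U"
  using assms(2,3)
proof (induction k arbitrary: f g)
  case 0
  then show ?case by (simp cong: continuous_on_cong_simp)
next
  case (Suc k)
  have d: "g differentiable at x" "fderiv g x = fderiv f x" if "x \<in> U" for x
    using fderiv_cong_open[OF \<open>open U\<close> that, of f g] Suc.prems that by auto
  have "Ck_on k (\<lambda>x. fderiv g x v) U" for v
    by (rule Suc.IH[of "\<lambda>x. fderiv f x v"]) (use Suc.prems d in auto)
  then show ?case using d by simp
qed

lemma Ck_on_subset: "Ck_on k f U \<Longrightarrow> V \<subseteq> U \<Longrightarrow> Ck_on k f V"
  by (induction k arbitrary: f) (auto intro: continuous_on_subset)

lemma Ck_on_local:
  assumes "\<And>x. x \<in> U \<Longrightarrow> \<exists>V. open V \<and> x \<in> V \<and> Ck_on k f V"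
  shows "Ck_on k f U"
  using assms
proof (induction k arbitrary: f)
  case 0
  then show ?case
    by (metis Ck_on.simps(1) continuous_at_imp_continuous_on continuous_on_eq_continuous_at)
next
  case (Suc k)
  have "f differentiable at x" if "x \<in> U" for x
    using Suc.prems[OF that] by auto
  moreover have "Ck_on k (\<lambda>x. fderiv f x v) U" for v
    using Suc.prems by (intro Suc.IH) fastforce
  ultimately show ?case by simp
qed

lemma Ck_on_Suc_imp: "Ck_on (Suc k) f U \<Longrightarrow> Ck_on k f U"
proof (induction k arbitrary: f)
  case 0
  then show ?case
    by (auto intro!: continuous_at_imp_continuous_on differentiable_imp_continuous_within)
next
  case (Suc k)
  then show ?case by (metis Ck_on.simps(2))
qed

lemma Ck_on_const: "Ck_on k (\<lambda>x. c) U"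
  by (induction k arbitrary: c) auto

lemma Ck_on_bounded_linear:
  assumes "bounded_linear L" shows "Ck_on k L U"
proof (cases k)
  case 0
  then show ?thesis using assms by (auto intro: linear_continuous_on)
next
  case (Suc j)
  have "fderiv L x = L" "L differentiable at x" for x
    using bounded_linear_imp_has_derivative[OF assms] fderiv_eq differentiableI by blast+
  then show ?thesis using Suc by (simp add: Ck_on_const)
qed

text \<open>Lets inductions on k work with an explicit formula for the derivative; openness of
  \<open>U\<close> transfers the regularity of the formula to
  \<open>frechet_derivative\<close>.\<close>

lemma Ck_on_SucI:
  assumes "open U" "\<And>x. x \<in> U \<Longrightarrow> (f has_derivative f' x) (at x)" "\<And>v. Ck_on k (\<lambda>x. f' x v) U"
  shows "Ck_on (Suc k) f U"
proof -
  have "Ck_on k (\<lambda>x. fderiv f x v) U" for v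
    by (rule Ck_on_cong[OF assms(1) _ assms(3)]) (simp add: fderiv_eq[OF assms(2)])
  then show ?thesis using assms(2) by (auto intro: differentiableI)
qed

lemma Ck_on_add:
  assumes "open U" "Ck_on k f U" "Ck_on k g U"
  shows "Ck_on k (\<lambda>x. f x + g x) U"
  using assms(2,3)
proof (induction k arbitrary: f g)
  case 0
  then show ?case by (auto intro: continuous_on_add)
next
  case (Suc k)
  show ?case
  proof (rule Ck_on_SucI[OF \<open>open U\<close>])
    show "((\<lambda>x. f x + g x) has_derivative (\<lambda>v. fderiv f x v + fderiv g x v)) (at x)" if "x \<in> U" for x
      using Suc.prems that by (intro has_derivative_add fderiv_works) auto
    show "Ck_on k (\<lambda>x. fderiv f x v + fderiv g x v) U" for v
      using Suc by simp
  qed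
qed

lemma Ck_on_linear_compose:
  assumes "open U" "bounded_linear L" "Ck_on k f U"
  shows "Ck_on k (\<lambda>x. L (f x)) U"
  using assms(3)
proof (induction k arbitrary: f)
  case 0
  then show ?case using assms by (auto intro: bounded_linear.continuous_on)
next
  case (Suc k)
  show ?case
  proof (rule Ck_on_SucI[OF \<open>open U\<close>])
    show "((\<lambda>x. L (f x)) has_derivative (\<lambda>v. L (fderiv f x v))) (at x)" if "x \<in> U" for x
      by (rule bounded_linear.has_derivative[OF assms(2) fderiv_works]) (use Suc.prems that in auto)
    show "Ck_on k (\<lambda>x. L (fderiv f x v)) U" for v
      using Suc by simp
  qed
qed

lemma (in bounded_bilinear) Ck_on:
  assumes "open U" "Ck_on k f U" "Ck_on k g U"
  shows "Ck_on k (\<lambda>x. prod (f x) (g x)) U"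
  using assms(2,3)
proof (induction k arbitrary: f g)
  case 0
  then show ?case by (auto intro: continuous_on)
next
  case (Suc k)
  have "Ck_on k f U" "Ck_on k g U"
    using Suc.prems by (simp_all only: Ck_on_Suc_imp)
  moreover have "Ck_on k (\<lambda>x. fderiv f x v) U" "Ck_on k (\<lambda>x. fderiv g x v) U" for v
    using Suc.prems by simp_all
  ultimately have "Ck_on k (\<lambda>x. prod (f x) (fderiv g x v) + prod (fderiv f x v) (g x)) U" for v
    by (intro Ck_on_add[OF \<open>open U\<close>] Suc.IH)
  moreover have "((\<lambda>x. prod (f x) (g x)) has_derivative
      (\<lambda>v. prod (f x) (fderiv g x v) + prod (fderiv f x v) (g x))) (at x)" if "x \<in> U" for x
    using Suc.prems that by (intro FDERIV fderiv_works) auto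
  ultimately show ?case
    by (rule Ck_on_SucI[OF \<open>open U\<close>, rotated])
qed

lemma Ck_on_sum:
  assumes "open U" "finite I" "\<And>i. i \<in> I \<Longrightarrow> Ck_on k (f i) U"
  shows "Ck_on k (\<lambda>x. \<Sum>i\<in>I. f i x) U"
  using assms(2,3) by (induction I rule: finite_induct) (auto intro: Ck_on_const Ck_on_add[OF \<open>open U\<close>])

text \<open>Allows families of linear maps to be treated one fixed basis vector at a time instead of
  in operator norm, even when they are applied to a varying vector.\<close>

lemma linear_basis_expansion:
  assumes "linear L"
  shows "L v = (\<Sum>b\<in>Basis. (v \<bullet> b) *\<^sub>R L b)"
  by (subst euclidean_representation[of v, symmetric])
     (simp add: linear_sum[OF assms] linear_scale[OF assms] o_def)

text \<open>The chain rule is expanded in a basis: its coefficients come from the derivative of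
  \<open>f\<close>, and the induction hypothesis applies to \<open>fderiv g y b\<close> for each
  fixed \<open>b\<close>, with the same inner map \<open>f\<close>.\<close>

lemma Ck_on_compose:
  fixes f :: "'a::euclidean_space \<Rightarrow> 'b::euclidean_space"
  assumes "open U" "open V" "f ` U \<subseteq> V" "Ck_on k f U" "Ck_on k g V"
  shows "Ck_on k (\<lambda>x. g (f x)) U"
  using assms(4,5)
proof (induction k arbitrary: g)
  case 0
  then show ?case using assms by (auto intro: continuous_on_compose2)
next
  case (Suc k)
  have h: "((\<lambda>x. g (f x)) has_derivative (\<lambda>v. \<Sum>b\<in>Basis. (fderiv f x v \<bullet> b) *\<^sub>R fderiv g (f x) b)) (at x)"
    if "x \<in> U" for x
  proof -
    have f: "(f has_derivative fderiv f x) (at x)" and g: "(g has_derivative fderiv g (f x)) (at (f x))"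
      using Suc.prems that assms(3) by (auto intro!: fderiv_works)
    from has_derivative_compose[OF this] show ?thesis
      by (simp only: linear_basis_expansion[OF has_derivative_linear[OF g], symmetric])
  qed
  have f1: "Ck_on k (\<lambda>x. fderiv f x v \<bullet> b) U" for b v
    using Suc.prems by (intro Ck_on_linear_compose[OF \<open>open U\<close> bounded_linear_inner_left]) simp
  have g1: "Ck_on k (\<lambda>x. fderiv g (f x) b) U" for b
  proof (rule Suc.IH)
    show "Ck_on k f U" by (rule Ck_on_Suc_imp) fact
    show "Ck_on k (\<lambda>y. fderiv g y b) V" using Suc.prems by simp
  qed
  have "Ck_on k (\<lambda>x. \<Sum>b\<in>Basis. (fderiv f x v \<bullet> b) *\<^sub>R fderiv g (f x) b) U" for v
    by (intro Ck_on_sum bounded_bilinear.Ck_on[OF bounded_bilinear_scaleR] \<open>open U\<close> f1 g1) auto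
  with h show ?case by (rule Ck_on_SucI[OF \<open>open U\<close>])
qed

section \<open>Smooth maps on open sets\<close>

lemma smooth_on_cong:
  "open U \<Longrightarrow> (\<And>x. x \<in> U \<Longrightarrow> f x = g x) \<Longrightarrow> smooth_on U f \<Longrightarrow> smooth_on U g"
  unfolding smooth_on_def using Ck_on_cong by blast

lemma smooth_on_subset: "smooth_on U f \<Longrightarrow> V \<subseteq> U \<Longrightarrow> smooth_on V f"
  unfolding smooth_on_def using Ck_on_subset by blast

lemma smooth_on_local:
  assumes "\<And>x. x \<in> U \<Longrightarrow> \<exists>V. open V \<and> x \<in> V \<and> smooth_on V f"
  shows "smooth_on U f"
  unfolding smooth_on_def
proof
  show "Ck_on k f U" for k
    by (rule Ck_on_local) (use assms in \<open>auto simp: smooth_on_def\<close>)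
qed

lemma smooth_on_differentiable: "smooth_on U f \<Longrightarrow> x \<in> U \<Longrightarrow> f differentiable at x"
  unfolding smooth_on_def by (metis Ck_on.simps(2))

lemma smooth_on_has_derivative:
  "smooth_on U f \<Longrightarrow> x \<in> U \<Longrightarrow> (f has_derivative fderiv f x) (at x)"
  by (simp add: fderiv_works smooth_on_differentiable)

lemma smooth_on_linear_fderiv: "smooth_on U f \<Longrightarrow> x \<in> U \<Longrightarrow> linear (fderiv f x)"
  by (simp add: linear_frechet_derivative smooth_on_differentiable)

lemma smooth_on_continuous: "smooth_on U f \<Longrightarrow> continuous_on U f"
  unfolding smooth_on_def by (metis Ck_on.simps(1))

lemma smooth_on_fderiv: "smooth_on U f \<Longrightarrow> smooth_on U (\<lambda>x. fderiv f x v)"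
  unfolding smooth_on_def by (metis Ck_on.simps(2))

lemma smooth_on_const: "smooth_on U (\<lambda>x. c)"
  by (simp add: smooth_on_def Ck_on_const)

lemma smooth_on_bounded_linear: "bounded_linear L \<Longrightarrow> smooth_on U L"
  by (simp add: smooth_on_def Ck_on_bounded_linear)

lemma smooth_on_add: "open U \<Longrightarrow> smooth_on U f \<Longrightarrow> smooth_on U g \<Longrightarrow> smooth_on U (\<lambda>x. f x + g x)"
  by (simp add: smooth_on_def Ck_on_add)

lemma smooth_on_sum:
  "open U \<Longrightarrow> finite I \<Longrightarrow> (\<And>i. i \<in> I \<Longrightarrow> smooth_on U (f i)) \<Longrightarrow> smooth_on U (\<lambda>x. \<Sum>i\<in>I. f i x)"
  by (simp add: smooth_on_def Ck_on_sum)

lemma smooth_on_linear_compose: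
  "open U \<Longrightarrow> bounded_linear L \<Longrightarrow> smooth_on U f \<Longrightarrow> smooth_on U (\<lambda>x. L (f x))"
  by (simp add: smooth_on_def Ck_on_linear_compose)

lemma smooth_on_scaleR:
  "open U \<Longrightarrow> smooth_on U f \<Longrightarrow> smooth_on U g \<Longrightarrow> smooth_on U (\<lambda>x. f x *\<^sub>R g x)"
  by (simp add: smooth_on_def bounded_bilinear.Ck_on[OF bounded_bilinear_scaleR])

lemma smooth_on_compose:
  fixes f :: "'a::euclidean_space \<Rightarrow> 'b::euclidean_space"
  shows "open U \<Longrightarrow> open V \<Longrightarrow> smooth_on U f \<Longrightarrow> smooth_on V g \<Longrightarrow> f ` U \<subseteq> V \<Longrightarrow>
    smooth_on U (\<lambda>x. g (f x))"
  unfolding smooth_on_def using Ck_on_compose by blast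

lemma smooth_on_apply_family:
  assumes "open U" "\<And>x. x \<in> U \<Longrightarrow> linear (\<Lambda> x)" "\<And>b. smooth_on U (\<lambda>x. \<Lambda> x b)" "smooth_on U h"
  shows "smooth_on U (\<lambda>x. \<Lambda> x (h x :: 'b::euclidean_space))"
proof (rule smooth_on_cong[OF \<open>open U\<close>])
  show "(\<Sum>b\<in>Basis. (h x \<bullet> b) *\<^sub>R \<Lambda> x b) = \<Lambda> x (h x)" if "x \<in> U" for x
    using linear_basis_expansion[OF assms(2)[OF that], of "h x"] by simp
  show "smooth_on U (\<lambda>x. \<Sum>b\<in>Basis. (h x \<bullet> b) *\<^sub>R \<Lambda> x b)"
    using assms by (intro smooth_on_sum smooth_on_scaleR smooth_on_linear_compose[OF _ bounded_linear_inner_left]) auto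
qed

lemma smooth_on_fderiv_apply:
  fixes f :: "'b::euclidean_space \<Rightarrow> 'c::real_normed_vector" and g :: "'a::euclidean_space \<Rightarrow> 'b"
  assumes "open U" "open V" "smooth_on V f" "smooth_on U g" "g ` U \<subseteq> V" "smooth_on U h"
  shows "smooth_on U (\<lambda>x. fderiv f (g x) (h x))"
proof (rule smooth_on_apply_family[OF \<open>open U\<close>])
  show "linear (fderiv f (g x))" if "x \<in> U" for x
    using assms that by (intro smooth_on_linear_fderiv) auto
  show "smooth_on U (\<lambda>x. fderiv f (g x) b)" for b
    by (rule smooth_on_compose[OF assms(1,2,4) smooth_on_fderiv[OF assms(3)] assms(5)])
qed fact

text \<open>A product rule at a zero of \<open>F\<close>. The increment is the remainder of
  \<open>F\<close> times \<Lambda> plus the linear part of \<open>F\<close> times the change of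
  \<Lambda>; both are of smaller order as soon as \<Lambda> is continuous, so \<Lambda> is never
  differentiated.\<close>

lemma has_derivative_apply_at_zero:
  fixes F :: "'a::real_normed_vector \<Rightarrow> 'b::euclidean_space"
    and \<Lambda> :: "'a \<Rightarrow> 'b \<Rightarrow> 'c::real_normed_vector"
  assumes F: "(F has_derivative F') (at z)" "F z = 0"
    and U: "open U" "z \<in> U" and lin: "\<And>x. x \<in> U \<Longrightarrow> linear (\<Lambda> x)" and cont: "\<And>b. isCont (\<lambda>x. \<Lambda> x b) z"
  shows "((\<lambda>x. \<Lambda> x (F x)) has_derivative (\<lambda>v. \<Lambda> z (F' v))) (at z)"
proof -
  have *: "((\<lambda>x. (F x \<bullet> b) *\<^sub>R \<Lambda> x b) has_derivative (\<lambda>v. (F' v \<bullet> b) *\<^sub>R \<Lambda> z b)) (at z)" for b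
  proof -
    define f where "f x = F x \<bullet> b" for x
    define f' where "f' v = F' v \<bullet> b" for v
    have f: "(f has_derivative f') (at z)" "f z = 0"
      unfolding f_def f'_def using F by (auto intro: has_derivative_inner_left)
    interpret bounded_linear f' using f(1) by (rule has_derivative_bounded_linear)
    obtain K where K: "norm (f' v) \<le> norm v * K" for v
      using bounded by blast
    have lim: "((\<lambda>y. norm (f y - f' (y - z)) / norm (y - z)) \<longlongrightarrow> 0) (at z)"
      using f unfolding has_derivative_iff_norm by simp
    have g: "((\<lambda>y. \<Lambda> y b) \<longlongrightarrow> \<Lambda> z b) (at z)"
      using cont isContD by blast
    have "((\<lambda>y. norm (f y - f' (y - z)) / norm (y - z) * norm (\<Lambda> y b) + K * norm (\<Lambda> y b - \<Lambda> z b))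
        \<longlongrightarrow> 0 * norm (\<Lambda> z b) + K * norm (\<Lambda> z b - \<Lambda> z b)) (at z)"
      by (intro tendsto_intros lim g)
    then have lim2: "((\<lambda>y. norm (f y - f' (y - z)) / norm (y - z) * norm (\<Lambda> y b) + K * norm (\<Lambda> y b - \<Lambda> z b))
        \<longlongrightarrow> 0) (at z)" by simp
    have bound: "norm (f y *\<^sub>R \<Lambda> y b - f z *\<^sub>R \<Lambda> z b - f' (y - z) *\<^sub>R \<Lambda> z b) / norm (y - z)
       \<le> norm (f y - f' (y - z)) / norm (y - z) * norm (\<Lambda> y b) + K * norm (\<Lambda> y b - \<Lambda> z b)"
      if "y \<noteq> z" for y
    proof -
      have "f y *\<^sub>R \<Lambda> y b - f z *\<^sub>R \<Lambda> z b - f' (y - z) *\<^sub>R \<Lambda> z b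
        = (f y - f' (y - z)) *\<^sub>R \<Lambda> y b + f' (y - z) *\<^sub>R (\<Lambda> y b - \<Lambda> z b)"
        by (simp add: f algebra_simps)
      also have "norm \<dots> \<le> norm (f y - f' (y - z)) * norm (\<Lambda> y b) + norm (y - z) * K * norm (\<Lambda> y b - \<Lambda> z b)"
        using K[of "y - z"] by (intro norm_triangle_le add_mono) (auto intro: mult_right_mono)
      finally show ?thesis using that by (simp add: field_simps)
    qed
    have "((\<lambda>y. norm (f y *\<^sub>R \<Lambda> y b - f z *\<^sub>R \<Lambda> z b - f' (y - z) *\<^sub>R \<Lambda> z b) / norm (y - z)) \<longlongrightarrow> 0) (at z)"
      by (rule Lim_null_comparison[OF _ lim2])
         (use bound in \<open>auto simp: eventually_at_filter intro!: always_eventually\<close>)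
    moreover have "bounded_linear (\<lambda>v. f' v *\<^sub>R \<Lambda> z b)"
      by (rule bounded_linear_scaleR_const) (rule bounded_linear_axioms)
    ultimately show ?thesis
      unfolding has_derivative_iff_norm f_def f'_def by simp
  qed
  have "((\<lambda>x. \<Sum>b\<in>Basis. (F x \<bullet> b) *\<^sub>R \<Lambda> x b) has_derivative (\<lambda>v. \<Sum>b\<in>Basis. (F' v \<bullet> b) *\<^sub>R \<Lambda> z b)) (at z)"
    by (intro has_derivative_sum *)
  then have "((\<lambda>x. \<Sum>b\<in>Basis. (F x \<bullet> b) *\<^sub>R \<Lambda> x b) has_derivative (\<lambda>v. \<Lambda> z (F' v))) (at z)"
    by (simp only: linear_basis_expansion[OF lin[OF U(2)], symmetric])
  then show ?thesis
    by (rule has_derivative_transform_within_open[OF _ U])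
       (simp only: linear_basis_expansion[OF lin, symmetric])
qed

section \<open>Second differences and the symmetry of second derivatives\<close>

lemma smooth_on_line_derivative:
  fixes f :: "'a::euclidean_space \<Rightarrow> real"
  assumes "smooth_on U f" "y + s *\<^sub>R u \<in> U"
  shows "((\<lambda>s. f (y + s *\<^sub>R u)) has_real_derivative fderiv f (y + s *\<^sub>R u) u) (at s)"
proof -
  note f = smooth_on_has_derivative[OF assms]
  have "((\<lambda>s. f (y + s *\<^sub>R u)) has_derivative (\<lambda>r. fderiv f (y + s *\<^sub>R u) (r *\<^sub>R u))) (at s)"
    by (rule has_derivative_compose[of "\<lambda>s. y + s *\<^sub>R u", OF _ f]) (auto intro!: derivative_eq_intros)
  moreover have "(\<lambda>r. fderiv f (y + s *\<^sub>R u) (r *\<^sub>R u)) = (*) (fderiv f (y + s *\<^sub>R u) u)"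
    using linear_scale[OF has_derivative_linear[OF f]] by auto
  ultimately show ?thesis by (simp add: has_field_derivative_def)
qed

text \<open>Two mean value theorems, in the direction \<open>u\<close> and then in the direction
  \<open>w\<close>, turn the second difference into \<open>h\<^sup>2\<close> times the mixed
  derivative at an intermediate point, and continuity does the rest. Since the second difference is
  symmetric in \<open>u\<close> and \<open>w\<close>, so is its limit.\<close>

lemma tendsto_second_difference:
  fixes f :: "'a::euclidean_space \<Rightarrow> real"
  assumes U: "open U" "x \<in> U" and f: "smooth_on U f"
  shows "((\<lambda>h. (f (x + h *\<^sub>R u + h *\<^sub>R w) - f (x + h *\<^sub>R u) - f (x + h *\<^sub>R w) + f x) / h\<^sup>2)
    \<longlongrightarrow> fderiv (\<lambda>y. fderiv f y u) x w) (at_right 0)"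
proof -
  define A where "A y = fderiv f y u" for y
  define C where "C y = fderiv A y w" for y
  have A: "smooth_on U A" unfolding A_def using f by (rule smooth_on_fderiv)
  have C: "smooth_on U C" unfolding C_def using A by (rule smooth_on_fderiv)
  show ?thesis
    unfolding A_def[symmetric] C_def[symmetric]
  proof (rule tendstoI)
    fix e :: real assume "e > 0"
    have "isCont C x"
      using smooth_on_continuous[OF C] U continuous_on_eq_continuous_at by blast
    then obtain d1 where d1: "d1 > 0" "\<And>y. dist y x < d1 \<Longrightarrow> dist (C y) (C x) < e"
      using \<open>e > 0\<close> unfolding continuous_at_eps_delta by blast
    obtain d2 where d2: "d2 > 0" "ball x d2 \<subseteq> U"
      using U open_contains_ball by blast
    \<comment> \<open>This bound on both parameters keeps
      \<open>s *\<^sub>R u + t *\<^sub>R w\<close> shorter than \<open>min d1 d2\<close>; the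
      summand 1 keeps the denominator positive when both directions vanish.\<close>
    define d where "d = min d1 d2 / (norm u + norm w + 1)"
    have "norm u + norm w + 1 > 0" by (simp add: add_nonneg_pos)
    then have "d > 0" using d1 d2 by (simp add: d_def)
    have near: "dist (x + s *\<^sub>R u + t *\<^sub>R w) x < min d1 d2" if "0 \<le> s" "s < d" "0 \<le> t" "t < d" for s t
    proof -
      have "dist (x + s *\<^sub>R u + t *\<^sub>R w) x = norm (s *\<^sub>R u + t *\<^sub>R w)"
        by (simp add: dist_norm algebra_simps)
      also have "\<dots> \<le> s * norm u + t * norm w"
        using norm_triangle_ineq[of "s *\<^sub>R u" "t *\<^sub>R w"] that by simp
      also have "\<dots> \<le> d * norm u + d * norm w"
        using that by (intro add_mono mult_right_mono) auto
      also have "\<dots> < d * (norm u + norm w + 1)"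
        using \<open>d > 0\<close> by (simp add: algebra_simps)
      also have "\<dots> = min d1 d2"
        using \<open>norm u + norm w + 1 > 0\<close> by (simp add: d_def)
      finally show ?thesis .
    qed
    have inU: "x + s *\<^sub>R u + t *\<^sub>R w \<in> U" if "0 \<le> s" "s < d" "0 \<le> t" "t < d" for s t
      using near[OF that] d2 by (auto simp: dist_commute)
    have main: "dist ((f (x + h *\<^sub>R u + h *\<^sub>R w) - f (x + h *\<^sub>R u) - f (x + h *\<^sub>R w) + f x) / h\<^sup>2) (C x) < e"
      if h: "0 < h" "h < d" for h
    proof -
      define \<phi> where "\<phi> s = f (x + s *\<^sub>R u + h *\<^sub>R w) - f (x + s *\<^sub>R u)" for s
      have d\<phi>: "(\<phi> has_real_derivative A (x + s *\<^sub>R u + h *\<^sub>R w) - A (x + s *\<^sub>R u)) (at s)"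
        if "0 \<le> s" "s \<le> h" for s
      proof -
        have "x + s *\<^sub>R u + t *\<^sub>R w = (x + t *\<^sub>R w) + s *\<^sub>R u" for t by simp
        then have "((\<lambda>s. f (x + s *\<^sub>R u + t *\<^sub>R w)) has_real_derivative A (x + s *\<^sub>R u + t *\<^sub>R w)) (at s)"
          if "0 \<le> t" "t \<le> h" for t
          using smooth_on_line_derivative[OF f, of "x + t *\<^sub>R w" s u] inU[of s t] \<open>0 \<le> s\<close> \<open>s \<le> h\<close> h that
          by (simp add: A_def add.assoc add.commute[of "_ *\<^sub>R w"])
        from this[of h] this[of 0] show ?thesis
          unfolding \<phi>_def using h by (intro DERIV_diff) auto
      qed
      obtain \<xi> where \<xi>: "0 < \<xi>" "\<xi> < h" "\<phi> h - \<phi> 0 = (h - 0) * (A (x + \<xi> *\<^sub>R u + h *\<^sub>R w) - A (x + \<xi> *\<^sub>R u))"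
        using MVT2[OF h(1) d\<phi>] by auto
      define \<psi> where "\<psi> t = A (x + \<xi> *\<^sub>R u + t *\<^sub>R w)" for t
      have d\<psi>: "(\<psi> has_real_derivative C (x + \<xi> *\<^sub>R u + t *\<^sub>R w)) (at t)" if "0 \<le> t" "t \<le> h" for t
        unfolding \<psi>_def C_def
        using inU[of \<xi> t] \<xi> h that by (intro smooth_on_line_derivative[OF A]) auto
      obtain \<eta> where \<eta>: "0 < \<eta>" "\<eta> < h" "\<psi> h - \<psi> 0 = (h - 0) * C (x + \<xi> *\<^sub>R u + \<eta> *\<^sub>R w)"
        using MVT2[OF h(1) d\<psi>] by auto
      have "f (x + h *\<^sub>R u + h *\<^sub>R w) - f (x + h *\<^sub>R u) - f (x + h *\<^sub>R w) + f x = \<phi> h - \<phi> 0"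
        by (simp add: \<phi>_def)
      also have "\<dots> = h\<^sup>2 * C (x + \<xi> *\<^sub>R u + \<eta> *\<^sub>R w)"
        using \<xi>(3) \<eta>(3) by (simp add: \<psi>_def power2_eq_square)
      finally show ?thesis
        using h d1(2)[of "x + \<xi> *\<^sub>R u + \<eta> *\<^sub>R w"] near[of \<xi> \<eta>] \<xi> \<eta> by auto
    qed
    show "\<forall>\<^sub>F h in at_right 0. dist ((f (x + h *\<^sub>R u + h *\<^sub>R w) - f (x + h *\<^sub>R u) - f (x + h *\<^sub>R w) + f x) / h\<^sup>2) (C x) < e"
      using eventually_at_right_real[OF \<open>d > 0\<close>] by eventually_elim (use main in auto)
  qed
qed

lemma fderiv_inner:
  "f differentiable at x \<Longrightarrow> fderiv (\<lambda>y. f y \<bullet> b) x v = fderiv f x v \<bullet> b"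
  using fderiv_eq[OF has_derivative_inner_left[OF fderiv_works]] by metis

lemma second_derivative_symmetric_real:
  fixes f :: "'a::euclidean_space \<Rightarrow> real"
  assumes "open U" "x \<in> U" "smooth_on U f"
  shows "fderiv (\<lambda>y. fderiv f y u) x w = fderiv (\<lambda>y. fderiv f y w) x u"
proof (rule tendsto_unique[OF _ tendsto_second_difference[OF assms]])
  show "((\<lambda>h. (f (x + h *\<^sub>R u + h *\<^sub>R w) - f (x + h *\<^sub>R u) - f (x + h *\<^sub>R w) + f x) / h\<^sup>2)
      \<longlongrightarrow> fderiv (\<lambda>y. fderiv f y w) x u) (at_right 0)"
    using tendsto_second_difference[OF assms, of w u] by (simp add: algebra_simps)
qed simp

lemma second_derivative_symmetric:
  fixes f :: "'a::euclidean_space \<Rightarrow> 'b::euclidean_space"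
  assumes "open U" "x \<in> U" "smooth_on U f"
  shows "fderiv (\<lambda>y. fderiv f y u) x w = fderiv (\<lambda>y. fderiv f y w) x u"
proof (rule euclidean_eqI)
  fix b :: 'b assume "b \<in> Basis"
  have comp: "fderiv (\<lambda>y. fderiv f y u) x w \<bullet> b = fderiv (\<lambda>y. fderiv (\<lambda>y. f y \<bullet> b) y u) x w" for u w
  proof -
    have "fderiv (\<lambda>y. fderiv f y u) x w \<bullet> b = fderiv (\<lambda>y. fderiv f y u \<bullet> b) x w"
      using assms by (intro fderiv_inner[symmetric] smooth_on_differentiable[OF smooth_on_fderiv])
    moreover have "fderiv (\<lambda>y. fderiv (\<lambda>y. f y \<bullet> b) y u) x = fderiv (\<lambda>y. fderiv f y u \<bullet> b) x"
    proof (rule fderiv_cong_open(2)[OF assms(1,2)])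
      show "fderiv f y u \<bullet> b = fderiv (\<lambda>y. f y \<bullet> b) y u" if "y \<in> U" for y
        using assms that by (intro fderiv_inner[symmetric] smooth_on_differentiable)
      show "(\<lambda>y. fderiv f y u \<bullet> b) differentiable at x"
        using assms by (intro smooth_on_differentiable[of U] smooth_on_linear_compose[OF _ bounded_linear_inner_left] smooth_on_fderiv)
    qed
    ultimately show ?thesis by simp
  qed
  show "fderiv (\<lambda>y. fderiv f y u) x w \<bullet> b = fderiv (\<lambda>y. fderiv f y w) x u \<bullet> b"
    unfolding comp
    by (rule second_derivative_symmetric_real[OF assms(1,2)])
       (rule smooth_on_linear_compose[OF assms(1) bounded_linear_inner_left assms(3)])
qed

subsection \<open>Solutions of smooth families of linear equations\<close>

context
  fixes U :: "'a::euclidean_space set" and \<omega> :: "'a \<Rightarrow> 'e::euclidean_space \<Rightarrow> 'e \<Rightarrow> real"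
  assumes U: "open U"
    and \<omega>_lin: "\<And>z w. z \<in> U \<Longrightarrow> linear (\<lambda>u. \<omega> z u w)" "\<And>z u. z \<in> U \<Longrightarrow> linear (\<omega> z u)"
    and \<omega>_nondeg: "\<And>z u. z \<in> U \<Longrightarrow> (\<And>w. \<omega> z u w = 0) \<Longrightarrow> u = 0"
    and \<omega>_smooth: "\<And>u w. smooth_on U (\<lambda>z. \<omega> z u w)"
begin

text \<open>The change of the map from vectors to covectors induced by the form when the base point
  moves from \<open>z0\<close> to \<open>z\<close>, with covectors written as vectors in the
  standard basis.\<close>

definition sharp_residual :: "'a \<Rightarrow> 'a \<Rightarrow> 'e \<Rightarrow> 'e" where
  "sharp_residual z0 z u = (\<Sum>b\<in>Basis. (\<omega> z u b - \<omega> z0 u b) *\<^sub>R b)"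

lemma linear_sharp_residual:
  "z0 \<in> U \<Longrightarrow> z \<in> U \<Longrightarrow> linear (sharp_residual z0 z)"
  using \<omega>_lin(1)[of z] \<omega>_lin(1)[of z0] unfolding sharp_residual_def
  by (intro linear_compose_sum ballI) (auto simp: linear_iff algebra_simps)

lemma sharp_residual_smooth: "smooth_on U (\<lambda>z. sharp_residual z0 z u)"
  unfolding sharp_residual_def
  using smooth_on_add[OF U \<omega>_smooth smooth_on_const[of U "- \<omega> z0 u _"]]
  by (intro smooth_on_sum smooth_on_scaleR smooth_on_const U) auto

text \<open>Solving with the form frozen at \<^term>\<open>z0\<close> makes the solution \<^term>\<open>X\<close> at \<^term>\<open>z\<close> a fixed
  point; the coefficient of the term in \<^term>\<open>X\<close> vanishes at \<^term>\<open>z0\<close>, which gives continuity of the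
  solution at \<^term>\<open>z0\<close>, and then differentiability.\<close>

lemma solution_fixed_point:
  assumes "z0 \<in> U"
  obtains G where "linear G"
    "\<And>X \<alpha> z. z \<in> U \<Longrightarrow> (\<And>w. \<omega> z X w = \<alpha> w) \<Longrightarrow>
       X = G (\<Sum>b\<in>Basis. \<alpha> b *\<^sub>R b) - G (sharp_residual z0 z X)"
proof -
  define J where "J u = (\<Sum>b\<in>Basis. \<omega> z0 u b *\<^sub>R b)" for u
  have J: "linear J"
    unfolding J_def using \<omega>_lin(1)[OF assms]
    by (intro linear_compose_sum ballI) (auto simp: linear_iff algebra_simps)
  have "inj J"
  proof (rule linear_injective_0[OF J, THEN iffD2], intro allI impI)
    fix u assume "J u = 0"
    then have "\<omega> z0 u b = 0" if "b \<in> Basis" for b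
      using that by (metis J_def inner_sum_left_Basis inner_zero_left)
    then have "\<omega> z0 u w = 0" for w
      using linear_basis_expansion[OF \<omega>_lin(2)[OF assms], of u w] by simp
    then show "u = 0" using \<omega>_nondeg[OF assms] by blast
  qed
  then obtain G where G: "linear G" "G \<circ> J = id"
    using linear_injective_left_inverse[OF J] by blast
  have "X = G (\<Sum>b\<in>Basis. \<alpha> b *\<^sub>R b) - G (sharp_residual z0 z X)"
    if "\<And>w. \<omega> z X w = \<alpha> w" for X \<alpha> z
  proof -
    have "(\<Sum>b\<in>Basis. \<alpha> b *\<^sub>R b) - sharp_residual z0 z X = J X"
      by (simp add: sharp_residual_def J_def that sum_subtractf[symmetric] algebra_simps)
    then show ?thesis
      using G by (metis comp_apply id_apply linear_diff)
  qed
  then show ?thesis using that G(1) by blast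
qed

text \<open>An a priori estimate: subtracting the fixed point equations at \<open>z\<close> and at
  \<open>z0\<close> bounds \<open>X z - X z0\<close> by terms tending to 0 plus a small multiple of
  itself.\<close>

lemma solution_isCont:
  assumes "z0 \<in> U" "\<And>w. continuous_on U (\<lambda>z. \<alpha> z w)"
    and X: "\<And>z w. z \<in> U \<Longrightarrow> \<omega> z (X z) w = \<alpha> z w"
  shows "isCont X z0"
proof -
  obtain G where G: "linear G" "\<And>X \<alpha> z. z \<in> U \<Longrightarrow> (\<And>w. \<omega> z X w = \<alpha> w) \<Longrightarrow>
       X = G (\<Sum>b\<in>Basis. \<alpha> b *\<^sub>R b) - G (sharp_residual z0 z X)"
    using solution_fixed_point[OF assms(1)] by blast
  let ?R = "sharp_residual z0"
  define \<beta> where "\<beta> z = (\<Sum>b\<in>Basis. \<alpha> z b *\<^sub>R b)" for z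
  define k where "k z = (\<Sum>b\<in>Basis. norm (?R z b))" for z
  obtain C where C: "C > 0" "\<And>v. norm (G v) \<le> C * norm v"
    using linear_bounded_pos[OF G(1)] by blast
  have Rk: "norm (?R z u) \<le> k z * norm u" if "z \<in> U" for z u
  proof -
    have "norm (?R z u) = norm (\<Sum>b\<in>Basis. (u \<bullet> b) *\<^sub>R ?R z b)"
      using linear_basis_expansion[OF linear_sharp_residual[OF assms(1) that], of u] by simp
    also have "\<dots> \<le> (\<Sum>b\<in>Basis. norm u * norm (?R z b))"
      by (rule sum_norm_le) (auto intro!: mult_right_mono Basis_le_norm)
    finally show ?thesis by (simp add: k_def sum_distrib_left mult.commute)
  qed
  have contR: "isCont (\<lambda>z. ?R z u) z0" for u
    using smooth_on_continuous[OF sharp_residual_smooth] assms(1) U continuous_on_eq_continuous_at by blast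
  have R0: "?R z0 u = 0" for u
    by (simp add: sharp_residual_def)
  have "isCont (\<lambda>z. \<alpha> z w) z0" for w
    using assms(1,2) U continuous_on_eq_continuous_at by blast
  then have c\<beta>: "isCont \<beta> z0" unfolding \<beta>_def by (intro continuous_intros) auto
  have ck: "isCont k z0" unfolding k_def by (intro continuous_intros contR)
  have k0: "k z0 = 0" by (simp add: k_def R0)
  have eU: "\<forall>\<^sub>F z in at z0. z \<in> U"
    using U assms(1) by (simp add: eventually_at_topological) blast
  have "((\<lambda>z. C * k z) \<longlongrightarrow> C * k z0) (at z0)"
    using ck by (intro tendsto_intros) (simp add: isCont_def)
  \<comment> \<open>With the coefficient below 1/2, the multiple of \<open>norm (X z - X z0)\<close>
    on the right is absorbed by the left side at the cost of a factor 2.\<close>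
  then have "\<forall>\<^sub>F z in at z0. C * k z < 1 / 2"
    by (rule order_tendstoD(2)) (simp add: k0)
  then have "\<forall>\<^sub>F z in at z0. norm (X z - X z0) \<le> 2 * C * norm (\<beta> z - \<beta> z0) + 2 * C * k z * norm (X z0)"
    using eU
  proof eventually_elim
    case (elim z)
    have "X z = G (\<beta> z) - G (?R z (X z))"
      unfolding \<beta>_def using G(2)[of z "X z" "\<alpha> z"] X elim by simp
    moreover have "X z0 = G (\<beta> z0)"
      unfolding \<beta>_def using G(2)[of z0 "X z0" "\<alpha> z0"] X assms(1) by (simp add: R0 linear_0[OF G(1)])
    ultimately have "X z - X z0 = G (\<beta> z - \<beta> z0) - G (?R z (X z))"
      by (simp add: linear_diff[OF G(1)])
    then have 1: "norm (X z - X z0) \<le> norm (G (\<beta> z - \<beta> z0)) + norm (G (?R z (X z)))"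
      using norm_triangle_ineq4 by metis
    have 2: "norm (G (\<beta> z - \<beta> z0)) \<le> C * norm (\<beta> z - \<beta> z0)" by (rule C)
    have "norm (G (?R z (X z))) \<le> C * (k z * norm (X z))"
      using C(2)[of "?R z (X z)"] Rk[OF elim(2), of "X z"] C(1)
      by (meson mult_left_mono order.strict_implies_order order.trans)
    also have "\<dots> \<le> C * (k z * (norm (X z - X z0) + norm (X z0)))"
      using norm_triangle_sub[of "X z" "X z0"] C(1)
      by (intro mult_left_mono) (simp_all add: k_def sum_nonneg add.commute)
    also have "\<dots> = (C * k z) * norm (X z - X z0) + C * k z * norm (X z0)"
      by (simp add: algebra_simps)
    finally have 3: "norm (G (?R z (X z))) \<le> (C * k z) * norm (X z - X z0) + C * k z * norm (X z0)" .
    have 4: "(C * k z) * norm (X z - X z0) \<le> 1 / 2 * norm (X z - X z0)"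
      using elim(1) by (intro mult_right_mono) auto
    show ?case
      using 1 2 3 4 by linarith
  qed
  moreover have "((\<lambda>z. 2 * C * norm (\<beta> z - \<beta> z0) + 2 * C * k z * norm (X z0)) \<longlongrightarrow>
      2 * C * norm (\<beta> z0 - \<beta> z0) + 2 * C * k z0 * norm (X z0)) (at z0)"
    using c\<beta> ck by (intro tendsto_intros) (simp_all add: isCont_def)
  then have "((\<lambda>z. 2 * C * norm (\<beta> z - \<beta> z0) + 2 * C * k z * norm (X z0)) \<longlongrightarrow> 0) (at z0)"
    by (simp add: k0)
  ultimately have "((\<lambda>z. X z - X z0) \<longlongrightarrow> 0) (at z0)"
    by (rule Lim_null_comparison)
  then show ?thesis by (simp add: isCont_def LIM_zero_iff)
qed

text \<open>In the fixed point equation the residual is differentiable and vanishes at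
  \<open>z0\<close>, while the solution is known to be continuous there. These are exactly the two
  factors of the product rule at a zero.\<close>

lemma solution_differentiable:
  assumes "z0 \<in> U" "\<And>w z. z \<in> U \<Longrightarrow> (\<lambda>z. \<alpha> z w) differentiable at z"
    and X: "\<And>z w. z \<in> U \<Longrightarrow> \<omega> z (X z) w = \<alpha> z w"
  shows "X differentiable at z0"
proof -
  obtain G where G: "linear G" "\<And>X \<alpha> z. z \<in> U \<Longrightarrow> (\<And>w. \<omega> z X w = \<alpha> w) \<Longrightarrow>
       X = G (\<Sum>b\<in>Basis. \<alpha> b *\<^sub>R b) - G (sharp_residual z0 z X)"
    using solution_fixed_point[OF assms(1)] by blast
  let ?R = "sharp_residual z0"
  have contX: "isCont X z0"
    by (rule solution_isCont[OF assms(1) _ X])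
       (auto intro!: continuous_at_imp_continuous_on differentiable_imp_continuous_within assms)
  have "((\<lambda>z. (X z \<bullet> b) *\<^sub>R ?R z b) has_derivative (\<lambda>v. (X z0 \<bullet> b) *\<^sub>R fderiv (\<lambda>z. ?R z b) z0 v)) (at z0)" for b
  proof (rule has_derivative_apply_at_zero[where \<Lambda> = "\<lambda>z u. (X z \<bullet> b) *\<^sub>R u" and U = UNIV])
    show "((\<lambda>z. ?R z b) has_derivative fderiv (\<lambda>z. ?R z b) z0) (at z0)"
      by (rule smooth_on_has_derivative[OF sharp_residual_smooth assms(1)])
  qed (auto intro!: continuous_intros contX simp: sharp_residual_def linear_iff algebra_simps)
  then have "(\<lambda>z. (X z \<bullet> b) *\<^sub>R ?R z b) differentiable at z0" for b
    by (rule differentiableI)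
  then have "(\<lambda>z. \<Sum>b\<in>Basis. (X z \<bullet> b) *\<^sub>R ?R z b) differentiable at z0"
    by (intro differentiable_sum) auto
  moreover have "(\<lambda>z. \<Sum>b\<in>Basis. \<alpha> z b *\<^sub>R b) differentiable at z0"
  proof (intro differentiable_sum finite_Basis ballI)
    show "(\<lambda>z. \<alpha> z b *\<^sub>R b) differentiable at z0" for b
      by (rule differentiableI, rule has_derivative_scaleR_left, rule fderiv_works, rule assms(2)[OF assms(1)])
  qed
  ultimately have "(\<lambda>z. G (\<Sum>b\<in>Basis. \<alpha> z b *\<^sub>R b) - G (\<Sum>b\<in>Basis. (X z \<bullet> b) *\<^sub>R ?R z b)) differentiable at z0"
    by (intro differentiable_diff differentiable_compose[OF linear_imp_differentiable[OF G(1)]])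
  then have "((\<lambda>z. G (\<Sum>b\<in>Basis. \<alpha> z b *\<^sub>R b) - G (\<Sum>b\<in>Basis. (X z \<bullet> b) *\<^sub>R ?R z b)) has_derivative
     fderiv (\<lambda>z. G (\<Sum>b\<in>Basis. \<alpha> z b *\<^sub>R b) - G (\<Sum>b\<in>Basis. (X z \<bullet> b) *\<^sub>R ?R z b)) z0) (at z0)"
    by (rule fderiv_works)
  then show ?thesis
  proof (rule differentiableI[OF has_derivative_transform_within_open[OF _ U assms(1)]])
    fix z assume z: "z \<in> U"
    have "X z = G (\<Sum>b\<in>Basis. \<alpha> z b *\<^sub>R b) - G (?R z (X z))"
      using G(2)[OF z, of "X z" "\<alpha> z"] X[OF z] by simp
    then show "G (\<Sum>b\<in>Basis. \<alpha> z b *\<^sub>R b) - G (\<Sum>b\<in>Basis. (X z \<bullet> b) *\<^sub>R ?R z b) = X z"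
      using linear_basis_expansion[OF linear_sharp_residual[OF assms(1) z], of "X z"] by simp
  qed
qed

text \<open>Differentiating the equation shows that a directional derivative of \<open>X\<close>
  solves an equation with the same form, whose right side involves only \<open>X\<close> itself and
  derivatives of the data. The induction hypothesis, being general in the right side and the
  solution, applies to it.\<close>

lemma solution_Ck:
  assumes "\<And>w. Ck_on k (\<lambda>z. \<alpha> z w) U" "\<And>z w. z \<in> U \<Longrightarrow> \<omega> z (X z) w = \<alpha> z w"
  shows "Ck_on k X U"
  using assms
proof (induction k arbitrary: \<alpha> X)
  case 0
  then show ?case
    using solution_isCont[of _ \<alpha> X] by (auto intro: continuous_at_imp_continuous_on)
next
  case (Suc k)
  have diff: "X differentiable at z" if "z \<in> U" for z
    using Suc.prems by (intro solution_differentiable[OF that]) auto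
  have Ck: "Ck_on k X U"
    by (rule Suc.IH[OF Ck_on_Suc_imp]) (use Suc.prems in auto)
  have "Ck_on k (\<lambda>z. fderiv X z v) U" for v
  proof (rule Suc.IH)
    let ?\<alpha> = "\<lambda>z w. fderiv (\<lambda>z. \<alpha> z w) z v + (- 1) *\<^sub>R (\<Sum>b\<in>Basis. (X z \<bullet> b) *\<^sub>R fderiv (\<lambda>z. \<omega> z b w) z v)"
    show "Ck_on k (\<lambda>z. ?\<alpha> z w) U" for w
    proof (intro Ck_on_add[OF U] Ck_on_linear_compose[OF U bounded_linear_scaleR_right] Ck_on_sum[OF U]
        bounded_bilinear.Ck_on[OF bounded_bilinear_scaleR U] finite_Basis)
      show "Ck_on k (\<lambda>z. fderiv (\<lambda>z. \<alpha> z w) z v) U"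
        using Suc.prems(1) by simp
      show "Ck_on k (\<lambda>z. fderiv (\<lambda>z. \<omega> z b w) z v) U" for b
        using smooth_on_fderiv[OF \<omega>_smooth] unfolding smooth_on_def by blast
      show "Ck_on k (\<lambda>z. X z \<bullet> b) U" for b
        by (rule Ck_on_linear_compose[OF U bounded_linear_inner_left Ck])
    qed
    show "\<omega> z (fderiv X z v) w = ?\<alpha> z w" if z: "z \<in> U" for z w
    proof -
      let ?s = "\<lambda>z. \<Sum>b\<in>Basis. (X z \<bullet> b) *\<^sub>R \<omega> z b w"
      have "(?s has_derivative (\<lambda>v. \<Sum>b\<in>Basis. (X z \<bullet> b) *\<^sub>R fderiv (\<lambda>z. \<omega> z b w) z v + (fderiv X z v \<bullet> b) *\<^sub>R \<omega> z b w)) (at z)"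
        by (intro has_derivative_sum has_derivative_scaleR has_derivative_inner_left fderiv_works[OF diff[OF z]]
            smooth_on_has_derivative[OF \<omega>_smooth z])
      then have "((\<lambda>z. \<alpha> z w) has_derivative (\<lambda>v. \<Sum>b\<in>Basis. (X z \<bullet> b) *\<^sub>R fderiv (\<lambda>z. \<omega> z b w) z v + (fderiv X z v \<bullet> b) *\<^sub>R \<omega> z b w)) (at z)"
      proof (rule has_derivative_transform_within_open[OF _ U z])
        show "?s y = \<alpha> y w" if "y \<in> U" for y
          using linear_basis_expansion[where L = "\<lambda>u. \<omega> y u w" and v = "X y", OF \<omega>_lin(1)[OF that]] Suc.prems(2)[OF that] by simp
      qed
      from fderiv_eq[OF this] show ?thesis
        using linear_basis_expansion[where L = "\<lambda>u. \<omega> z u w" and v = "fderiv X z v", OF \<omega>_lin(1)[OF z]] by (simp add: sum.distrib)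
    qed
  qed
  then show ?case using diff by simp
qed

lemma smooth_on_solution:
  assumes "\<And>w. smooth_on U (\<lambda>z. \<alpha> z w)" "\<And>z w. z \<in> U \<Longrightarrow> \<omega> z (X z) w = \<alpha> z w"
  shows "smooth_on U X"
  using solution_Ck[of _ \<alpha> X] assms unfolding smooth_on_def by blast

end

subsection \<open>Iterated directional derivatives\<close>

lemma iter_deriv_cong:
  assumes "open U" "x \<in> U" "\<And>y. y \<in> U \<Longrightarrow> f y = g y" "smooth_on U f"
  shows "iter_deriv vs f x = iter_deriv vs g x"
  using assms(3,4)
proof (induction vs arbitrary: f g)
  case Nil
  then show ?case using assms by simp
next
  case (Cons v vs)
  have "fderiv f y v = fderiv g y v" if "y \<in> U" for y
    using fderiv_cong_open(2)[OF \<open>open U\<close> that, of f g] Cons.prems smooth_on_differentiable[OF Cons.prems(2) that]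
    by simp
  then show ?case
    using Cons.IH[of "\<lambda>y. fderiv f y v" "\<lambda>y. fderiv g y v"] smooth_on_fderiv[OF Cons.prems(2)] by simp
qed

lemma smooth_on_iter_deriv: "smooth_on U f \<Longrightarrow> smooth_on U (iter_deriv vs f)"
  by (induction vs arbitrary: f) (auto intro: smooth_on_fderiv)

lemma iter_deriv_Cons:
  assumes "open U" "x \<in> U" "smooth_on U f" "\<And>y. y \<in> U \<Longrightarrow> (f has_derivative f' y) (at y)"
  shows "iter_deriv (v # vs) f x = iter_deriv vs (\<lambda>y. f' y v) x"
  unfolding iter_deriv.simps
  by (rule iter_deriv_cong[OF assms(1,2) _ smooth_on_fderiv[OF assms(3)]]) (simp add: fderiv_eq[OF assms(4)])

lemma iter_deriv_add:
  assumes "open U" "x \<in> U" "smooth_on U f" "smooth_on U g"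
  shows "iter_deriv vs (\<lambda>y. f y + g y) x = iter_deriv vs f x + iter_deriv vs g x"
  using assms(3,4)
proof (induction vs arbitrary: f g)
  case (Cons v vs)
  have "iter_deriv (v # vs) (\<lambda>y. f y + g y) x = iter_deriv vs (\<lambda>y. fderiv f y v + fderiv g y v) x"
    by (rule iter_deriv_Cons[OF assms(1,2)])
       (use Cons.prems assms(1) in \<open>auto intro: smooth_on_add has_derivative_add smooth_on_has_derivative\<close>)
  then show ?case
    using Cons.IH[of "\<lambda>y. fderiv f y v" "\<lambda>y. fderiv g y v"] Cons.prems smooth_on_fderiv by auto
qed simp

lemma iter_deriv_linear:
  assumes "open U" "x \<in> U" "smooth_on U f" "bounded_linear L"
  shows "iter_deriv vs (\<lambda>y. L (f y)) x = L (iter_deriv vs f x)"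
  using assms(3)
proof (induction vs arbitrary: f)
  case (Cons v vs)
  have "iter_deriv (v # vs) (\<lambda>y. L (f y)) x = iter_deriv vs (\<lambda>y. L (fderiv f y v)) x"
    by (rule iter_deriv_Cons[OF assms(1,2) smooth_on_linear_compose[OF assms(1,4) Cons.prems]
          bounded_linear.has_derivative[OF assms(4) smooth_on_has_derivative[OF Cons.prems]]])
  then show ?case
    using Cons.IH[of "\<lambda>y. fderiv f y v"] Cons.prems smooth_on_fderiv by auto
qed simp

subsection \<open>Rescaling a map transversally to a subspace\<close>

text \<open>The parameter value 0 belongs to the compact domain, so uniform continuity on the
  product gives the uniform limit directly.\<close>

lemma uniform_limit_at_right_0:
  fixes h :: "real \<Rightarrow> 'a::euclidean_space \<Rightarrow> 'b::real_normed_vector"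
  assumes "compact K" "\<delta> > 0" "continuous_on ({0..\<delta>} \<times> K) (\<lambda>(r, z). h r z)"
  shows "uniform_limit K h (h 0) (at_right 0)"
proof (rule uniform_limitI)
  fix e :: real assume "e > 0"
  have "uniformly_continuous_on ({0..\<delta>} \<times> K) (\<lambda>(r, z). h r z)"
    using assms by (intro compact_uniformly_continuous compact_Times) auto
  then obtain d where d: "d > 0" "\<And>p q. p \<in> {0..\<delta>} \<times> K \<Longrightarrow> q \<in> {0..\<delta>} \<times> K \<Longrightarrow> dist q p < d \<Longrightarrow>
      dist ((\<lambda>(r, z). h r z) q) ((\<lambda>(r, z). h r z) p) < e"
    using \<open>e > 0\<close> unfolding uniformly_continuous_on_def by metis
  have "min d \<delta> > 0" using d assms by simp
  from eventually_at_right_real[OF this]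
  show "\<forall>\<^sub>F r in at_right 0. \<forall>z\<in>K. dist (h r z) (h 0 z) < e"
  proof eventually_elim
    case (elim r)
    have "dist (h r z) (h 0 z) < e" if "z \<in> K" for z
      using d(2)[of "(0, z)" "(r, z)"] elim that assms(2) by (simp add: dist_Pair_Pair)
    then show ?case by blast
  qed
qed

context
  fixes P :: "'a::euclidean_space \<Rightarrow> 'a"
  assumes P: "bounded_linear P"
begin

definition dil :: "real \<Rightarrow> 'a \<Rightarrow> 'a" where
  "dil r z = P z + r *\<^sub>R (z - P z)"

lemma bounded_linear_dil: "bounded_linear (dil r)"
  unfolding dil_def
  by (intro bounded_linear_add P bounded_linear_compose[OF bounded_linear_scaleR_right]
      bounded_linear_sub bounded_linear_ident)

lemma dil_0 [simp]: "dil 0 z = P z"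
  by (simp add: dil_def)

lemma continuous_on_dil: "continuous_on S (\<lambda>(r, z). dil r z)"
  unfolding dil_def split_def
  by (intro continuous_intros bounded_linear.continuous_on[OF P])

lemma open_dil_vimage: "open U \<Longrightarrow> open {z. dil r z \<in> U}"
  using open_vimage[OF _ linear_continuous_on[OF bounded_linear_dil]] by (simp add: vimage_def)

lemma dil_compact_subset:
  assumes "compact K" "open U" "P ` K \<subseteq> U"
  obtains \<delta> where "\<delta> > 0" "\<And>r z. 0 \<le> r \<Longrightarrow> r \<le> \<delta> \<Longrightarrow> z \<in> K \<Longrightarrow> dil r z \<in> U"
proof -
  have "compact (P ` K)"
    by (rule compact_continuous_image[OF linear_continuous_on[OF P] assms(1)])
  then obtain e where e: "e > 0" "(\<Union>x\<in>P ` K. cball x e) \<subseteq> U"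
    using compact_subset_open_imp_cball_epsilon_subset[of "P ` K" U] assms by blast
  have "bounded ((\<lambda>z. z - P z) ` K)"
    by (intro compact_imp_bounded compact_continuous_image continuous_intros linear_continuous_on[OF P] assms)
  then obtain C where C: "C > 0" "\<And>z. z \<in> K \<Longrightarrow> norm (z - P z) \<le> C"
    unfolding bounded_pos by auto
  show ?thesis
  proof
    show "e / C > 0" using e C by simp
    fix r z assume r: "0 \<le> r" "r \<le> e / C" and z: "z \<in> K"
    have "dist (P z) (dil r z) = r * norm (z - P z)"
      using r by (simp add: dil_def dist_norm)
    also have "\<dots> \<le> e / C * C"
      using r C(1) C(2)[OF z] by (intro mult_mono) auto
    finally have "dil r z \<in> cball (P z) e" using C by simp
    then show "dil r z \<in> U" using e z by blast
  qed
qed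

lemma eventually_dil:
  assumes "compact K" "open U" "P ` K \<subseteq> U"
  shows "\<forall>\<^sub>F r in at_right 0. 0 < r \<and> (\<forall>z\<in>K. dil r z \<in> U)"
proof -
  obtain \<delta> where "\<delta> > 0" "\<And>r z. 0 \<le> r \<Longrightarrow> r \<le> \<delta> \<Longrightarrow> z \<in> K \<Longrightarrow> dil r z \<in> U"
    using dil_compact_subset[OF assms] by blast
  with eventually_at_right_real[OF this(1)] show ?thesis
    by (auto elim: eventually_mono)
qed

lemma uniform_limit_dil:
  fixes f :: "'a \<Rightarrow> 'b::real_normed_vector"
  assumes "compact K" "open U" "P ` K \<subseteq> U" "continuous_on U f"
  shows "uniform_limit K (\<lambda>r z. f (dil r z)) (\<lambda>z. f (P z)) (at_right 0)"
proof -
  obtain \<delta> where \<delta>: "\<delta> > 0" "\<And>r z. 0 \<le> r \<Longrightarrow> r \<le> \<delta> \<Longrightarrow> z \<in> K \<Longrightarrow> dil r z \<in> U"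
    using dil_compact_subset[OF assms(1-3)] by blast
  have "continuous_on ({0..\<delta>} \<times> K) (\<lambda>p. f ((\<lambda>(r, z). dil r z) p))"
    by (rule continuous_on_compose2[OF assms(4) continuous_on_dil]) (use \<delta> in auto)
  from uniform_limit_at_right_0[OF assms(1) \<delta>(1), of "\<lambda>r z. f (dil r z)"] this show ?thesis
    by (simp add: split_def)
qed

lemma smooth_on_dil_compose:
  fixes F :: "'a \<Rightarrow> 'b::real_normed_vector"
  assumes "open U" "smooth_on U F"
  shows "smooth_on {z. dil r z \<in> U} (\<lambda>z. F (dil r z))"
  by (rule smooth_on_compose[OF open_dil_vimage[OF assms(1)] assms(1) smooth_on_bounded_linear[OF bounded_linear_dil] assms(2)]) auto

lemma fderiv_dil_compose:
  fixes F :: "'a \<Rightarrow> 'b::real_normed_vector"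
  assumes "smooth_on U F" "dil r z \<in> U"
  shows "((\<lambda>z. F (dil r z)) has_derivative (\<lambda>v. fderiv F (dil r z) (P v) + r *\<^sub>R fderiv F (dil r z) (v - P v))) (at z)"
proof (rule has_derivative_eq_rhs)
  have F: "(F has_derivative fderiv F (dil r z)) (at (dil r z))"
    by (rule smooth_on_has_derivative[OF assms])
  show "((\<lambda>z. F (dil r z)) has_derivative (\<lambda>v. fderiv F (dil r z) (dil r v))) (at z)"
    by (rule has_derivative_compose[OF bounded_linear_imp_has_derivative[OF bounded_linear_dil] F])
  show "(\<lambda>v. fderiv F (dil r z) (dil r v)) = (\<lambda>v. fderiv F (dil r z) (P v) + r *\<^sub>R fderiv F (dil r z) (v - P v))"
    using has_derivative_linear[OF F] by (simp add: dil_def linear_add linear_scale fun_eq_iff)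
qed

text \<open>A derivative in the direction \<open>v\<close> of the dilated map is the dilated
  derivative along \<open>P v\<close> plus r times the dilated derivative along
  \<open>v - P v\<close>. The second summand disappears in the limit, since its cofactor converges
  uniformly to a function bounded on \<open>K\<close>.\<close>

lemma uniform_limit_iter_deriv_dil:
  fixes F :: "'a \<Rightarrow> 'b::real_normed_vector"
  assumes K: "compact K" "P ` K \<subseteq> U" and U: "open U" and F: "smooth_on U F"
  shows "uniform_limit K (\<lambda>r. iter_deriv vs (\<lambda>z. F (dil r z))) (iter_deriv vs (\<lambda>z. F (P z))) (at_right 0)"
  using F
proof (induction vs arbitrary: F)
  case Nil
  then show ?case using uniform_limit_dil[OF K(1) U K(2) smooth_on_continuous] by auto
next
  case (Cons v vs)
  define F1 where "F1 y = fderiv F y (P v)" for y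
  define F2 where "F2 y = fderiv F y (v - P v)" for y
  have F12: "smooth_on U F1" "smooth_on U F2"
    unfolding F1_def F2_def using Cons.prems by (auto intro: smooth_on_fderiv)
  have eq: "iter_deriv (v # vs) (\<lambda>z. F (dil r z)) z =
      iter_deriv vs (\<lambda>z. F1 (dil r z)) z + r *\<^sub>R iter_deriv vs (\<lambda>z. F2 (dil r z)) z"
    if "dil r z \<in> U" for r z
  proof -
    let ?O = "{z. dil r z \<in> U}"
    note s = smooth_on_dil_compose[OF U F12(1), of r] smooth_on_dil_compose[OF U F12(2), of r]
    have O: "open ?O" "z \<in> ?O" using U that by (auto intro: open_dil_vimage)
    have "iter_deriv (v # vs) (\<lambda>z. F (dil r z)) z = iter_deriv vs (\<lambda>z. F1 (dil r z) + r *\<^sub>R F2 (dil r z)) z"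
      unfolding F1_def F2_def
      by (rule iter_deriv_Cons[OF O smooth_on_dil_compose[OF U Cons.prems] fderiv_dil_compose[OF Cons.prems]]) simp
    also have "\<dots> = iter_deriv vs (\<lambda>z. F1 (dil r z)) z + iter_deriv vs (\<lambda>z. r *\<^sub>R F2 (dil r z)) z"
      by (intro iter_deriv_add[OF O] smooth_on_linear_compose[OF O(1) bounded_linear_scaleR_right] s)
    also have "iter_deriv vs (\<lambda>z. r *\<^sub>R F2 (dil r z)) z = r *\<^sub>R iter_deriv vs (\<lambda>z. F2 (dil r z)) z"
      by (rule iter_deriv_linear[OF O s(2) bounded_linear_scaleR_right])
    finally show ?thesis .
  qed
  have "bounded (iter_deriv vs (\<lambda>z. F2 (P z)) ` K)"
  proof (intro compact_imp_bounded compact_continuous_image[OF _ K(1)])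
    show "continuous_on K (iter_deriv vs (\<lambda>z. F2 (P z)))"
      using smooth_on_continuous[OF smooth_on_iter_deriv[OF smooth_on_dil_compose[OF U F12(2), of 0]]] K(2)
      by (intro continuous_on_subset[where s = "{z. P z \<in> U}" and t = K]) auto
  qed
  moreover have "uniform_limit K (\<lambda>r z. r) (\<lambda>z. 0) (at_right (0::real))"
  proof (rule uniform_limitI)
    show "\<forall>\<^sub>F r in at_right 0. \<forall>z\<in>K. dist r (0::real) < e" if "e > 0" for e
      using eventually_at_right_real[OF that] by eventually_elim auto
  qed
  moreover have "bounded ((\<lambda>z. 0::real) ` K)"
    by (rule boundedI[of _ 0]) auto
  ultimately have "uniform_limit K (\<lambda>r z. r *\<^sub>R iter_deriv vs (\<lambda>z. F2 (dil r z)) z)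
      (\<lambda>z. 0 *\<^sub>R iter_deriv vs (\<lambda>z. F2 (P z)) z) (at_right 0)"
    by (intro bounded_bilinear.bounded_uniform_limit[OF bounded_bilinear_scaleR] Cons.IH F12)
  then have "uniform_limit K (\<lambda>r z. iter_deriv vs (\<lambda>z. F1 (dil r z)) z + r *\<^sub>R iter_deriv vs (\<lambda>z. F2 (dil r z)) z)
      (\<lambda>z. iter_deriv vs (\<lambda>z. F1 (P z)) z + 0 *\<^sub>R iter_deriv vs (\<lambda>z. F2 (P z)) z) (at_right 0)"
    by (intro uniform_limit_add Cons.IH F12)
  then show ?case
  proof (rule uniform_limit_cong[THEN iffD1, rotated 2])
    show "\<forall>\<^sub>F r in at_right 0. \<forall>z\<in>K. iter_deriv vs (\<lambda>z. F1 (dil r z)) z + r *\<^sub>R iter_deriv vs (\<lambda>z. F2 (dil r z)) z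
        = iter_deriv (v # vs) (\<lambda>z. F (dil r z)) z"
      using eventually_dil[OF K(1) U K(2)] by eventually_elim (use eq in auto)
    \<comment> \<open>The splitting formula holds for r = 0 as well, and there it identifies the
      limit.\<close>
    show "iter_deriv vs (\<lambda>z. F1 (P z)) z + 0 *\<^sub>R iter_deriv vs (\<lambda>z. F2 (P z)) z = iter_deriv (v # vs) (\<lambda>z. F (P z)) z"
      if "z \<in> K" for z
      using eq[of 0 z] that K(2) by auto
  qed
qed

text \<open>A mean value estimate along the segment from \<open>P z\<close> to
  \<open>dil r z\<close>: the derivative of \<open>F\<close> in the direction \<open>z - P z\<close>
  is uniformly close, for small r, to its value at \<open>P z\<close>.\<close>

lemma uniform_limit_dil_quotient:
  fixes F :: "'a \<Rightarrow> 'b::real_normed_vector"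
  assumes K: "compact K" "P ` K \<subseteq> U" and U: "open U" and F: "smooth_on U F"
    and F0: "\<And>z. P z \<in> U \<Longrightarrow> F (P z) = 0"
  shows "uniform_limit K (\<lambda>r z. (1 / r) *\<^sub>R F (dil r z)) (\<lambda>z. fderiv F (P z) (z - P z)) (at_right 0)"
proof (rule uniform_limitI)
  fix e :: real assume "e > 0"
  define h where "h r z = fderiv F (dil r z) (z - P z)" for r z
  obtain \<delta> where \<delta>: "\<delta> > 0" "\<And>r z. 0 \<le> r \<Longrightarrow> r \<le> \<delta> \<Longrightarrow> z \<in> K \<Longrightarrow> dil r z \<in> U"
    using dil_compact_subset[OF K(1) U K(2)] by blast
  have "continuous_on ({0..\<delta>} \<times> K) (\<lambda>p. \<Sum>b\<in>Basis. ((snd p - P (snd p)) \<bullet> b) *\<^sub>R fderiv F ((\<lambda>(r, z). dil r z) p) b)"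
    by (intro continuous_intros continuous_on_compose2[OF linear_continuous_on[OF P]]
        continuous_on_compose2[OF smooth_on_continuous[OF smooth_on_fderiv[OF F]] continuous_on_dil]) (use \<delta> in auto)
  then have "continuous_on ({0..\<delta>} \<times> K) (\<lambda>(r, z). h r z)"
  proof (rule continuous_on_eq)
    fix p assume "p \<in> {0..\<delta>} \<times> K"
    then have "linear (fderiv F (dil (fst p) (snd p)))"
      using \<delta> by (intro smooth_on_linear_fderiv[OF F]) auto
    from linear_basis_expansion[OF this, of "snd p - P (snd p)"]
    show "(\<Sum>b\<in>Basis. ((snd p - P (snd p)) \<bullet> b) *\<^sub>R fderiv F ((\<lambda>(r, z). dil r z) p) b) = (\<lambda>(r, z). h r z) p"
      by (simp add: h_def split_def)
  qed
  from uniform_limitD[OF uniform_limit_at_right_0[OF K(1) \<delta>(1) this], of "e / 2"] \<open>e > 0\<close>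
  have "\<forall>\<^sub>F r in at_right 0. \<forall>z\<in>K. dist (h r z) (h 0 z) < e / 2" by simp
  then obtain b where b: "b > 0" "\<And>r z. 0 < r \<Longrightarrow> r < b \<Longrightarrow> z \<in> K \<Longrightarrow> dist (h r z) (h 0 z) < e / 2"
    unfolding eventually_at_right_field by auto
  have "min b \<delta> > 0" using b \<delta> by simp
  from eventually_at_right_real[OF this]
  show "\<forall>\<^sub>F r in at_right 0. \<forall>z\<in>K. dist ((1 / r) *\<^sub>R F (dil r z)) (fderiv F (P z) (z - P z)) < e"
  proof (eventually_elim, intro ballI)
    fix r z assume r: "r \<in> {0<..<min b \<delta>}" and z: "z \<in> K"
    \<comment> \<open>Subtracting the candidate limit leaves a function that vanishes at 0, because
      \<open>F\<close> vanishes at \<open>P z\<close>, and whose derivative is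
      \<open>h t z - h 0 z\<close>, which is at most \<open>e / 2\<close> in norm. The half gives
      the strict inequality in the end.\<close>
    define g where "g t = F (dil t z) - t *\<^sub>R h 0 z" for t
    have dg: "(g has_derivative (\<lambda>s. s *\<^sub>R (h t z - h 0 z))) (at t within {0..r})" if "t \<in> {0..r}" for t
    proof -
      have 1: "(F has_derivative fderiv F (dil t z)) (at (dil t z))"
        using \<delta>(2)[of t z] that r z by (intro smooth_on_has_derivative[OF F]) auto
      have "((\<lambda>t. F (dil t z)) has_derivative (\<lambda>s. fderiv F (dil t z) (s *\<^sub>R (z - P z)))) (at t)"
        by (rule has_derivative_compose[where f = "\<lambda>t. dil t z", OF _ 1]) (auto simp: dil_def intro!: derivative_eq_intros)
      then have "(g has_derivative (\<lambda>s. s *\<^sub>R h t z - s *\<^sub>R h 0 z)) (at t)"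
        unfolding g_def h_def linear_scale[OF has_derivative_linear[OF 1]]
        by (intro has_derivative_diff) (auto intro!: derivative_eq_intros)
      then show ?thesis
        by (simp add: has_derivative_at_withinI scaleR_diff_right)
    qed
    have "norm (g r - g 0) \<le> e / 2 * norm (r - 0)"
    proof (rule differentiable_bound[OF convex_real_interval(5) dg])
      fix t assume t: "t \<in> {0..r}"
      have "dist (h t z) (h 0 z) \<le> e / 2"
        using b(2)[of t z] t r z \<open>e > 0\<close> by (cases "t = 0") auto
      then show "onorm (\<lambda>s. s *\<^sub>R (h t z - h 0 z)) \<le> e / 2"
        using mult_right_mono[of "norm (h t z - h 0 z)" "e / 2" "\<bar>s\<bar>" for s]
        by (intro onorm_le) (simp add: dist_norm mult.commute[of "\<bar>_\<bar>"])
    qed (use r in auto)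
    moreover have "g 0 = 0"
      using F0[of z] K(2) z by (auto simp: g_def)
    ultimately have "norm (F (dil r z) - r *\<^sub>R h 0 z) \<le> e / 2 * r"
      using r by (simp add: g_def)
    moreover have eq: "(1 / r) *\<^sub>R F (dil r z) - h 0 z = (1 / r) *\<^sub>R (F (dil r z) - r *\<^sub>R h 0 z)"
      using r by (simp add: algebra_simps)
    have "norm ((1 / r) *\<^sub>R F (dil r z) - h 0 z) = norm (F (dil r z) - r *\<^sub>R h 0 z) / r"
      unfolding eq using r by simp
    ultimately have "norm ((1 / r) *\<^sub>R F (dil r z) - h 0 z) \<le> e / 2"
      using r by (simp only: pos_divide_le_eq greaterThanLessThan_iff)
    then show "dist ((1 / r) *\<^sub>R F (dil r z)) (fderiv F (P z) (z - P z)) < e"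
      using \<open>e > 0\<close> by (simp add: dist_norm h_def)
  qed
qed

text \<open>The derivative in a direction \<open>v\<close> of the quotient for \<open>F\<close> is the quotient for the
  derivative of \<open>F\<close> along \<open>P v\<close>, which again vanishes on the range of \<open>P\<close>, plus the dilated derivative
  of \<open>F\<close> along \<open>v - P v\<close>. The limits match by the symmetry of second derivatives.\<close>

lemma uniform_limit_iter_deriv_dil_quotient:
  fixes F :: "'a \<Rightarrow> 'b::euclidean_space"
  assumes K: "compact K" "P ` K \<subseteq> U" and U: "open U" and F: "smooth_on U F"
    and F0: "\<And>z. P z \<in> U \<Longrightarrow> F (P z) = 0"
  shows "uniform_limit K (\<lambda>r. iter_deriv vs (\<lambda>z. (1 / r) *\<^sub>R F (dil r z)))
    (iter_deriv vs (\<lambda>z. fderiv F (P z) (z - P z))) (at_right 0)"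
  using F F0
proof (induction vs arbitrary: F)
  case Nil
  then show ?case using uniform_limit_dil_quotient[OF K U Nil.prems] by simp
next
  case (Cons v vs)
  note F = Cons.prems(1)
  define F1 where "F1 y = fderiv F y (P v)" for y
  define F2 where "F2 y = fderiv F y (v - P v)" for y
  have F12: "smooth_on U F1" "smooth_on U F2"
    unfolding F1_def F2_def using F by (auto intro: smooth_on_fderiv)
  let ?O0 = "{z. dil 0 z \<in> U}"
  have O0: "open ?O0" using U by (rule open_dil_vimage)
  \<comment> \<open>Composing \<open>F\<close> with \<open>dil 0\<close>, that is with
    \<open>P\<close>, gives a map that vanishes on an open set; its derivative in the direction
    \<open>v\<close> is that of \<open>F\<close> along \<open>P v\<close>.\<close>
  have F10: "F1 (P z) = 0" if "P z \<in> U" for z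
  proof -
    have "((\<lambda>z. F (dil 0 z)) has_derivative (\<lambda>v. 0)) (at z)"
      by (rule has_derivative_transform_within_open[OF has_derivative_const O0]) (use that Cons.prems(2) in auto)
    from has_derivative_unique[OF this fderiv_dil_compose[OF F, of 0 z]] that show ?thesis
      by (simp add: F1_def fun_eq_iff)
  qed
  have eq: "iter_deriv (v # vs) (\<lambda>z. (1 / r) *\<^sub>R F (dil r z)) z =
      iter_deriv vs (\<lambda>z. (1 / r) *\<^sub>R F1 (dil r z)) z + iter_deriv vs (\<lambda>z. F2 (dil r z)) z"
    if "dil r z \<in> U" "r > 0" for r z
  proof -
    let ?O = "{z. dil r z \<in> U}"
    note s = smooth_on_dil_compose[OF U F12(1), of r] smooth_on_dil_compose[OF U F12(2), of r]
    have O: "open ?O" "z \<in> ?O" using U that by (auto intro: open_dil_vimage)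
    have "iter_deriv (v # vs) (\<lambda>z. (1 / r) *\<^sub>R F (dil r z)) z =
        iter_deriv vs (\<lambda>z. (1 / r) *\<^sub>R (F1 (dil r z) + r *\<^sub>R F2 (dil r z))) z"
      unfolding F1_def F2_def
      by (rule iter_deriv_Cons[OF O smooth_on_linear_compose[OF O(1) bounded_linear_scaleR_right smooth_on_dil_compose[OF U F]]
            has_derivative_scaleR_right[OF fderiv_dil_compose[OF F]]]) simp
    also have "\<dots> = iter_deriv vs (\<lambda>z. (1 / r) *\<^sub>R F1 (dil r z) + F2 (dil r z)) z"
      using \<open>r > 0\<close> by (simp add: scaleR_add_right)
    also have "\<dots> = iter_deriv vs (\<lambda>z. (1 / r) *\<^sub>R F1 (dil r z)) z + iter_deriv vs (\<lambda>z. F2 (dil r z)) z"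
      by (intro iter_deriv_add[OF O] smooth_on_linear_compose[OF O(1) bounded_linear_scaleR_right] s)
    finally show ?thesis .
  qed
  have eq0: "iter_deriv (v # vs) (\<lambda>z. fderiv F (P z) (z - P z)) z =
      iter_deriv vs (\<lambda>z. fderiv F1 (P z) (z - P z)) z + iter_deriv vs (\<lambda>z. F2 (P z)) z"
    if "P z \<in> U" for z
  proof -
    have O: "z \<in> ?O0" using that by simp
    have bP: "bounded_linear (\<lambda>z. z - P z)"
      by (intro bounded_linear_sub bounded_linear_ident P)
    have sm: "smooth_on ?O0 (\<lambda>z. fderiv F (P z) (z - P z))" if "smooth_on U F" for F :: "'a \<Rightarrow> 'b"
      by (rule smooth_on_fderiv_apply[OF O0 U that smooth_on_bounded_linear[OF P] _ smooth_on_bounded_linear[OF bP]]) auto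
    have "iter_deriv (v # vs) (\<lambda>z. fderiv F (P z) (z - P z)) z = iter_deriv vs (\<lambda>z. fderiv (\<lambda>z. fderiv F (P z) (z - P z)) z v) z"
      by simp
    also have "\<dots> = iter_deriv vs (\<lambda>z. fderiv F1 (P z) (z - P z) + F2 (P z)) z"
    proof (rule iter_deriv_cong[OF O0 O])
      show "smooth_on ?O0 (\<lambda>z. fderiv (\<lambda>z. fderiv F (P z) (z - P z)) z v)"
        by (intro smooth_on_fderiv sm F)
      fix y assume y: "y \<in> ?O0"
      have Dy: "((\<lambda>z. fderiv F (P z) b) has_derivative (\<lambda>v. fderiv (\<lambda>z. fderiv F z b) (P y) (P v))) (at y)" for b
        by (rule has_derivative_compose[where f = P and g = "\<lambda>z. fderiv F z b",
              OF bounded_linear_imp_has_derivative[OF P] smooth_on_has_derivative[OF smooth_on_fderiv[OF F]]])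
           (use y in auto)
      have "((\<lambda>z. \<Sum>b\<in>Basis. ((z - P z) \<bullet> b) *\<^sub>R fderiv F (P z) b) has_derivative
         (\<lambda>v. \<Sum>b\<in>Basis. ((y - P y) \<bullet> b) *\<^sub>R fderiv (\<lambda>z. fderiv F z b) (P y) (P v) + ((v - P v) \<bullet> b) *\<^sub>R fderiv F (P y) b)) (at y)"
        by (intro has_derivative_sum has_derivative_scaleR has_derivative_inner_left
            bounded_linear_imp_has_derivative[OF bP] Dy)
      then have "((\<lambda>z. fderiv F (P z) (z - P z)) has_derivative
         (\<lambda>v. \<Sum>b\<in>Basis. ((y - P y) \<bullet> b) *\<^sub>R fderiv (\<lambda>z. fderiv F z b) (P y) (P v) + ((v - P v) \<bullet> b) *\<^sub>R fderiv F (P y) b)) (at y)"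
      proof (rule has_derivative_transform_within_open[OF _ O0 y])
        fix z assume "z \<in> ?O0"
        then show "(\<Sum>b\<in>Basis. ((z - P z) \<bullet> b) *\<^sub>R fderiv F (P z) b) = fderiv F (P z) (z - P z)"
          using linear_basis_expansion[OF smooth_on_linear_fderiv[OF F], of "P z" "z - P z"] by simp
      qed
      from fderiv_eq[OF this]
      have "fderiv (\<lambda>z. fderiv F (P z) (z - P z)) y v =
         (\<Sum>b\<in>Basis. ((y - P y) \<bullet> b) *\<^sub>R fderiv (\<lambda>z. fderiv F z b) (P y) (P v)) + (\<Sum>b\<in>Basis. ((v - P v) \<bullet> b) *\<^sub>R fderiv F (P y) b)"
        by (simp add: sum.distrib)
      also have "(\<Sum>b\<in>Basis. ((v - P v) \<bullet> b) *\<^sub>R fderiv F (P y) b) = F2 (P y)"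
        using linear_basis_expansion[OF smooth_on_linear_fderiv[OF F], of "P y" "v - P v"] y by (simp add: F2_def)
      also have "(\<Sum>b\<in>Basis. ((y - P y) \<bullet> b) *\<^sub>R fderiv (\<lambda>z. fderiv F z b) (P y) (P v)) = (\<Sum>b\<in>Basis. ((y - P y) \<bullet> b) *\<^sub>R fderiv F1 (P y) b)"
        unfolding F1_def using second_derivative_symmetric[OF U _ F] y by simp
      also have "\<dots> = fderiv F1 (P y) (y - P y)"
        using linear_basis_expansion[OF smooth_on_linear_fderiv[OF F12(1)], of "P y" "y - P y"] y by simp
      finally show "fderiv (\<lambda>z. fderiv F (P z) (z - P z)) y v = fderiv F1 (P y) (y - P y) + F2 (P y)" .
    qed
    also have "\<dots> = iter_deriv vs (\<lambda>z. fderiv F1 (P z) (z - P z)) z + iter_deriv vs (\<lambda>z. F2 (P z)) z"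
      using smooth_on_dil_compose[OF U F12(2), of 0]
      by (intro iter_deriv_add[OF O0 O] sm F12) simp
    finally show ?thesis .
  qed
  have "uniform_limit K (\<lambda>r z. iter_deriv vs (\<lambda>z. (1 / r) *\<^sub>R F1 (dil r z)) z + iter_deriv vs (\<lambda>z. F2 (dil r z)) z)
      (\<lambda>z. iter_deriv vs (\<lambda>z. fderiv F1 (P z) (z - P z)) z + iter_deriv vs (\<lambda>z. F2 (P z)) z) (at_right 0)"
    by (intro uniform_limit_add uniform_limit_iter_deriv_dil[OF K U F12(2)] Cons.IH[OF F12(1)] F10)
  then show ?case
  proof (rule uniform_limit_cong[THEN iffD1, rotated 2])
    show "\<forall>\<^sub>F r in at_right 0. \<forall>z\<in>K. iter_deriv vs (\<lambda>z. (1 / r) *\<^sub>R F1 (dil r z)) z + iter_deriv vs (\<lambda>z. F2 (dil r z)) z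
        = iter_deriv (v # vs) (\<lambda>z. (1 / r) *\<^sub>R F (dil r z)) z"
      using eventually_dil[OF K(1) U K(2)] by eventually_elim (use eq in auto)
    show "iter_deriv vs (\<lambda>z. fderiv F1 (P z) (z - P z)) z + iter_deriv vs (\<lambda>z. F2 (P z)) z
        = iter_deriv (v # vs) (\<lambda>z. fderiv F (P z) (z - P z)) z"
      if "z \<in> K" for z
      using eq0[of z] that K(2) by auto
  qed
qed

text \<open>Applying \<open>dil (1 / r)\<close> leaves the component \<open>P (F _)\<close> as it is
  and multiplies the complementary one by 1/r. The former tends to \<open>P (F (P z)) = 0\<close>
  with all derivatives, the latter is a quotient as treated above.\<close>

lemma uniform_limit_iter_deriv_dil_conjugate:
  fixes F :: "'a \<Rightarrow> 'a"
  assumes K: "compact K" "P ` K \<subseteq> U" and U: "open U" and F: "smooth_on U F"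
    and F0: "\<And>z. P z \<in> U \<Longrightarrow> F (P z) = 0"
  shows "uniform_limit K (\<lambda>r. iter_deriv vs (\<lambda>z. dil (1 / r) (F (dil r z))))
    (iter_deriv vs (\<lambda>z. fderiv F (P z) (z - P z) - P (fderiv F (P z) (z - P z)))) (at_right 0)"
proof -
  define F1 where "F1 z = P (F z)" for z
  define F2 where "F2 z = F z - P (F z)" for z
  have bP: "bounded_linear (\<lambda>z. z - P z)"
    by (intro bounded_linear_sub bounded_linear_ident P)
  have F12: "smooth_on U F1" "smooth_on U F2"
    unfolding F1_def F2_def
    using smooth_on_linear_compose[OF U P F] smooth_on_linear_compose[OF U bP F] by auto
  have F120: "F1 (P z) = 0" "F2 (P z) = 0" if "P z \<in> U" for z
    using F0[OF that] linear_simps(3)[OF P] by (auto simp: F1_def F2_def)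
  have lim: "uniform_limit K (\<lambda>r z. iter_deriv vs (\<lambda>z. F1 (dil r z)) z + iter_deriv vs (\<lambda>z. (1 / r) *\<^sub>R F2 (dil r z)) z)
     (\<lambda>z. iter_deriv vs (\<lambda>z. F1 (P z)) z + iter_deriv vs (\<lambda>z. fderiv F2 (P z) (z - P z)) z) (at_right 0)"
    by (intro uniform_limit_add uniform_limit_iter_deriv_dil[OF K U F12(1)]
        uniform_limit_iter_deriv_dil_quotient[OF K U F12(2)] F120)
  show ?thesis
  proof (rule uniform_limit_cong[THEN iffD1, OF _ _ lim])
    have "iter_deriv vs (\<lambda>z. F1 (dil r z)) z + iter_deriv vs (\<lambda>z. (1 / r) *\<^sub>R F2 (dil r z)) z
        = iter_deriv vs (\<lambda>z. dil (1 / r) (F (dil r z))) z" if "dil r z \<in> U" for r z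
    proof -
      let ?O = "{z. dil r z \<in> U}"
      have O: "open ?O" "z \<in> ?O" using U that by (auto intro: open_dil_vimage)
      have "iter_deriv vs (\<lambda>z. F1 (dil r z)) z + iter_deriv vs (\<lambda>z. (1 / r) *\<^sub>R F2 (dil r z)) z
        = iter_deriv vs (\<lambda>z. F1 (dil r z) + (1 / r) *\<^sub>R F2 (dil r z)) z"
        by (intro iter_deriv_add[OF O, symmetric] smooth_on_linear_compose[OF O(1) bounded_linear_scaleR_right]
            smooth_on_dil_compose[OF U] F12)
      then show ?thesis by (simp add: dil_def[of "1 / r"] F1_def F2_def)
    qed
    then show "\<forall>\<^sub>F r in at_right 0. \<forall>z\<in>K. iter_deriv vs (\<lambda>z. F1 (dil r z)) z + iter_deriv vs (\<lambda>z. (1 / r) *\<^sub>R F2 (dil r z)) z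
        = iter_deriv vs (\<lambda>z. dil (1 / r) (F (dil r z))) z"
      using eventually_dil[OF K(1) U K(2)] by (auto elim: eventually_mono)
    fix z assume "z \<in> K"
    then have O: "open {z. dil 0 z \<in> U}" "z \<in> {z. dil 0 z \<in> U}"
      using open_dil_vimage[OF U, of 0] K(2) by auto
    have "iter_deriv vs (\<lambda>z. F1 (P z)) z = iter_deriv vs (\<lambda>z. 0) z"
      by (rule iter_deriv_cong[OF O]) (use F120 smooth_on_dil_compose[OF U F12(1), of 0] in auto)
    moreover have "iter_deriv vs (\<lambda>z. 0) z = 0" for z :: 'a
      by (induction vs) auto
    moreover have "iter_deriv vs (\<lambda>z. fderiv F2 (P z) (z - P z)) z
      = iter_deriv vs (\<lambda>z. fderiv F (P z) (z - P z) - P (fderiv F (P z) (z - P z))) z"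
    proof (rule iter_deriv_cong[OF O])
      show "smooth_on {z. dil 0 z \<in> U} (\<lambda>z. fderiv F2 (P z) (z - P z))"
        by (rule smooth_on_fderiv_apply[OF O(1) U F12(2) smooth_on_bounded_linear[OF P] _ smooth_on_bounded_linear[OF bP]]) auto
      show "fderiv F2 (P y) (y - P y) = fderiv F (P y) (y - P y) - P (fderiv F (P y) (y - P y))"
        if "y \<in> {z. dil 0 z \<in> U}" for y
        using that fderiv_eq[OF bounded_linear.has_derivative[OF bP smooth_on_has_derivative[OF F]], of "P y"]
        by (simp add: F2_def[abs_def])
    qed
    ultimately show "iter_deriv vs (\<lambda>z. F1 (P z)) z + iter_deriv vs (\<lambda>z. fderiv F2 (P z) (z - P z)) z
        = iter_deriv vs (\<lambda>z. fderiv F (P z) (z - P z) - P (fderiv F (P z) (z - P z))) z"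
      by simp
  qed
qed

end

section \<open>Calculus in charts\<close>

text \<open>Compatibility of charts alone, so that the same calculus serves the manifold and the
  total space of the bundle.\<close>

definition smooth_atlas :: "('p, 'e::euclidean_space) chart set \<Rightarrow> bool" where
  "smooth_atlas A \<longleftrightarrow> (\<forall>c\<in>A. is_chart c) \<and> (\<forall>c\<in>A. \<forall>d\<in>A. smooth_transition c d)"

abbreviation rep :: "('p, 'e) chart \<Rightarrow> ('q, 'f) chart \<Rightarrow> ('p \<Rightarrow> 'q) \<Rightarrow> 'e \<Rightarrow> 'f" where
  "rep c d f \<equiv> snd d \<circ> f \<circ> chart_inv c"

abbreviation rep_dom :: "('p, 'e) chart \<Rightarrow> ('q, 'f) chart \<Rightarrow> 'p set \<Rightarrow> ('p \<Rightarrow> 'q) \<Rightarrow> 'e set" where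
  "rep_dom c d S f \<equiv> snd c ` {p \<in> S \<inter> fst c. f p \<in> fst d}"

lemma chart_inv_left [simp]: "is_chart c \<Longrightarrow> p \<in> fst c \<Longrightarrow> chart_inv c (snd c p) = p"
  by (simp add: is_chart_def)

lemma chart_at_in:
  assumes "p \<in> carrier A" shows "chart_at A p \<in> A" "p \<in> fst (chart_at A p)"
proof -
  have "\<exists>c. c \<in> A \<and> p \<in> fst c" using assms by (auto simp: carrier_def)
  from someI_ex[OF this] show "chart_at A p \<in> A" "p \<in> fst (chart_at A p)"
    by (simp_all add: chart_at_def)
qed

lemma smooth_atlas_is_chart: "smooth_atlas A \<Longrightarrow> c \<in> A \<Longrightarrow> is_chart c"
  by (simp add: smooth_atlas_def)

lemma chart_subset_carrier: "c \<in> A \<Longrightarrow> fst c \<subseteq> carrier A"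
  by (auto simp: carrier_def)

section \<open>Local representatives of smooth maps and the chain rule\<close>

lemma smooth_mapD:
  assumes "smooth_map A B S f" "c \<in> A" "d \<in> B"
  shows "open (rep_dom c d S f)" "smooth_on (rep_dom c d S f) (rep c d f)"
  using assms by (auto simp: smooth_map_def)

lemma smooth_map_open:
  assumes "smooth_map A B S f" "c \<in> A"
  shows "open (snd c ` (S \<inter> fst c))"
proof -
  have "snd c ` (S \<inter> fst c) = (\<Union>d\<in>B. rep_dom c d S f)"
    using assms by (fastforce simp: smooth_map_def carrier_def)
  then show ?thesis using smooth_mapD(1)[OF assms] by auto
qed

lemma smooth_map_id:
  assumes "smooth_atlas A" shows "smooth_map A A (carrier A) id"
proof -
  have "{p \<in> carrier A \<inter> fst c. id p \<in> fst d} = fst c \<inter> fst d" if "c \<in> A" for c d :: "('a, 'b) chart"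
    using chart_subset_carrier[OF that] by auto
  then show ?thesis
    using assms by (simp add: smooth_map_def smooth_atlas_def smooth_transition_def)
qed

lemma smooth_atlasI:
  assumes "\<And>c. c \<in> A \<Longrightarrow> is_chart c" "smooth_map A A (carrier A) id"
  shows "smooth_atlas A"
proof -
  have "{p \<in> carrier A \<inter> fst c. id p \<in> fst d} = fst c \<inter> fst d" if "c \<in> A" for c d :: "('a, 'b) chart"
    using chart_subset_carrier[OF that] by auto
  then show ?thesis
    using assms smooth_mapD[OF assms(2)] by (simp add: smooth_atlas_def smooth_transition_def)
qed

lemma rep_comp_eq:
  assumes "is_chart c" "is_chart d" "z \<in> rep_dom c d S f"
  shows "G (chart_inv d (rep c d f z)) = G (f (chart_inv c z))"
  using assms by auto

text \<open>The image of a chart domain may meet many charts of the middle manifold. The sets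
  \<open>O' d\<close>, where the representative through the middle chart \<open>d\<close> makes
  sense, are open and cover the domain, and smoothness is a local property.\<close>

lemma smooth_map_comp:
  fixes A :: "('p, 'e::euclidean_space) chart set" and B :: "('q, 'f::euclidean_space) chart set"
    and C :: "('r, 'g::euclidean_space) chart set"
  assumes f: "smooth_map A B S f" and g: "smooth_map B C T g"
    and A: "\<And>c. c \<in> A \<Longrightarrow> is_chart c" and B: "\<And>c. c \<in> B \<Longrightarrow> is_chart c"
  shows "smooth_map A C {p \<in> S. f p \<in> T} (g \<circ> f)"
  unfolding smooth_map_def
proof (intro conjI ballI)
  show "{p \<in> S. f p \<in> T} \<subseteq> carrier A" "(g \<circ> f) ` {p \<in> S. f p \<in> T} \<subseteq> carrier C"
    using f g by (auto simp: smooth_map_def)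
  fix c e assume c: "c \<in> A" and e: "e \<in> C"
  let ?O = "rep_dom c e {p \<in> S. f p \<in> T} (g \<circ> f)"
  define O' :: "('q, 'f) chart \<Rightarrow> 'e set" where "O' d = rep_dom c d S f \<inter> rep c d f -` rep_dom d e T g" for d
  have O'_open: "open (O' d)" if "d \<in> B" for d
    unfolding O'_def
    by (rule continuous_open_preimage[OF smooth_on_continuous[OF smooth_mapD(2)[OF f c that]]
          smooth_mapD(1)[OF f c that] smooth_mapD(1)[OF g that e]])
  have sub: "O' d \<subseteq> ?O" if "d \<in> B" for d
  proof
    fix z assume "z \<in> O' d"
    then obtain p q where p: "p \<in> S" "p \<in> fst c" "f p \<in> fst d" "z = snd c p"
      and q: "q \<in> T" "q \<in> fst d" "g q \<in> fst e" "rep c d f z = snd d q"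
      by (auto simp: O'_def)
    then have "snd d (f p) = snd d q" using A[OF c] by simp
    then have "f p = q" using B[OF that] p q by (metis chart_inv_left)
    then show "z \<in> ?O" using p q by auto
  qed
  have cover: "\<exists>d\<in>B. z \<in> O' d" if z: "z \<in> ?O" for z
  proof -
    obtain p where p: "p \<in> S" "f p \<in> T" "p \<in> fst c" "g (f p) \<in> fst e" "z = snd c p"
      using z by auto
    have "f p \<in> carrier B" using p f by (auto simp: smooth_map_def)
    then obtain d where d: "d \<in> B" "f p \<in> fst d"
      by (auto simp: carrier_def)
    have "z \<in> O' d"
      using p d A[OF c] by (auto simp: O'_def)
    then show ?thesis using d by blast
  qed
  have "?O = (\<Union>d\<in>B. O' d)" using sub cover by blast
  then show "open ?O" using O'_open by auto
  show "smooth_on ?O (rep c e (g \<circ> f))"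
  proof (rule smooth_on_local)
    fix z assume "z \<in> ?O"
    then obtain d where d: "d \<in> B" "z \<in> O' d" using cover by blast
    have "smooth_on (O' d) (rep c d f)"
      by (rule smooth_on_subset[OF smooth_mapD(2)[OF f c d(1)]]) (auto simp: O'_def)
    then have "smooth_on (O' d) (\<lambda>z. rep d e g (rep c d f z))"
      by (rule smooth_on_compose[OF O'_open[OF d(1)] smooth_mapD(1)[OF g d(1) e] _ smooth_mapD(2)[OF g d(1) e]])
         (simp add: O'_def image_subset_iff)
    then have "smooth_on (O' d) (rep c e (g \<circ> f))"
    proof (rule smooth_on_cong[OF O'_open[OF d(1)], rotated])
      show "rep d e g (rep c d f y) = rep c e (g \<circ> f) y" if "y \<in> O' d" for y
        using that rep_comp_eq[OF A[OF c] B[OF d(1)], of y S f "\<lambda>q. snd e (g q)"] by (auto simp: O'_def)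
    qed
    then show "\<exists>V. open V \<and> z \<in> V \<and> smooth_on V (rep c e (g \<circ> f))"
      using O'_open[OF d(1)] d(2) by blast
  qed
qed

lemma smooth_map_restrict_dom:
  assumes "smooth_map A B S f" "S' \<subseteq> S" "\<And>c. c \<in> A \<Longrightarrow> is_chart c" "\<And>c. c \<in> A \<Longrightarrow> open (snd c ` (S' \<inter> fst c))"
  shows "smooth_map A B S' f"
  unfolding smooth_map_def
proof (intro conjI ballI)
  show "S' \<subseteq> carrier A" "f ` S' \<subseteq> carrier B"
    using assms(1,2) by (auto simp: smooth_map_def)
  fix c d assume cd: "c \<in> A" "d \<in> B"
  have "rep_dom c d S' f = rep_dom c d S f \<inter> snd c ` (S' \<inter> fst c)"
  proof
    show "rep_dom c d S f \<inter> snd c ` (S' \<inter> fst c) \<subseteq> rep_dom c d S' f"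
    proof
      fix z assume "z \<in> rep_dom c d S f \<inter> snd c ` (S' \<inter> fst c)"
      then obtain p q where "p \<in> S" "p \<in> fst c" "f p \<in> fst d" "z = snd c p" "q \<in> S'" "q \<in> fst c" "z = snd c q"
        by auto
      moreover from this have "p = q" using assms(3)[OF cd(1)] by (metis chart_inv_left)
      ultimately show "z \<in> rep_dom c d S' f" by auto
    qed
  qed (use assms(2) in auto)
  then show "open (rep_dom c d S' f)" "smooth_on (rep_dom c d S' f) (rep c d f)"
    using smooth_mapD[OF assms(1) cd] assms(4)[OF cd(1)] by (auto intro: smooth_on_subset)
qed

text \<open>The outer map \<open>G\<close> has values in a vector space, so one chain rule covers
  both real functions and maps followed by a coordinate map.\<close>

lemma has_derivative_rep_comp:
  fixes A :: "('p, 'e::euclidean_space) chart set" and B :: "('q, 'f::euclidean_space) chart set"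
  assumes f: "smooth_map A B S f" and "is_chart c" "is_chart d" "c \<in> A" "d \<in> B"
    and p: "p \<in> S" "p \<in> fst c" "f p \<in> fst d"
    and G: "(G \<circ> chart_inv d has_derivative G') (at (snd d (f p)))"
  shows "(G \<circ> f \<circ> chart_inv c has_derivative (\<lambda>v. G' (fderiv (rep c d f) (snd c p) v))) (at (snd c p))"
proof -
  have z: "snd c p \<in> rep_dom c d S f" using p by blast
  have "rep c d f (snd c p) = snd d (f p)" using assms by simp
  from has_derivative_compose[OF smooth_on_has_derivative[OF smooth_mapD(2)[OF f \<open>c \<in> A\<close> \<open>d \<in> B\<close>] z] G[folded this]]
  show ?thesis
  proof (rule has_derivative_transform_within_open[OF _ smooth_mapD(1)[OF f] z])
    show "(G \<circ> chart_inv d) (rep c d f y) = (G \<circ> f \<circ> chart_inv c) y" if "y \<in> rep_dom c d S f" for y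
      using rep_comp_eq[OF assms(2,3) that, of G] by simp
  qed fact+
qed

lemma fderiv_rep_comp:
  assumes f: "smooth_map A B S f" and g: "smooth_map B C T g"
    and "is_chart c" "is_chart d" "c \<in> A" "d \<in> B" "e \<in> C"
    and p: "p \<in> S" "p \<in> fst c" "f p \<in> fst d" "f p \<in> T" "g (f p) \<in> fst e"
  shows "fderiv (rep c e (g \<circ> f)) (snd c p) v = fderiv (rep d e g) (snd d (f p)) (fderiv (rep c d f) (snd c p) v)"
proof -
  have "snd d (f p) \<in> rep_dom d e T g" using p by blast
  from smooth_on_has_derivative[OF smooth_mapD(2)[OF g \<open>d \<in> B\<close> \<open>e \<in> C\<close>] this]
  have "(rep d e g has_derivative fderiv (rep d e g) (snd d (f p))) (at (snd d (f p)))" .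
  from fderiv_eq[OF has_derivative_rep_comp[where G = "snd e \<circ> g", OF f assms(3-6) p(1-3) this]]
  show ?thesis by (simp add: o_assoc)
qed

lemma fderiv_rep_id:
  assumes f: "smooth_map A A S f" "\<And>q. q \<in> S \<Longrightarrow> f q = q" and "is_chart c" "c \<in> A" "p \<in> S" "p \<in> fst c"
  shows "fderiv (rep c c f) (snd c p) v = v"
proof -
  have "open (snd c ` (S \<inter> fst c))" by (rule smooth_map_open) fact+
  then have "((\<lambda>z. rep c c f z) has_derivative (\<lambda>v. v)) (at (snd c p))"
    by (rule has_derivative_transform_within_open[OF has_derivative_ident]) (use assms in auto)
  from fderiv_eq[OF this] show ?thesis by (simp add: comp_def)
qed

lemma fderiv_rep_linear:
  assumes "smooth_map A B S f" "c \<in> A" "d \<in> B" "p \<in> S" "p \<in> fst c" "f p \<in> fst d"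
  shows "linear (fderiv (rep c d f) (snd c p))"
  by (rule smooth_on_linear_fderiv[OF smooth_mapD(2)]) (use assms in auto)

lemma tangent_map_comp:
  assumes f: "smooth_map A B S f" and g: "smooth_map B C T g"
    and A: "\<And>c. c \<in> A \<Longrightarrow> is_chart c" and B: "\<And>c. c \<in> B \<Longrightarrow> is_chart c"
    and p: "p \<in> S" "f p \<in> T"
  shows "tangent_map A C (g \<circ> f) p v = tangent_map B C g (f p) (tangent_map A B f p v)"
proof -
  have "p \<in> carrier A" "f p \<in> carrier B" "g (f p) \<in> carrier C"
    using f g p by (auto simp: smooth_map_def)
  note c = chart_at_in[OF this(1)] chart_at_in[OF this(2)] chart_at_in[OF this(3)]
  show ?thesis
    using fderiv_rep_comp[OF f g A[OF c(1)] B[OF c(3)] c(1) c(3) c(5) p(1) c(2) c(4) p(2) c(6), of v]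
    by (simp add: tangent_map_def)
qed

lemma tangent_map_id:
  assumes f: "smooth_map A A S f" "\<And>q. q \<in> S \<Longrightarrow> f q = q"
    and A: "\<And>c. c \<in> A \<Longrightarrow> is_chart c" and p: "p \<in> S"
  shows "tangent_map A A f p v = v"
proof -
  have "p \<in> carrier A" using f p by (auto simp: smooth_map_def)
  note c = chart_at_in[OF this]
  show ?thesis
    using fderiv_rep_id[OF f A[OF c(1)] c(1) p c(2)] f(2)[OF p] by (simp add: tangent_map_def)
qed

section \<open>Tangent vectors, differentials and vector fields in charts\<close>

context
  fixes A :: "('p, 'e::euclidean_space) chart set"
  assumes A: "smooth_atlas A"
begin

text \<open>Passing from preferred coordinates to a chart is the derivative of a representative of
  the identity, which brings changes of coordinates under the chain rule for smooth maps.\<close>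

lemma vec_to_chart_rep: "vec_to_chart A c p = fderiv (rep (chart_at A p) c id) (pref A p p)"
  by (simp add: vec_to_chart_def fun_eq_iff)

lemma vec_from_chart_rep: "vec_from_chart A c p = fderiv (rep c (chart_at A p) id) (snd c p)"
  by (simp add: vec_from_chart_def fun_eq_iff)

lemma vec_chart_inverse:
  assumes "c \<in> A" "p \<in> fst c"
  shows "vec_to_chart A c p (vec_from_chart A c p v) = v" "vec_from_chart A c p (vec_to_chart A c p v) = v"
proof -
  have p: "p \<in> carrier A" using assms by (auto simp: carrier_def)
  note c = chart_at_in[OF p]
  note ch = smooth_atlas_is_chart[OF A]
  have "fderiv (rep c c id) (snd c p) v = v" if "c \<in> A" "p \<in> fst c" for c
    by (rule fderiv_rep_id[OF smooth_map_id[OF A] _ ch]) (use that p in auto)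
  note id = this[OF assms] this[OF c]
  show "vec_to_chart A c p (vec_from_chart A c p v) = v"
    using fderiv_rep_comp[OF smooth_map_id[OF A] smooth_map_id[OF A] ch[OF assms(1)] ch[OF c(1)] assms(1) c(1) assms(1),
        of p v] id assms c p
    by (simp add: vec_to_chart_rep vec_from_chart_rep)
  show "vec_from_chart A c p (vec_to_chart A c p v) = v"
    using fderiv_rep_comp[OF smooth_map_id[OF A] smooth_map_id[OF A] ch[OF c(1)] ch[OF assms(1)] c(1) assms(1) c(1),
        of p v] id assms c p
    by (simp add: vec_to_chart_rep vec_from_chart_rep)
qed

lemma vec_to_chart_pref: "p \<in> carrier A \<Longrightarrow> vec_to_chart A (chart_at A p) p v = v"
  using fderiv_rep_id[OF smooth_map_id[OF A] _ smooth_atlas_is_chart[OF A], of "chart_at A p" p v] chart_at_in[of p A]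
  by (simp add: vec_to_chart_rep)

lemma vec_from_chart_pref: "p \<in> carrier A \<Longrightarrow> vec_from_chart A (chart_at A p) p v = v"
  using fderiv_rep_id[OF smooth_map_id[OF A] _ smooth_atlas_is_chart[OF A], of "chart_at A p" p v] chart_at_in[of p A]
  by (simp add: vec_from_chart_rep)

lemma linear_vec_to_chart:
  assumes "c \<in> A" "p \<in> fst c" shows "linear (vec_to_chart A c p)"
proof -
  have p: "p \<in> carrier A" using assms by (auto simp: carrier_def)
  show ?thesis
    using fderiv_rep_linear[OF smooth_map_id[OF A] chart_at_in(1)[OF p] assms(1) p chart_at_in(2)[OF p]] assms
    by (simp add: vec_to_chart_rep)
qed

lemma linear_vec_from_chart:
  assumes "c \<in> A" "p \<in> fst c" shows "linear (vec_from_chart A c p)"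
proof -
  have p: "p \<in> carrier A" using assms by (auto simp: carrier_def)
  show ?thesis
    using fderiv_rep_linear[OF smooth_map_id[OF A] assms(1) chart_at_in(1)[OF p] p assms(2)] chart_at_in(2)[OF p]
    by (simp add: vec_from_chart_rep)
qed

lemma differential_in_chart:
  assumes "smooth_function A h" "c \<in> A" "p \<in> fst c"
  shows "differential A h p v = fderiv (h \<circ> chart_inv c) (snd c p) (vec_to_chart A c p v)"
proof -
  have p: "p \<in> carrier A" using assms by (auto simp: carrier_def)
  note c = chart_at_in[OF p]
  note ch = smooth_atlas_is_chart[OF A]
  have "(h \<circ> chart_inv c has_derivative fderiv (h \<circ> chart_inv c) (snd c p)) (at (snd c p))"
    using assms unfolding smooth_function_def by (intro smooth_on_has_derivative) auto
  from has_derivative_rep_comp[OF smooth_map_id[OF A] ch[OF c(1)] ch[OF assms(2)] c(1) assms(2) p c(2), of h] this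
  have "(h \<circ> id \<circ> chart_inv (chart_at A p) has_derivative
     (\<lambda>v. fderiv (h \<circ> chart_inv c) (snd c p) (fderiv (rep (chart_at A p) c id) (pref A p p) v))) (at (pref A p p))"
    using assms by simp
  from fderiv_eq[OF this] show ?thesis
    by (simp add: differential_def vec_to_chart_rep)
qed

text \<open>Both sides are the derivative of the representative of \<open>f\<close> from the
  preferred chart of \<open>p\<close> to the chart \<open>d\<close>, factored once as
  \<open>id \<circ> f\<close> and once as \<open>f \<circ> id\<close>.\<close>

lemma vec_to_chart_tangent_map:
  fixes B :: "('q, 'f::euclidean_space) chart set"
  assumes B: "smooth_atlas B" and f: "smooth_map A B S f" and c: "c \<in> A" "p \<in> fst c" and d: "d \<in> B" "f p \<in> fst d"
    and p: "p \<in> S"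
  shows "vec_to_chart B d (f p) (tangent_map A B f p v) = fderiv (rep c d f) (snd c p) (vec_to_chart A c p v)"
proof -
  have pA: "p \<in> carrier A" and pB: "f p \<in> carrier B" using f p by (auto simp: smooth_map_def)
  note c' = chart_at_in[OF pA] and d' = chart_at_in[OF pB]
  note chA = smooth_atlas_is_chart[OF A] and chB = smooth_atlas_is_chart[OF B]
  have "vec_to_chart B d (f p) (tangent_map A B f p v) = fderiv (rep (chart_at A p) d (id \<circ> f)) (pref A p p) v"
    using fderiv_rep_comp[OF f smooth_map_id[OF B] chA[OF c'(1)] chB[OF d'(1)] c'(1) d'(1) d(1) p c'(2) d'(2) pB] d
    by (simp add: fun_eq_iff vec_to_chart_def tangent_map_def)
  also have "\<dots> = fderiv (rep (chart_at A p) d (f \<circ> id)) (pref A p p) v" by simp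
  also have "\<dots> = fderiv (rep c d f) (snd c p) (vec_to_chart A c p v)"
    using fderiv_rep_comp[OF smooth_map_id[OF A] f chA[OF c'(1)] chA[OF c(1)] c'(1) c(1) d(1) pA c'(2)] c d p
    by (simp add: vec_to_chart_def)
  finally show ?thesis .
qed

lemma differential_comp:
  fixes B :: "('q, 'f::euclidean_space) chart set"
  assumes B: "smooth_atlas B" and f: "smooth_map A B S f" and h: "smooth_function B h" and p: "p \<in> S"
  shows "differential A (\<lambda>q. h (f q)) p v = differential B h (f p) (tangent_map A B f p v)"
proof -
  have pA: "p \<in> carrier A" and pB: "f p \<in> carrier B" using f p by (auto simp: smooth_map_def)
  note c' = chart_at_in[OF pA] and d' = chart_at_in[OF pB]
  note chA = smooth_atlas_is_chart[OF A] and chB = smooth_atlas_is_chart[OF B]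
  have "(h \<circ> chart_inv (chart_at B (f p)) has_derivative fderiv (h \<circ> chart_inv (chart_at B (f p))) (pref B (f p) (f p))) (at (pref B (f p) (f p)))"
    using h d' unfolding smooth_function_def by (intro smooth_on_has_derivative) auto
  from fderiv_eq[OF has_derivative_rep_comp[OF f chA[OF c'(1)] chB[OF d'(1)] c'(1) d'(1) p c'(2) d'(2) this]]
  show ?thesis by (simp add: differential_def tangent_map_def o_def)
qed

lemma field_in_chart_pushforward:
  fixes B :: "('q, 'f::euclidean_space) chart set"
  assumes B: "smooth_atlas B" and f: "smooth_map A B S f" "inj_on f S" and c: "c \<in> A" "p \<in> fst c" and d: "d \<in> B" "f p \<in> fst d"
    and p: "p \<in> S"
  shows "field_in_chart B d (pushforward A B f S X) (snd d (f p)) =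
    fderiv (rep c d f) (snd c p) (field_in_chart A c X (snd c p))"
  using vec_to_chart_tangent_map[OF B f(1) c d p, of "X p"] f(2) c d p
    smooth_atlas_is_chart[OF A] smooth_atlas_is_chart[OF B]
  by (simp add: field_in_chart_def pushforward_def)

text \<open>In a chart the pushed field at \<open>y\<close> is the derivative of \<open>f\<close>
  applied to the field, both taken at the preimage of \<open>y\<close>. The preimage depends
  smoothly on \<open>y\<close> because the inverse \<open>g\<close> is a smooth map.\<close>

lemma smooth_pushforward:
  fixes B :: "('q, 'f::euclidean_space) chart set"
  assumes B: "smooth_atlas B" and f: "smooth_map A B S f" and g: "smooth_map B A T g" "T = f ` S"
    and gf: "\<And>p. p \<in> S \<Longrightarrow> g (f p) = p"
    and X: "\<And>c. c \<in> A \<Longrightarrow> smooth_on (snd c ` (S \<inter> fst c)) (field_in_chart A c X)"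
    and d: "d \<in> B"
  shows "smooth_on (snd d ` (T \<inter> fst d)) (field_in_chart B d (pushforward A B f S X))"
proof (rule smooth_on_local)
  note chA = smooth_atlas_is_chart[OF A] and chB = smooth_atlas_is_chart[OF B]
  fix z assume "z \<in> snd d ` (T \<inter> fst d)"
  then obtain p where p: "p \<in> S" "f p \<in> fst d" "z = snd d (f p)" using g(2) by auto
  then have "p \<in> carrier A" using f by (auto simp: smooth_map_def)
  define c where "c = chart_at A p"
  have c: "c \<in> A" "p \<in> fst c" using chart_at_in[OF \<open>p \<in> carrier A\<close>] by (simp_all add: c_def)
  let ?V = "rep_dom d c T g"
  have V: "open ?V" "smooth_on ?V (rep d c g)" using smooth_mapD[OF g(1) d c(1)] .
  have img: "rep d c g ` ?V \<subseteq> rep_dom c d S f" "rep d c g ` ?V \<subseteq> snd c ` (S \<inter> fst c)"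
    using gf chB[OF d] g(2) by auto
  have "smooth_on ?V (\<lambda>z. fderiv (rep c d f) (rep d c g z) (field_in_chart A c X (rep d c g z)))"
    by (rule smooth_on_fderiv_apply[OF V(1) smooth_mapD(1)[OF f c(1) d] smooth_mapD(2)[OF f c(1) d] V(2) img(1)
        smooth_on_compose[OF V(1) smooth_map_open[OF f c(1)] V(2) X[OF c(1)] img(2)]])
  then have "smooth_on ?V (field_in_chart B d (pushforward A B f S X))"
  proof (rule smooth_on_cong[OF V(1), rotated])
    fix y assume "y \<in> ?V"
    then obtain q where q: "q \<in> S" "f q \<in> fst d" "q \<in> fst c" "y = snd d (f q)"
      using g(2) gf by auto
    have "inj_on f S" using gf by (metis inj_on_inverseI)
    from field_in_chart_pushforward[OF B f this c(1) q(3) d q(2) q(1), of X]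
    show "fderiv (rep c d f) (rep d c g y) (field_in_chart A c X (rep d c g y)) = field_in_chart B d (pushforward A B f S X) y"
      using q gf chB[OF d] by simp
  qed
  moreover have "z \<in> ?V" using p c g(2) gf by auto
  ultimately show "\<exists>V. open V \<and> z \<in> V \<and> smooth_on V (field_in_chart B d (pushforward A B f S X))"
    using V(1) by blast
qed

subsection \<open>Hamiltonian vector fields\<close>

lemma hamiltonian_in_chart:
  assumes H: "smooth_function A H" and X: "\<forall>p\<in>carrier A. \<forall>w. \<Omega> p (X p) w = differential A H p w"
    and c: "c \<in> A" "z \<in> snd c ` fst c"
  shows "form_in_chart A c \<Omega> z (field_in_chart A c X z) w = fderiv (H \<circ> chart_inv c) z w"
proof -
  obtain p where p: "p \<in> fst c" "z = snd c p" using c by blast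
  have pA: "p \<in> carrier A" using p c by (auto simp: carrier_def)
  note ch = smooth_atlas_is_chart[OF A c(1)]
  show ?thesis
    using X pA p ch vec_chart_inverse[OF c(1) p(1)] differential_in_chart[OF H c(1) p(1)]
    by (simp add: form_in_chart_def field_in_chart_def)
qed

lemma linear_form_in_chart:
  assumes \<Omega>: "\<forall>p\<in>carrier A. linear_symplectic UNIV (\<Omega> p)" and c: "c \<in> A" "z \<in> snd c ` fst c"
  shows "linear (\<lambda>u. form_in_chart A c \<Omega> z u w)" "linear (form_in_chart A c \<Omega> z u)"
    "(\<And>w. form_in_chart A c \<Omega> z u w = 0) \<Longrightarrow> u = 0"
proof -
  obtain p where p: "p \<in> fst c" "z = snd c p" using c by blast
  have pA: "p \<in> carrier A" using p c by (auto simp: carrier_def)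
  have "linear_symplectic UNIV (\<Omega> p)" using \<Omega> pA by blast
  then have bil: "\<Omega> p (a *\<^sub>R u + b *\<^sub>R v) w = a * \<Omega> p u w + b * \<Omega> p v w"
      and bil': "\<Omega> p w (a *\<^sub>R u + b *\<^sub>R v) = a * \<Omega> p w u + b * \<Omega> p w v"
      and nd: "(\<forall>w. \<Omega> p u w = 0) \<Longrightarrow> u = 0" for a b u v w
    by (auto simp: linear_symplectic_def)
  have add: "\<Omega> p (u + v) w = \<Omega> p u w + \<Omega> p v w" "\<Omega> p w (u + v) = \<Omega> p w u + \<Omega> p w v"
    and sc: "\<Omega> p (a *\<^sub>R u) w = a * \<Omega> p u w" "\<Omega> p w (a *\<^sub>R u) = a * \<Omega> p w u" for u v w a
    using bil[of 1 u 1 v w] bil[of a u 0 u w] bil'[of w 1 u 1 v] bil'[of w a u 0 u] by simp_all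
  note ch = smooth_atlas_is_chart[OF A c(1)]
  note lin = linear_vec_from_chart[OF c(1) p(1)]
  show "linear (\<lambda>u. form_in_chart A c \<Omega> z u w)" "linear (form_in_chart A c \<Omega> z u)"
    using ch p lin by (auto intro!: linearI simp: form_in_chart_def linear_add linear_scale add sc)
  assume 0: "form_in_chart A c \<Omega> z u w = 0" for w
  have "\<Omega> p (vec_from_chart A c p u) w = 0" for w
    using 0[of "vec_to_chart A c p w"] ch p vec_chart_inverse[OF c(1) p(1)] by (simp add: form_in_chart_def)
  then have "vec_from_chart A c p u = 0" using nd by blast
  then show "u = 0"
    using vec_chart_inverse(1)[OF c(1) p(1), of u] linear_0[OF linear_vec_to_chart[OF c(1) p(1)]] by simp
qed

text \<open>In a chart the field solves a nondegenerate linear system whose coefficients are those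
  of the form and whose right side consists of the partial derivatives of \<open>H\<close>.\<close>

lemma hamiltonian_smooth:
  assumes H: "smooth_function A H" and \<Omega>: "symplectic_form A \<Omega>"
    and X: "\<forall>p\<in>carrier A. \<forall>w. \<Omega> p (X p) w = differential A H p w" and c: "c \<in> A"
  shows "smooth_on (snd c ` fst c) (field_in_chart A c X)"
proof (rule smooth_on_solution[where \<omega> = "form_in_chart A c \<Omega>" and \<alpha> = "\<lambda>z w. fderiv (H \<circ> chart_inv c) z w"])
  show "open (snd c ` fst c)" using smooth_atlas_is_chart[OF A c] by (simp add: is_chart_def)
  have "\<forall>p\<in>carrier A. linear_symplectic UNIV (\<Omega> p)" using \<Omega> by (simp add: symplectic_form_def)
  note lin = linear_form_in_chart[OF this c]
  show "linear (\<lambda>u. form_in_chart A c \<Omega> z u w)" "linear (form_in_chart A c \<Omega> z u)"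
    if "z \<in> snd c ` fst c" for z u w
    using lin(1,2)[OF that] by blast+
  show "u = 0" if "z \<in> snd c ` fst c" "\<And>w. form_in_chart A c \<Omega> z u w = 0" for z u
    using lin(3)[OF that] .
  show "smooth_on (snd c ` fst c) (\<lambda>z. form_in_chart A c \<Omega> z u w)" for u w
    using \<Omega> c by (simp add: symplectic_form_def)
  show "smooth_on (snd c ` fst c) (\<lambda>z. fderiv (H \<circ> chart_inv c) z w)" for w
    using H c by (intro smooth_on_fderiv) (simp add: smooth_function_def)
  show "form_in_chart A c \<Omega> z (field_in_chart A c X z) w = fderiv (H \<circ> chart_inv c) z w" if "z \<in> snd c ` fst c" for z w
    by (rule hamiltonian_in_chart[where \<Omega> = \<Omega>, OF H X c that])
qed

end

section \<open>Linear flows generated by skew maps\<close>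

text \<open>The degenerate case of the Cauchy-Schwarz inequality: otherwise the form would be affine
  and nonconstant along the line through \<open>w\<close> in the direction \<open>v\<close>, hence
  negative somewhere. It serves both the eigenvector argument below and the definiteness of the
  Hessian on the fibres.\<close>

lemma psd_null_vector:
  fixes b :: "'e::real_vector \<Rightarrow> 'e \<Rightarrow> real"
  assumes V: "subspace V" and b: "bilinear b" "\<And>u v. u \<in> V \<Longrightarrow> v \<in> V \<Longrightarrow> b u v = b v u"
    and psd: "\<And>v. v \<in> V \<Longrightarrow> 0 \<le> b v v" and v: "v \<in> V" "b v v = 0" and w: "w \<in> V"
  shows "b v w = 0"
proof (rule ccontr)
  assume n: "b v w \<noteq> 0"
  \<comment> \<open>Chosen so that the form takes the value -1 at
    \<open>w + t *\<^sub>R v\<close>.\<close>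
  define t where "t = - (b w w + 1) / (2 * b v w)"
  have "w + t *\<^sub>R v \<in> V" using V v w by (simp add: subspace_add subspace_scale)
  from psd[OF this] have "0 \<le> b w w + 2 * t * b v w"
    using b(2)[OF v(1) w] v(2)
    by (simp add: bilinear_ladd[OF b(1)] bilinear_radd[OF b(1)] bilinear_lmul[OF b(1)] bilinear_rmul[OF b(1)])
  also have "2 * t * b v w = - (b w w + 1)" using n by (simp add: t_def)
  finally show False by simp
qed

text \<open>A maximiser of \<open>h (Y v) (Y v) / h v v\<close> is an eigenvector of \<open>Y\<^sup>2\<close>.\<close>

lemma skew_eigenplane:
  fixes h :: "'e::euclidean_space \<Rightarrow> 'e \<Rightarrow> real"
  assumes V: "subspace V" "V \<noteq> {0}" and h: "bilinear h" "\<And>u v. h u v = h v u" "\<And>v. v \<in> V \<Longrightarrow> v \<noteq> 0 \<Longrightarrow> 0 < h v v"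
    and Y: "linear Y" "Y ` V \<subseteq> V" "\<And>u v. u \<in> V \<Longrightarrow> v \<in> V \<Longrightarrow> h (Y u) v = - h u (Y v)"
      "\<And>v. v \<in> V \<Longrightarrow> Y v = 0 \<Longrightarrow> v = 0"
  obtains e f \<omega> where "e \<in> V" "f \<in> V" "Y e = \<omega> *\<^sub>R f" "Y f = - \<omega> *\<^sub>R e" "h e e = 1" "h f f = 1" "h e f = 0"
proof -
  note hs = bilinear_ladd[OF h(1)] bilinear_radd[OF h(1)] bilinear_lmul[OF h(1)] bilinear_rmul[OF h(1)]
    bilinear_lzero[OF h(1)] bilinear_rzero[OF h(1)]
  let ?S = "V \<inter> sphere 0 1"
  have S: "compact ?S" by (intro closed_Int_compact closed_subspace V compact_sphere)
  obtain u where u: "u \<in> V" "u \<noteq> 0" using V subspace_0 by blast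
  then have "(1 / norm u) *\<^sub>R u \<in> ?S" using V by (simp add: subspace_scale)
  then have "?S \<noteq> {}" by blast
  define R where "R v = h (Y v) (Y v) / h v v" for v
  have nz: "v \<noteq> 0" if "v \<in> ?S" for v using that by auto
  have "continuous_on ?S R"
    unfolding R_def using h(3) nz
    by (intro continuous_on_divide bilinear_continuous_on_compose[OF _ _ h(1)] linear_continuous_on_compose[OF _ Y(1)]
        continuous_on_id) force
  then obtain v where v: "v \<in> ?S" "\<And>w. w \<in> ?S \<Longrightarrow> R w \<le> R v"
    using continuous_attains_sup[OF S \<open>?S \<noteq> {}\<close>] by blast
  have vV: "v \<in> V" and v0: "v \<noteq> 0" using v nz by auto
  define l where "l = R v"
  have hv: "0 < h v v" using h(3) vV v0 by blast
  have max: "h (Y w) (Y w) \<le> l * h w w" if w: "w \<in> V" for w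
  proof (cases "w = 0")
    case False
    have "(1 / norm w) *\<^sub>R w \<in> ?S" using V w False by (simp add: subspace_scale)
    from v(2)[OF this] have "R w \<le> l"
      using False by (simp add: R_def l_def hs linear_scale[OF Y(1)])
    then show ?thesis using h(3)[OF w False] by (simp add: R_def field_simps)
  qed (simp add: linear_0[OF Y(1)] hs)
  have "Y v \<in> V" using Y(2) vV by blast
  have "Y v \<noteq> 0" using Y(4) vV v0 by blast
  then have "0 < h (Y v) (Y v)" using h(3) \<open>Y v \<in> V\<close> by blast
  then have l: "0 < l" using hv by (simp add: l_def R_def)
  have lv: "h (Y v) (Y v) = l * h v v" using hv by (simp add: l_def R_def)
  \<comment> \<open>Maximality of \<open>l\<close> makes this form semidefinite with null vector
    \<open>v\<close>, so \<open>v\<close> lies in its radical; by skewness of \<open>Y\<close> that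
    says that \<open>l *\<^sub>R v + Y (Y v)\<close> is orthogonal to \<open>V\<close>.\<close>
  define b where "b u w = l * h u w - h (Y u) (Y w)" for u w
  have "bilinear b"
    unfolding b_def bilinear_def
    by (auto intro!: linearI simp: hs linear_add[OF Y(1)] linear_scale[OF Y(1)] algebra_simps)
  moreover have "b u w = b w u" for u w unfolding b_def using h(2) by metis
  moreover have "0 \<le> b w w" if "w \<in> V" for w using max[OF that] by (simp add: b_def)
  moreover have "b v v = 0" by (simp add: b_def lv)
  ultimately have bv: "b v w = 0" if "w \<in> V" for w
    using psd_null_vector[OF V(1)] vV that by blast
  have "Y (Y v) \<in> V" using Y(2) \<open>Y v \<in> V\<close> by blast
  have YY: "Y (Y v) = - l *\<^sub>R v"
  proof (rule ccontr)
    assume "Y (Y v) \<noteq> - l *\<^sub>R v"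
    then have n: "l *\<^sub>R v + Y (Y v) \<noteq> 0" by (simp add: eq_neg_iff_add_eq_0 add.commute)
    have m: "l *\<^sub>R v + Y (Y v) \<in> V" using V vV \<open>Y (Y v) \<in> V\<close> by (simp add: subspace_add subspace_scale)
    have "h (l *\<^sub>R v + Y (Y v)) w = l * h v w + h (Y (Y v)) w" for w by (simp add: hs)
    then have "h (l *\<^sub>R v + Y (Y v)) (l *\<^sub>R v + Y (Y v)) = 0"
      using bv[OF m] Y(3)[OF \<open>Y v \<in> V\<close> m] by (simp add: b_def)
    then show False using h(3)[OF m n] by simp
  qed
  define \<omega> where "\<omega> = sqrt l"
  have w: "\<omega> > 0" "\<omega> * \<omega> = l" using l by (simp_all add: \<omega>_def)
  define s where "s = sqrt (h v v)"
  have s: "s > 0" "s * s = h v v" using hv by (simp_all add: s_def)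
  define e where "e = (1 / s) *\<^sub>R v"
  define f where "f = (1 / \<omega>) *\<^sub>R Y e"
  show ?thesis
  proof
    show "e \<in> V" using V vV by (simp add: e_def subspace_scale)
    then show "f \<in> V" using V Y(2) by (auto simp: f_def intro: subspace_scale)
    show "Y e = \<omega> *\<^sub>R f" using w by (simp add: f_def)
    have YYe: "Y (Y e) = - l *\<^sub>R e" by (simp add: e_def linear_scale[OF Y(1)] YY)
    have "l / \<omega> = \<omega>" unfolding w(2)[symmetric] using w(1) by simp
    then show "Y f = - \<omega> *\<^sub>R e"
      using YYe by (simp add: f_def linear_scale[OF Y(1)])
    show "h e e = 1" using s hv by (simp add: e_def hs field_simps)
    have "h (Y e) (Y e) = l"
      using s hv lv by (simp add: e_def hs linear_scale[OF Y(1)] field_simps)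
    then show "h f f = 1" using w l by (simp add: f_def hs field_simps)
    have "h (Y e) e = - h e (Y e)" using Y(3) \<open>e \<in> V\<close> by blast
    then have "h e (Y e) = 0" using h(2)[of "Y e" e] by simp
    then show "h e f = 0" by (simp add: f_def hs)
  qed
qed

text \<open>Induction on the dimension: skewness makes the orthogonal complement of an invariant
  plane invariant again, so eigenplanes can be split off one after the other.\<close>

lemma skew_normal_form:
  fixes h :: "'e::euclidean_space \<Rightarrow> 'e \<Rightarrow> real"
  assumes "subspace V" and h: "bilinear h" "\<And>u v. h u v = h v u" and "\<And>v. v \<in> V \<Longrightarrow> v \<noteq> 0 \<Longrightarrow> 0 < h v v"
    and Y: "linear Y" and "Y ` V \<subseteq> V" "\<And>u v. u \<in> V \<Longrightarrow> v \<in> V \<Longrightarrow> h (Y u) v = - h u (Y v)"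
      "\<And>v. v \<in> V \<Longrightarrow> Y v = 0 \<Longrightarrow> v = 0"
  shows "\<exists>(k::nat) e f \<omega>. (\<forall>i<k. e i \<in> V \<and> f i \<in> V \<and> Y (e i) = \<omega> i *\<^sub>R f i \<and> Y (f i) = - \<omega> i *\<^sub>R e i) \<and>
    (\<forall>i<k. \<forall>j<k. h (e i) (e j) = (if i = j then 1 else 0) \<and> h (f i) (f j) = (if i = j then 1 else 0) \<and> h (e i) (f j) = 0) \<and>
    (\<forall>v\<in>V. v = (\<Sum>i<k. h (e i) v *\<^sub>R e i + h (f i) v *\<^sub>R f i))"
  using assms(1,4,6,7,8)
proof (induction "dim V" arbitrary: V rule: less_induct)
  case less
  note hs = bilinear_ladd[OF h(1)] bilinear_radd[OF h(1)] bilinear_lmul[OF h(1)] bilinear_rmul[OF h(1)]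
    bilinear_lzero[OF h(1)] bilinear_rzero[OF h(1)] bilinear_lsub[OF h(1)] bilinear_rsub[OF h(1)]
  show ?case
  proof (cases "V = {0}")
    case True
    then show ?thesis by (intro exI[of _ 0]) auto
  next
    case False
    obtain a b w where ab: "a \<in> V" "b \<in> V" "Y a = w *\<^sub>R b" "Y b = - w *\<^sub>R a" "h a a = 1" "h b b = 1" "h a b = 0"
      using skew_eigenplane[OF less.prems(1) False h less.prems(2) Y less.prems(3-5)] by blast
    have ba: "h b a = 0" using ab(7) h(2) by metis
    define V' where "V' = {v \<in> V. h a v = 0 \<and> h b v = 0}"
    have sub: "subspace V'"
      using less.prems(1) unfolding V'_def subspace_def by (auto simp: hs)
    have V'V: "V' \<subseteq> V" by (auto simp: V'_def)
    have "a \<notin> V'" using ab by (simp add: V'_def)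
    then have "dim V' < dim V"
      using subspace_dim_equal[OF sub less.prems(1) V'V] ab(1) dim_subset[OF V'V] by fastforce
    moreover have "Y ` V' \<subseteq> V'"
    proof
      fix y assume "y \<in> Y ` V'"
      then obtain v where v: "v \<in> V" "h a v = 0" "h b v = 0" "y = Y v" by (auto simp: V'_def)
      have "h (Y a) v = - h a (Y v)" "h (Y b) v = - h b (Y v)"
        using less.prems(4) ab(1,2) v(1) by blast+
      then have "h a (Y v) = 0" "h b (Y v) = 0"
        using v(2,3) by (simp_all add: ab(3,4) hs bilinear_lneg[OF h(1)])
      then show "y \<in> V'" using v less.prems(3) by (auto simp: V'_def)
    qed
    moreover have "0 < h v v" if "v \<in> V'" "v \<noteq> 0" for v
      using less.prems(2) V'V that by blast
    moreover have "h (Y u) v = - h u (Y v)" if "u \<in> V'" "v \<in> V'" for u v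
      using less.prems(4) V'V that by blast
    moreover have "v = 0" if "v \<in> V'" "Y v = 0" for v
      using less.prems(5) V'V that by blast
    ultimately obtain k :: nat and e f \<omega> where 1: "\<forall>i<k. e i \<in> V' \<and> f i \<in> V' \<and> Y (e i) = \<omega> i *\<^sub>R f i \<and> Y (f i) = - \<omega> i *\<^sub>R e i"
      and 2: "\<forall>i<k. \<forall>j<k. h (e i) (e j) = (if i = j then 1 else 0) \<and> h (f i) (f j) = (if i = j then 1 else 0) \<and> h (e i) (f j) = 0"
      and 3: "\<forall>v\<in>V'. v = (\<Sum>i<k. h (e i) v *\<^sub>R e i + h (f i) v *\<^sub>R f i)"
      using less.hyps[of V'] sub by blast
    have o: "h a (e i) = 0" "h a (f i) = 0" "h b (e i) = 0" "h b (f i) = 0"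
        "h (e i) a = 0" "h (f i) a = 0" "h (e i) b = 0" "h (f i) b = 0" if "i < k" for i
      using 1 that h(2)[of "e i"] h(2)[of "f i"] by (auto simp: V'_def)
    let ?e = "e(k := a)" and ?f = "f(k := b)" and ?w = "fun_upd \<omega> k w"
    have "v = (\<Sum>i<Suc k. h (?e i) v *\<^sub>R ?e i + h (?f i) v *\<^sub>R ?f i)" if v: "v \<in> V" for v
    proof -
      define v' where "v' = v - (h a v *\<^sub>R a + h b v *\<^sub>R b)"
      have "v' \<in> V'"
        using v ab ba less.prems(1) by (auto simp: V'_def v'_def hs intro!: subspace_diff subspace_add subspace_scale)
      then have "v' = (\<Sum>i<k. h (e i) v' *\<^sub>R e i + h (f i) v' *\<^sub>R f i)" using 3 by blast
      also have "\<dots> = (\<Sum>i<k. h (?e i) v *\<^sub>R ?e i + h (?f i) v *\<^sub>R ?f i)"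
        by (rule sum.cong) (auto simp: v'_def hs o)
      finally show ?thesis by (simp add: v'_def algebra_simps)
    qed
    moreover have "\<forall>i<Suc k. ?e i \<in> V \<and> ?f i \<in> V \<and> Y (?e i) = ?w i *\<^sub>R ?f i \<and> Y (?f i) = - ?w i *\<^sub>R ?e i"
      using 1 ab V'V by (auto simp: less_Suc_eq)
    moreover have "\<forall>i<Suc k. \<forall>j<Suc k. h (?e i) (?e j) = (if i = j then 1 else 0) \<and> h (?f i) (?f j) = (if i = j then 1 else 0) \<and> h (?e i) (?f j) = 0"
      using 2 ab o by (auto simp: less_Suc_eq)
    ultimately show ?thesis by blast
  qed
qed

text \<open>The pair of coordinates along \<open>e i\<close> and \<open>f i\<close> forms one
  complex coordinate, in which \<open>Y\<close> is multiplication by the imaginary number with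
  imaginary part \<open>\<omega> i\<close>. The flow can therefore be written down as a product of
  rotations and checked by differentiation.\<close>

lemma skew_flow:
  fixes h :: "'e::euclidean_space \<Rightarrow> 'e \<Rightarrow> real"
  assumes V: "subspace V" and h: "bilinear h" "\<And>u v. h u v = h v u" "\<And>v. v \<in> V \<Longrightarrow> v \<noteq> 0 \<Longrightarrow> 0 < h v v"
    and Y: "linear Y" "Y ` V \<subseteq> V" "\<And>u v. u \<in> V \<Longrightarrow> v \<in> V \<Longrightarrow> h (Y u) v = - h u (Y v)"
      "\<And>v. v \<in> V \<Longrightarrow> Y v = 0 \<Longrightarrow> v = 0"
  shows "\<exists>(k::nat) (\<zeta> :: nat \<Rightarrow> 'e \<Rightarrow> complex) (\<omega> :: nat \<Rightarrow> real) (\<theta> :: real \<Rightarrow> 'e \<Rightarrow> 'e).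
    (\<forall>i<k. linear (\<zeta> i)) \<and>
    bij_betw (\<lambda>v. \<lambda>i\<in>{..<k}. \<zeta> i v) V ({..<k} \<rightarrow>\<^sub>E UNIV) \<and>
    (\<forall>v\<in>V. \<theta> 0 v = v \<and> (\<forall>t. \<theta> t v \<in> V) \<and>
       (\<forall>t. ((\<lambda>t. \<theta> t v) has_vector_derivative Y (\<theta> t v)) (at t)) \<and>
       (\<forall>t. \<forall>i<k. \<zeta> i (\<theta> t v) = cis (\<omega> i * t) * \<zeta> i v))"
proof -
  note hs = bilinear_ladd[OF h(1)] bilinear_radd[OF h(1)] bilinear_lmul[OF h(1)] bilinear_rmul[OF h(1)]
    bilinear_lzero[OF h(1)] bilinear_rzero[OF h(1)]
  obtain k :: nat and e f \<omega> where 1: "\<forall>i<k. e i \<in> V \<and> f i \<in> V \<and> Y (e i) = \<omega> i *\<^sub>R f i \<and> Y (f i) = - \<omega> i *\<^sub>R e i"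
    and 2: "\<forall>i<k. \<forall>j<k. h (e i) (e j) = (if i = j then 1 else 0) \<and> h (f i) (f j) = (if i = j then 1 else 0) \<and> h (e i) (f j) = 0"
    and 3: "\<forall>v\<in>V. v = (\<Sum>i<k. h (e i) v *\<^sub>R e i + h (f i) v *\<^sub>R f i)"
    using skew_normal_form[OF V h Y] by blast
  define \<zeta> where "\<zeta> i v = Complex (h (e i) v) (h (f i) v)" for i v
  define comb where "comb c = (\<Sum>i<k. Re (c i) *\<^sub>R e i + Im (c i) *\<^sub>R f i)" for c
  have combV: "comb c \<in> V" for c
    unfolding comb_def using V 1 by (intro subspace_sum subspace_add subspace_scale) auto
  have \<zeta>_comb: "\<zeta> j (comb c) = c j" if j: "j < k" for j c
  proof -
    have lin: "linear (h u)" for u using h(1) by (simp add: bilinear_def)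
    have fe: "h (f j) (e i) = 0" if "i < k" for i using 2 that j h(2) by metis
    have "h (e j) (comb c) = (\<Sum>i<k. if j = i then Re (c i) else 0)"
      unfolding comb_def linear_sum[OF lin] by (rule sum.cong) (use 2 j in \<open>auto simp: hs\<close>)
    moreover have "h (f j) (comb c) = (\<Sum>i<k. if j = i then Im (c i) else 0)"
      unfolding comb_def linear_sum[OF lin] by (rule sum.cong) (use 2 fe j in \<open>auto simp: hs\<close>)
    ultimately show ?thesis using j by (simp add: \<zeta>_def complex_eq_iff)
  qed
  have comb_\<zeta>: "comb (\<lambda>i. \<zeta> i v) = v" if "v \<in> V" for v
    using 3 that by (simp add: comb_def \<zeta>_def)
  have comb_cong: "comb c = comb c'" if "\<And>i. i < k \<Longrightarrow> c i = c' i" for c c'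
    unfolding comb_def using that by (intro sum.cong) auto
  define \<theta> where "\<theta> t v = comb (\<lambda>i. cis (\<omega> i * t) * \<zeta> i v)" for t v
  have "((\<lambda>t. \<theta> t v) has_vector_derivative Y (\<theta> t v)) (at t)" for v t
  proof -
    let ?c = "\<lambda>i t. cis (\<omega> i * t) * \<zeta> i v"
    have "((\<lambda>t. Re (?c i t)) has_real_derivative - \<omega> i * Im (?c i t)) (at t)"
      "((\<lambda>t. Im (?c i t)) has_real_derivative \<omega> i * Re (?c i t)) (at t)" for i
      by (auto intro!: derivative_eq_intros simp: algebra_simps)
    then have "((\<lambda>t. \<Sum>i<k. Re (?c i t) *\<^sub>R e i + Im (?c i t) *\<^sub>R f i) has_vector_derivative
       (\<Sum>i<k. (- \<omega> i * Im (?c i t)) *\<^sub>R e i + (\<omega> i * Re (?c i t)) *\<^sub>R f i)) (at t)"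
      by (intro has_vector_derivative_sum has_vector_derivative_add
          has_vector_derivative_scaleR[where g' = 0, simplified] has_vector_derivative_const)
    moreover have "Y (\<theta> t v) = (\<Sum>i<k. (- \<omega> i * Im (?c i t)) *\<^sub>R e i + (\<omega> i * Re (?c i t)) *\<^sub>R f i)"
      unfolding \<theta>_def comb_def linear_sum[OF Y(1)] linear_add[OF Y(1)] linear_scale[OF Y(1)]
      using 1 by (intro sum.cong) (simp_all add: algebra_simps)
    ultimately show ?thesis unfolding \<theta>_def comb_def by simp
  qed
  moreover have "linear (\<zeta> i)" for i
    by (auto intro!: linearI simp: \<zeta>_def hs complex_eq_iff)
  moreover have "bij_betw (\<lambda>v. \<lambda>i\<in>{..<k}. \<zeta> i v) V ({..<k} \<rightarrow>\<^sub>E UNIV)"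
  proof (rule bij_betw_byWitness[where f' = comb])
    show "\<forall>v\<in>V. comb (\<lambda>i\<in>{..<k}. \<zeta> i v) = v"
    proof
      fix v assume "v \<in> V"
      have "comb (\<lambda>i\<in>{..<k}. \<zeta> i v) = comb (\<lambda>i. \<zeta> i v)" by (rule comb_cong) simp
      then show "comb (\<lambda>i\<in>{..<k}. \<zeta> i v) = v" using comb_\<zeta> \<open>v \<in> V\<close> by simp
    qed
    show "\<forall>c\<in>{..<k} \<rightarrow>\<^sub>E UNIV. (\<lambda>i\<in>{..<k}. \<zeta> i (comb c)) = c"
    proof (intro ballI ext)
      fix c :: "nat \<Rightarrow> complex" and i assume "c \<in> {..<k} \<rightarrow>\<^sub>E UNIV"
      \<comment> \<open>Extensional functions and restrictions take the same default value outside
        the index set, so equality of functions can be checked there too.\<close>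
      then have "c i = undefined" if "\<not> i < k" using PiE_arb[of c "{..<k}" "\<lambda>_. UNIV" i] that by simp
      then show "(\<lambda>i\<in>{..<k}. \<zeta> i (comb c)) i = c i"
        using \<zeta>_comb[of i c] by simp
    qed
    show "(\<lambda>v. \<lambda>i\<in>{..<k}. \<zeta> i v) ` V \<subseteq> {..<k} \<rightarrow>\<^sub>E UNIV"
      by (rule image_subsetI) (rule restrict_PiE_iff[THEN iffD2], simp)
    show "comb ` ({..<k} \<rightarrow>\<^sub>E UNIV) \<subseteq> V"
      using combV by blast
  qed
  moreover have "\<theta> 0 v = v" if "v \<in> V" for v
    using comb_\<zeta>[OF that] by (simp add: \<theta>_def)
  moreover have "\<zeta> i (\<theta> t v) = cis (\<omega> i * t) * \<zeta> i v" if "i < k" for i t v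
    unfolding \<theta>_def by (rule \<zeta>_comb[OF that])
  moreover have "\<theta> t v \<in> V" for t v unfolding \<theta>_def by (rule combV)
  ultimately show ?thesis by blast
qed

section \<open>The normal bundle\<close>

lemma orth_proj_exists:
  fixes S :: "'e::euclidean_space set"
  assumes "subspace S"
  shows "\<exists>P. bounded_linear P \<and> (\<forall>s\<in>S. P s = s) \<and> (\<forall>t\<in>S\<^sup>\<bottom>. P t = 0) \<and> (\<forall>z. P z \<in> S \<and> z - P z \<in> S\<^sup>\<bottom>)"
proof -
  obtain C where C: "C \<subseteq> S" "pairwise orthogonal C" "\<And>x. x \<in> C \<Longrightarrow> norm x = 1" "independent C" "span C = S"
    using orthonormal_basis_subspace[OF assms] by metis
  have fin: "finite C" using C(4) by (rule independent_imp_finite)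
  define P where "P z = (\<Sum>b\<in>C. (z \<bullet> b) *\<^sub>R b)" for z
  have P: "bounded_linear P"
    unfolding P_def
    by (intro bounded_linear_sum bounded_linear_compose[OF bounded_linear_scaleR_left] bounded_linear_inner_left)
  have Pb: "P z \<bullet> b = z \<bullet> b" if "b \<in> C" for z b
  proof -
    have "P z \<bullet> b = (\<Sum>a\<in>C. (z \<bullet> a) * (a \<bullet> b))" by (simp add: P_def inner_sum_left)
    also have "\<dots> = (\<Sum>a\<in>C. if a = b then z \<bullet> b else 0)"
    proof (rule sum.cong)
      show "(z \<bullet> a) * (a \<bullet> b) = (if a = b then z \<bullet> b else 0)" if "a \<in> C" for a
        using C(2,3) that \<open>b \<in> C\<close> by (auto simp: pairwise_def orthogonal_def norm_eq_1)
    qed simp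
    finally show ?thesis using fin that by simp
  qed
  have PS: "P z \<in> S" for z
    unfolding P_def using assms C(1) by (intro subspace_sum subspace_scale) auto
  have orth: "z - P z \<in> S\<^sup>\<bottom>" for z
    unfolding orthogonal_comp_def
  proof (intro CollectI ballI)
    fix y assume "y \<in> S"
    then have "y \<in> span C" using C(5) by simp
    then show "orthogonal y (z - P z)"
    proof (induction rule: span_induct_alt)
      case (step a b y)
      then show ?case
        using Pb[of b z] by (simp add: orthogonal_def inner_left_distrib inner_right_distrib inner_diff_right inner_commute)
    qed (simp add: orthogonal_def)
  qed
  have "P s = s" if "s \<in> S" for s
  proof -
    have "s - P s \<in> S" using assms that PS by (simp add: subspace_diff)
    then have "orthogonal (s - P s) (s - P s)" using orth[of s] by (auto simp: orthogonal_comp_def)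
    then show ?thesis by (simp add: orthogonal_def)
  qed
  moreover have "P t = 0" if "t \<in> S\<^sup>\<bottom>" for t
    using that C(1) by (auto simp: P_def orthogonal_comp_def orthogonal_def inner_commute intro!: sum.neutral)
  ultimately show ?thesis using P PS orth by blast
qed

definition orth_proj :: "'e::euclidean_space set \<Rightarrow> 'e \<Rightarrow> 'e" where
  "orth_proj S = (SOME P. bounded_linear P \<and> (\<forall>s\<in>S. P s = s) \<and> (\<forall>t\<in>S\<^sup>\<bottom>. P t = 0) \<and> (\<forall>z. P z \<in> S \<and> z - P z \<in> S\<^sup>\<bottom>))"

lemma orth_proj:
  assumes "subspace S"
  shows "bounded_linear (orth_proj S)" "s \<in> S \<Longrightarrow> orth_proj S s = s" "t \<in> S\<^sup>\<bottom> \<Longrightarrow> orth_proj S t = 0"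
    "orth_proj S z \<in> S" "z - orth_proj S z \<in> S\<^sup>\<bottom>"
  using someI_ex[OF orth_proj_exists[OF assms]] unfolding orth_proj_def by blast+

lemma inv_dilation: "r \<noteq> 0 \<Longrightarrow> inv (dilation r) = dilation (1 / r)"
  by (rule inv_unique_comp) (auto simp: dilation_def fun_eq_iff)

lemma dilation_dilation [simp]: "dilation r (dilation s e) = dilation (r * s) e"
  by (simp add: dilation_def split: prod.split)

lemma dilation_1 [simp]: "dilation 1 e = e"
  by (simp add: dilation_def split: prod.split)

lemma smooth_map_cong:
  assumes "smooth_map A B S f" "\<And>p. p \<in> S \<Longrightarrow> f p = g p" "\<And>c. c \<in> A \<Longrightarrow> is_chart c"
  shows "smooth_map A B S g"
  unfolding smooth_map_def
proof (intro conjI ballI)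
  show "S \<subseteq> carrier A" "g ` S \<subseteq> carrier B"
    using assms(1,2) by (auto simp: smooth_map_def)
  fix c d assume cd: "c \<in> A" "d \<in> B"
  have eq: "rep_dom c d S g = rep_dom c d S f" using assms(2) by auto
  show "open (rep_dom c d S g)" unfolding eq using smooth_mapD(1)[OF assms(1) cd] .
  show "smooth_on (rep_dom c d S g) (rep c d g)"
    unfolding eq
  proof (rule smooth_on_cong[OF smooth_mapD(1)[OF assms(1) cd] _ smooth_mapD(2)[OF assms(1) cd]])
    show "rep c d f z = rep c d g z" if "z \<in> rep_dom c d S f" for z
      using that assms(2) assms(3)[OF cd(1)] by auto
  qed
qed

lemma openin_atlas_topology:
  assumes "S \<subseteq> carrier A" "\<And>c. c \<in> A \<Longrightarrow> open (snd c ` (S \<inter> fst c))" "\<And>c. c \<in> A \<Longrightarrow> is_chart c"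
  shows "openin (atlas_topology A) S"
proof -
  have "openin (atlas_topology A) (S \<inter> fst c)" if c: "c \<in> A" for c
  proof -
    have "{p \<in> fst c. snd c p \<in> snd c ` (S \<inter> fst c)} = S \<inter> fst c"
      using assms(3)[OF c] inj_on_image_mem_iff[of "snd c" "fst c" _ "S \<inter> fst c"] by (auto simp: is_chart_def)
    moreover have "openin (atlas_topology A) {p \<in> fst c. snd c p \<in> snd c ` (S \<inter> fst c)}"
      unfolding atlas_topology_def using c assms(2)[OF c] by (intro topology_generated_by_Basis) blast
    ultimately show ?thesis by simp
  qed
  then have "openin (atlas_topology A) (\<Union>c\<in>A. S \<inter> fst c)" by (intro openin_Union) blast
  moreover have "(\<Union>c\<in>A. S \<inter> fst c) = S" using assms(1) by (auto simp: carrier_def)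
  ultimately show ?thesis by (simp only:)
qed

text \<open>\<open>d\<close> is the dimension of \<open>M\<close>. Only the original data are fixed;
  the field on \<open>W\<close>, its rescalings and their limit are defined inside.\<close>

locale bott_minimum =
  fixes N :: "'p set" and A :: "('p, 'e::euclidean_space) chart set"
    and \<Omega> :: "'p \<Rightarrow> 'e \<Rightarrow> 'e \<Rightarrow> real" and H :: "'p \<Rightarrow> real" and XH :: "'p \<Rightarrow> 'e"
    and d :: nat and M :: "'p set"
    and E W :: "('p \<times> 'e) set" and B :: "('p \<times> 'e, 'e) chart set" and \<Psi> :: "'p \<times> 'e \<Rightarrow> 'p"
    and \<Omega>F :: "'p \<Rightarrow> 'e \<Rightarrow> 'e \<Rightarrow> real"
  assumes manifold: "smooth_manifold N A" and symplectic: "symplectic_form A \<Omega>"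
    and smooth_H: "smooth_function A H"
    and min: "\<forall>p\<in>N. 0 \<le> H p" "M = {p \<in> N. H p = 0}"
    and sub: "symplectic_submanifold A \<Omega> M d" and bott: "bott_nondegenerate A H M"
    and XH: "\<forall>p\<in>N. \<forall>w. \<Omega> p (XH p) w = differential A H p w"
    and E: "E = symplectic_normal_bundle A \<Omega> M" and B: "B = bundle_atlas A M d E"
    and weinstein: "weinstein_neighbourhood A \<Omega> M B E W \<Psi> \<Omega>F"
begin

lemma carrier_A: "carrier A = N"
  using manifold by (simp add: smooth_manifold_def)

lemma atlas_A: "smooth_atlas A"
  using manifold by (simp add: smooth_manifold_def smooth_atlas_def)

lemma M_sub: "M \<subseteq> N"
  using min by blast

lemma \<Omega>_point:
  assumes "p \<in> N"
  shows "bilinear (\<Omega> p)" "\<Omega> p u u = 0" "\<Omega> p u v = - \<Omega> p v u" "(\<And>w. \<Omega> p u w = 0) \<Longrightarrow> u = 0"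
proof -
  have "linear_symplectic UNIV (\<Omega> p)"
    using symplectic assms by (simp add: symplectic_form_def carrier_A)
  then have bil: "\<Omega> p (a *\<^sub>R u + b *\<^sub>R v) w = a * \<Omega> p u w + b * \<Omega> p v w"
      and bil': "\<Omega> p w (a *\<^sub>R u + b *\<^sub>R v) = a * \<Omega> p w u + b * \<Omega> p w v"
      and alt: "\<Omega> p u u = 0" and nd: "(\<forall>w. \<Omega> p u w = 0) \<Longrightarrow> u = 0" for a b u v w
    by (auto simp: linear_symplectic_def)
  show b: "bilinear (\<Omega> p)"
    using bil[of 1 _ 1] bil[of _ _ 0] bil'[of _ 1 _ 1] bil'[of _ _ _ 0]
    by (simp add: bilinear_def linear_iff)
  show "\<Omega> p u u = 0" by (rule alt)
  have "\<Omega> p (u + v) (u + v) = 0" by (rule alt)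
  from this[unfolded bilinear_ladd[OF b], unfolded bilinear_radd[OF b]]
  show "\<Omega> p u v = - \<Omega> p v u" by (simp add: alt eq_neg_iff_add_eq_0)
  show "(\<And>w. \<Omega> p u w = 0) \<Longrightarrow> u = 0" using nd by blast
qed

lemma fibre_eq: "fibre E x = (if x \<in> M then {v. \<forall>w\<in>tangent_space A M x. \<Omega> x v w = 0} else {})"
  by (auto simp: E symplectic_normal_bundle_def)

lemma E_base: "(x, v) \<in> E \<Longrightarrow> x \<in> M"
  by (auto simp: E symplectic_normal_bundle_def)

lemma subspace_fibre:
  assumes "x \<in> M" shows "subspace (fibre E x)"
proof -
  have b: "bilinear (\<Omega> x)" using \<Omega>_point M_sub assms by blast
  show ?thesis
    unfolding fibre_eq using assms
    by (auto simp: subspace_def bilinear_lzero[OF b] bilinear_ladd[OF b] bilinear_lmul[OF b])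
qed

lemma zero_in_E: "x \<in> M \<Longrightarrow> (x, 0) \<in> E"
  using subspace_0[OF subspace_fibre] by simp

lemma dilation_in_E: "e \<in> E \<Longrightarrow> dilation r e \<in> E"
  using subspace_scale[OF subspace_fibre] E_base by (cases e) (auto simp: dilation_def)

text \<open>Names the slice chart, the slice and the fibre coordinates that
  \<open>bundle_atlas\<close> hides under an existential quantifier; a chart by itself does not
  display its splitting into base and fibre directions.\<close>

definition bundle_chart :: "('p \<times> 'e, 'e) chart \<Rightarrow> ('p, 'e) chart \<Rightarrow> 'e set \<Rightarrow> ('p \<Rightarrow> 'e \<Rightarrow> 'e) \<Rightarrow> bool" where
  "bundle_chart b c S \<tau> \<longleftrightarrow> b \<in> B \<and> slice_chart A M d c S \<and> fst b = {(x, v). (x, v) \<in> E \<and> x \<in> fst c} \<and>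
     (\<forall>x\<in>fst c \<inter> M. linear (\<tau> x) \<and> bij_betw (\<tau> x) (fibre E x) (S\<^sup>\<bottom>)) \<and>
     (\<forall>(x, v)\<in>fst b. snd b (x, v) = snd c x + \<tau> x v)"

lemma bundle_chart_exists:
  assumes "b \<in> B" obtains c S \<tau> where "bundle_chart b c S \<tau>"
proof -
  have "(fst b, snd b) \<in> bundle_atlas A M d E" using assms B by simp
  then obtain c S \<tau> where "slice_chart A M d c S" "fst b = {(x, v). (x, v) \<in> E \<and> x \<in> fst c}"
     "\<forall>x\<in>fst c \<inter> M. linear (\<tau> x) \<and> bij_betw (\<tau> x) (fibre E x) (S\<^sup>\<bottom>)"
     "\<forall>(x, v)\<in>fst b. snd b (x, v) = snd c x + \<tau> x v"
    unfolding bundle_atlas_def mem_Collect_eq prod.case by blast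
  then show ?thesis using assms that unfolding bundle_chart_def by blast
qed

section \<open>A single bundle chart: projection to the base, and dilation as a linear map\<close>

context
  fixes b c S \<tau>
  assumes b: "bundle_chart b c S \<tau>"
begin

lemma bc_B: "b \<in> B" using b by (simp add: bundle_chart_def)

lemma bc_subspace: "subspace S"
  using b by (simp add: bundle_chart_def slice_chart_def)

lemma bc_chart: "is_chart c"
  using b by (simp add: bundle_chart_def slice_chart_def max_atlas_def)

lemma bc_slice: "snd c ` (fst c \<inter> M) = snd c ` fst c \<inter> S"
  using b by (simp add: bundle_chart_def slice_chart_def)

lemma bc_fst: "e \<in> fst b \<longleftrightarrow> e \<in> E \<and> fst e \<in> fst c"
  using b by (cases e) (simp add: bundle_chart_def)

lemma bc_snd: "(x, v) \<in> fst b \<Longrightarrow> snd b (x, v) = snd c x + \<tau> x v"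
  using b unfolding bundle_chart_def by blast

lemma bc_linear: "(x, v) \<in> fst b \<Longrightarrow> linear (\<tau> x)"
  and bc_bij: "(x, v) \<in> fst b \<Longrightarrow> bij_betw (\<tau> x) (fibre E x) (S\<^sup>\<bottom>)"
  using b E_base unfolding bundle_chart_def by blast+

lemma bc_base: "(x, v) \<in> fst b \<Longrightarrow> snd c x \<in> S"
  using bc_slice bc_fst E_base by auto

lemma bc_perp: "(x, v) \<in> fst b \<Longrightarrow> \<tau> x v \<in> S\<^sup>\<bottom>"
  using bij_betwE[OF bc_bij] bc_fst by auto

lemmas bc_P = orth_proj[OF bc_subspace]

text \<open>The base point lands in \<open>S\<close> and the fibre coordinate in its orthogonal
  complement, so the orthogonal projection recovers both.\<close>

lemma bc_proj:
  assumes "(x, v) \<in> fst b"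
  shows "orth_proj S (snd b (x, v)) = snd c x" "snd b (x, v) - orth_proj S (snd b (x, v)) = \<tau> x v"
  using bc_P(2)[OF bc_base[OF assms]] bc_P(3)[OF bc_perp[OF assms]] bounded_linear.linear[OF bc_P(1)]
  by (simp_all add: bc_snd[OF assms] linear_add)

lemma bc_inj: "inj_on (snd b) (fst b)"
proof (rule inj_onI)
  fix e e' assume e: "e \<in> fst b" "e' \<in> fst b" "snd b e = snd b e'"
  obtain x v y w where xv: "e = (x, v)" "e' = (y, w)" by fastforce
  have "snd c x = snd c y" "\<tau> x v = \<tau> y w"
    using bc_proj e unfolding xv by metis+
  moreover have "x = y"
    using calculation e bc_fst bc_chart unfolding xv by (metis chart_inv_left fst_conv)
  ultimately show "e = e'"
    using bij_betw_imp_inj_on[OF bc_bij] e bc_fst unfolding xv by (auto dest: inj_onD)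
qed

text \<open>A bundle chart contains the whole fibre over each of its base points, so its image is a
  cylinder over part of the slice; openness then follows from continuity of the projection.\<close>

lemma bc_image: "snd b ` fst b = {z. orth_proj S z \<in> snd c ` fst c}"
proof
  show "snd b ` fst b \<subseteq> {z. orth_proj S z \<in> snd c ` fst c}"
    using bc_proj bc_fst by auto
  show "{z. orth_proj S z \<in> snd c ` fst c} \<subseteq> snd b ` fst b"
  proof
    fix z assume "z \<in> {z. orth_proj S z \<in> snd c ` fst c}"
    then have "orth_proj S z \<in> snd c ` (fst c \<inter> M)" using bc_slice bc_P(4) by blast
    then obtain x where x: "x \<in> fst c" "x \<in> M" "orth_proj S z = snd c x" by auto
    then have x0: "(x, 0) \<in> fst b" using bc_fst zero_in_E by simp
    then obtain v where v: "v \<in> fibre E x" "z - orth_proj S z = \<tau> x v"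
      using bc_bij[OF x0] bc_P(5)[of z] by (auto simp: bij_betw_def)
    then have "(x, v) \<in> fst b" using bc_fst x by simp
    moreover from bc_snd[OF this] have "z = snd b (x, v)" using v(2) x(3) by (simp add: algebra_simps)
    ultimately show "z \<in> snd b ` fst b" by blast
  qed
qed

lemma bc_is_chart: "is_chart b"
proof -
  have "open (snd c ` fst c)" using bc_chart by (simp add: is_chart_def)
  from open_vimage[OF this linear_continuous_on[OF bc_P(1)]] have "open (snd b ` fst b)"
    by (simp add: bc_image vimage_def)
  then show ?thesis using bc_inj by (simp add: is_chart_def)
qed

lemma bc_dilation:
  assumes "e \<in> fst b"
  shows "dilation r e \<in> fst b" "snd b (dilation r e) = dil (orth_proj S) r (snd b e)"
proof -
  obtain x v where e: "e = (x, v)" by fastforce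
  show *: "dilation r e \<in> fst b"
    using assms dilation_in_E bc_fst by (auto simp: dilation_def split: prod.split)
  then have "snd b (dilation r e) = snd c x + r *\<^sub>R \<tau> x v"
    using bc_snd[of x "r *\<^sub>R v"] linear_scale[OF bc_linear] assms by (simp add: e dilation_def)
  also have "\<dots> = dil (orth_proj S) r (snd b e)"
    using bc_proj assms unfolding dil_def[OF bc_P(1)] e by simp
  finally show "snd b (dilation r e) = dil (orth_proj S) r (snd b e)" .
qed

lemma bc_dilation_iff: "r \<noteq> 0 \<Longrightarrow> dilation r e \<in> fst b \<longleftrightarrow> e \<in> fst b"
  using bc_dilation(1)[of "dilation r e" "1 / r"] bc_dilation(1)[of e r] by auto

lemma bc_dil_vimage:
  assumes "r \<noteq> 0"
  shows "snd b ` ({e. dilation r e \<in> T} \<inter> fst b) = {z. dil (orth_proj S) r z \<in> snd b ` (T \<inter> fst b)}"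
proof
  show "snd b ` ({e. dilation r e \<in> T} \<inter> fst b) \<subseteq> {z. dil (orth_proj S) r z \<in> snd b ` (T \<inter> fst b)}"
    using bc_dilation by (auto simp flip: bc_dilation(2))
  show "{z. dil (orth_proj S) r z \<in> snd b ` (T \<inter> fst b)} \<subseteq> snd b ` ({e. dilation r e \<in> T} \<inter> fst b)"
  proof
    fix z assume "z \<in> {z. dil (orth_proj S) r z \<in> snd b ` (T \<inter> fst b)}"
    then obtain e where e: "e \<in> T" "e \<in> fst b" "dil (orth_proj S) r z = snd b e" by auto
    have "dil (orth_proj S) (1 / r) (dil (orth_proj S) r z) = z"
      using assms bc_P(2)[OF bc_P(4)] bounded_linear.linear[OF bc_P(1)]
      by (simp add: dil_def[OF bc_P(1)] linear_add linear_scale linear_diff)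
    then have "z = snd b (dilation (1 / r) e)" using e bc_dilation(2)[of e "1 / r"] by simp
    then show "z \<in> snd b ` ({e. dilation r e \<in> T} \<inter> fst b)"
      using assms e bc_dilation(1)[of e "1 / r"] by (intro image_eqI[of _ _ "dilation (1 / r) e"]) auto
  qed
qed

end

section \<open>The total space as a manifold with smooth dilations\<close>

lemma B_is_chart: "b \<in> B \<Longrightarrow> is_chart b"
  using bundle_chart_exists bc_is_chart by metis

lemma diffeo: "smooth_map B A W \<Psi>" "smooth_map A B (\<Psi> ` W) (inv_into W \<Psi>)" "inj_on \<Psi> W"
  using weinstein by (auto simp: weinstein_neighbourhood_def diffeomorphism_def bij_betw_def)

lemma zero_section: "x \<in> M \<Longrightarrow> (x, 0) \<in> W" "x \<in> M \<Longrightarrow> \<Psi> (x, 0) = x"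
  using weinstein by (auto simp: weinstein_neighbourhood_def)

text \<open>The zero section lies in \<open>W\<close>, hence in chart domains, and a chart around a
  zero vector contains the whole fibre.\<close>

lemma carrier_B: "carrier B = E"
proof
  show "carrier B \<subseteq> E"
    unfolding carrier_def using bundle_chart_exists bc_fst by (metis UN_least subsetI)
  show "E \<subseteq> carrier B"
  proof
    fix e assume e: "e \<in> E"
    then have "(fst e, 0) \<in> carrier B"
      using zero_section(1) diffeo(1) E_base[of "fst e" "snd e"] by (auto simp: smooth_map_def)
    then obtain b where b: "b \<in> B" "(fst e, 0) \<in> fst b" by (auto simp: carrier_def)
    then have "e \<in> fst b" using bundle_chart_exists[OF b(1)] bc_fst e by (metis fst_conv)
    then show "e \<in> carrier B" using b(1) by (auto simp: carrier_def)
  qed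
qed

lemma W_sub: "W \<subseteq> E"
  using diffeo(1) carrier_B by (auto simp: smooth_map_def)

lemma open_W: "b \<in> B \<Longrightarrow> open (snd b ` (W \<inter> fst b))"
  by (rule smooth_map_open[OF diffeo(1)])

text \<open>In a bundle chart the orthogonal projection onto the slice is the bundle projection onto
  the zero section. It therefore sends every compact set of the chart into the region where the
  field on \<open>W\<close> lives.\<close>

lemma bc_proj_W:
  assumes b: "bundle_chart b c S \<tau>" and "e \<in> fst b"
  shows "orth_proj S (snd b e) = snd b (fst e, 0)" "snd b (fst e, 0) \<in> snd b ` (W \<inter> fst b)"
proof -
  obtain x v where e: "e = (x, v)" by fastforce
  have x: "x \<in> M" using assms bc_fst[OF b] E_base e by blast
  have x0: "(x, 0) \<in> fst b" using bc_dilation(1)[OF b, of e 0] assms(2) by (simp add: e dilation_def)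
  show "orth_proj S (snd b e) = snd b (fst e, 0)"
    using bc_proj(1)[OF b] assms(2) bc_snd[OF b x0] linear_0[OF bc_linear[OF b x0]] by (simp add: e)
  show "snd b (fst e, 0) \<in> snd b ` (W \<inter> fst b)"
    using zero_section(1)[OF x] x0 by (simp add: e)
qed

lemma dilation_into_W:
  assumes "e \<in> E" obtains r where "r > 0" "dilation r e \<in> W"
proof -
  obtain b where b: "b \<in> B" "e \<in> fst b" using assms carrier_B by (auto simp: carrier_def)
  obtain c S \<tau> where bc: "bundle_chart b c S \<tau>" using bundle_chart_exists[OF b(1)] .
  have "orth_proj S ` {snd b e} \<subseteq> snd b ` (W \<inter> fst b)" using bc_proj_W[OF bc b(2)] by simp
  from eventually_dil[OF bc_P(1)[OF bc] _ open_W[OF b(1)] this]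
  have "\<forall>\<^sub>F r in at_right 0. 0 < r \<and> dil (orth_proj S) r (snd b e) \<in> snd b ` (W \<inter> fst b)" by simp
  then obtain r where r: "r > 0" "dil (orth_proj S) r (snd b e) \<in> snd b ` (W \<inter> fst b)"
    using eventually_happens'[OF trivial_limit_at_right_real] by blast
  then have "snd b e \<in> snd b ` ({e. dilation r e \<in> W} \<inter> fst b)"
    using bc_dil_vimage[OF bc, of r W] by simp
  then have "dilation r e \<in> W" using bc_inj[OF bc] b(2) by (auto dest: inj_onD)
  then show ?thesis using that r(1) by blast
qed

text \<open>Smoothness of the transition maps near the zero section comes from \<open>\<Psi>\<close> and its inverse;
  since transition maps commute with dilations, it extends to the whole bundle.\<close>

lemma smooth_map_id_W: "smooth_map B B W id"
proof -
  have "smooth_map B B {p \<in> W. \<Psi> p \<in> \<Psi> ` W} (inv_into W \<Psi> \<circ> \<Psi>)"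
    by (rule smooth_map_comp[OF diffeo(1,2) B_is_chart smooth_atlas_is_chart[OF atlas_A]])
  moreover have "{p \<in> W. \<Psi> p \<in> \<Psi> ` W} = W" by auto
  ultimately have "smooth_map B B W (inv_into W \<Psi> \<circ> \<Psi>)" by simp
  then show ?thesis
    by (rule smooth_map_cong) (use diffeo(3) B_is_chart in auto)
qed

lemma smooth_map_id_E: "smooth_map B B E id"
  unfolding smooth_map_def
proof (intro conjI ballI)
  show "E \<subseteq> carrier B" "id ` E \<subseteq> carrier B" by (simp_all add: carrier_B)
  fix b b' assume B: "b \<in> B" "b' \<in> B"
  obtain c S \<tau> where bc: "bundle_chart b c S \<tau>" using bundle_chart_exists[OF B(1)] .
  obtain c' S' \<tau>' where bc': "bundle_chart b' c' S' \<tau>'" using bundle_chart_exists[OF B(2)] .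
  let ?P = "orth_proj S" and ?P' = "orth_proj S'"
  let ?O = "rep_dom b b' E id" and ?U = "rep_dom b b' W id"
  \<comment> \<open>The chart points which dilation by r moves into the region where smoothness is
    known. Every point of the overlap is reached by some positive r.\<close>
  define O' where "O' r = {z. dil ?P r z \<in> ?U}" for r
  have rescaled_dom: "rep_dom b b' T id = snd b ` ((T \<inter> fst b') \<inter> fst b)" for T
    by (rule arg_cong[where f = "(`) (snd b)"]) auto
  have U: "open ?U" "smooth_on ?U (rep b b' id)"
    using smooth_mapD[OF smooth_map_id_W B] by blast+
  have O'_open: "open (O' r)" for r
    unfolding O'_def by (rule open_dil_vimage[OF bc_P(1)[OF bc] U(1)])
  have O'_eq: "O' r = snd b ` ({e. dilation r e \<in> W \<inter> fst b'} \<inter> fst b)" if "r > 0" for r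
    unfolding O'_def rescaled_dom using bc_dil_vimage[OF bc, of r "W \<inter> fst b'"] that by simp
  have sub: "O' r \<subseteq> ?O" if "r > 0" for r
    unfolding O'_eq[OF that] rescaled_dom using that bc_dilation_iff[OF bc'] bc_fst[OF bc] by auto
  have cover: "\<exists>r>0. z \<in> O' r" if z: "z \<in> ?O" for z
  proof -
    obtain e where e: "e \<in> fst b" "e \<in> fst b'" "z = snd b e" "e \<in> E" using z by auto
    obtain r where "r > 0" "dilation r e \<in> W" using dilation_into_W[OF e(4)] .
    then show ?thesis
      using e bc_dilation(1)[OF bc'] O'_eq by (intro exI[of _ r]) auto
  qed
  have "?O = (\<Union>r\<in>{0<..}. O' r)"
  proof (rule equalityI)
    show "?O \<subseteq> (\<Union>r\<in>{0<..}. O' r)"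
    proof
      fix z assume "z \<in> ?O"
      from cover[OF this] show "z \<in> (\<Union>r\<in>{0<..}. O' r)" by blast
    qed
    show "(\<Union>r\<in>{0<..}. O' r) \<subseteq> ?O"
      by (rule UN_least) (rule sub, simp)
  qed
  moreover have "open (\<Union>r\<in>{0<..}. O' r)" using O'_open by blast
  ultimately show "open ?O" by (simp only:)
  show "smooth_on ?O (rep b b' id)"
  proof (rule smooth_on_local)
    fix z assume "z \<in> ?O"
    then obtain r where r: "r > 0" "z \<in> O' r" using cover by blast
    \<comment> \<open>Since both charts turn dilation into a linear map, the transition map equals
      its own conjugate by dilation, and the conjugate is evaluated only inside
      \<open>?U\<close>.\<close>
    have "smooth_on (O' r) (\<lambda>z. dil ?P' (1 / r) (rep b b' id (dil ?P r z)))"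
      unfolding O'_def
      by (intro smooth_on_linear_compose[OF open_dil_vimage bounded_linear_dil] smooth_on_dil_compose bc_P(1)[OF bc] bc_P(1)[OF bc'] U)
    then have "smooth_on (O' r) (rep b b' id)"
    proof (rule smooth_on_cong[OF O'_open, rotated])
      fix y assume "y \<in> O' r"
      then obtain e where e: "dilation r e \<in> fst b'" "e \<in> fst b" "y = snd b e"
        using O'_eq[OF r(1)] by auto
      have "e \<in> fst b'" using e(1) bc_dilation_iff[OF bc', of r e] r(1) by simp
      have "rep b b' id (dil ?P r y) = snd b' (dilation r e)"
        using bc_dilation[OF bc e(2), of r] B_is_chart[OF B(1)] e by (simp flip: bc_dilation(2)[OF bc])
      also have "dil ?P' (1 / r) \<dots> = snd b' e"
        using bc_dilation(2)[OF bc' e(1), of "1 / r"] r(1) by simp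
      finally show "dil ?P' (1 / r) (rep b b' id (dil ?P r y)) = rep b b' id y"
        using B_is_chart[OF B(1)] e by simp
    qed
    then show "\<exists>V. open V \<and> z \<in> V \<and> smooth_on V (rep b b' id)"
      using O'_open r(2) by blast
  qed
qed

lemma atlas_B: "smooth_atlas B"
  by (rule smooth_atlasI) (simp_all add: B_is_chart carrier_B smooth_map_id_E)

text \<open>A representative of the dilation is a transition map preceded by a linear map; whole
  fibres in every chart make its domain the same as that of the transition map.\<close>

lemma smooth_map_dilation:
  assumes "r > 0" shows "smooth_map B B E (dilation r)"
  unfolding smooth_map_def
proof (intro conjI ballI)
  show "E \<subseteq> carrier B" "dilation r ` E \<subseteq> carrier B" using dilation_in_E by (auto simp: carrier_B)
  fix b b' assume B: "b \<in> B" "b' \<in> B"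
  obtain c S \<tau> where bc: "bundle_chart b c S \<tau>" using bundle_chart_exists[OF B(1)] .
  obtain c' S' \<tau>' where bc': "bundle_chart b' c' S' \<tau>'" using bundle_chart_exists[OF B(2)] .
  let ?O = "rep_dom b b' E id"
  have O: "open ?O" "smooth_on ?O (rep b b' id)" using smooth_mapD[OF smooth_map_id_E B] .
  have eq: "rep_dom b b' E (dilation r) = ?O" using bc_dilation_iff[OF bc'] assms by auto
  show "open (rep_dom b b' E (dilation r))" unfolding eq by (rule O)
  have maps: "dil (orth_proj S) r ` ?O \<subseteq> ?O"
  proof
    fix y assume "y \<in> dil (orth_proj S) r ` ?O"
    then obtain e where e: "e \<in> fst b" "e \<in> fst b'" "e \<in> E" "y = dil (orth_proj S) r (snd b e)" by auto
    then have "y = snd b (dilation r e)" using bc_dilation(2)[OF bc] by simp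
    then show "y \<in> ?O" using bc_dilation(1)[OF bc] bc_dilation(1)[OF bc'] e dilation_in_E by auto
  qed
  have "smooth_on ?O (\<lambda>z. rep b b' id (dil (orth_proj S) r z))"
    by (rule smooth_on_compose[OF O(1,1) smooth_on_bounded_linear[OF bounded_linear_dil[OF bc_P(1)[OF bc]]] O(2) maps])
  then show "smooth_on (rep_dom b b' E (dilation r)) (rep b b' (dilation r))"
    unfolding eq
  proof (rule smooth_on_cong[OF O(1), rotated])
    fix y assume "y \<in> ?O"
    then obtain e where e: "e \<in> fst b" "y = snd b e" by auto
    then show "rep b b' id (dil (orth_proj S) r y) = rep b b' (dilation r) y"
      using B_is_chart[OF B(1)] bc_dilation(1)[OF bc] by (simp flip: bc_dilation(2)[OF bc])
  qed
qed

definition rescaled_dom :: "real \<Rightarrow> ('p \<times> 'e) set" where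
  "rescaled_dom r = {e \<in> E. dilation r e \<in> W}"

lemma rescaled_dom_eq: "r > 0 \<Longrightarrow> rescaled_dom r = dilation (1 / r) ` W"
proof
  assume r: "r > 0"
  show "rescaled_dom r \<subseteq> dilation (1 / r) ` W"
    using r by (auto simp: rescaled_dom_def intro!: image_eqI[of _ _ "dilation r _"])
  show "dilation (1 / r) ` W \<subseteq> rescaled_dom r"
    using r W_sub dilation_in_E by (auto simp: rescaled_dom_def)
qed

lemma open_rescaled_dom:
  assumes "r > 0" "bundle_chart b c S \<tau>"
  shows "snd b ` (rescaled_dom r \<inter> fst b) = {z. dil (orth_proj S) r z \<in> snd b ` (W \<inter> fst b)}" "open (snd b ` (rescaled_dom r \<inter> fst b))"
proof -
  have "rescaled_dom r \<inter> fst b = {e. dilation r e \<in> W} \<inter> fst b"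
    using bc_fst[OF assms(2)] by (auto simp: rescaled_dom_def)
  then show *: "snd b ` (rescaled_dom r \<inter> fst b) = {z. dil (orth_proj S) r z \<in> snd b ` (W \<inter> fst b)}"
    using bc_dil_vimage[OF assms(2), of r W] assms(1) by simp
  show "open (snd b ` (rescaled_dom r \<inter> fst b))"
    unfolding * by (rule open_dil_vimage[OF bc_P(1)[OF assms(2)] open_W[OF bc_B[OF assms(2)]]])
qed

lemma open_rescaled_dom_B: "r > 0 \<Longrightarrow> b \<in> B \<Longrightarrow> open (snd b ` (rescaled_dom r \<inter> fst b))"
  using bundle_chart_exists open_rescaled_dom(2) by metis

lemma smooth_map_dilation_rescaled_dom:
  assumes "r > 0"
  shows "smooth_map B B (rescaled_dom r) (dilation r)" "smooth_map B B W (dilation (1 / r))"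
proof -
  have "rescaled_dom r \<subseteq> E" by (auto simp: rescaled_dom_def)
  from smooth_map_restrict_dom[OF smooth_map_dilation[OF assms] this B_is_chart open_rescaled_dom_B[OF assms]]
  show "smooth_map B B (rescaled_dom r) (dilation r)" .
  have "1 / r > 0" using assms by simp
  from smooth_map_restrict_dom[OF smooth_map_dilation[OF this] W_sub B_is_chart open_W]
  show "smooth_map B B W (dilation (1 / r))" .
qed

lemma openin_E: "openin (atlas_topology B) E"
proof (rule openin_atlas_topology)
  fix b assume "b \<in> B"
  then show "open (snd b ` (E \<inter> fst b))"
    using B_is_chart[of b] chart_subset_carrier[of b B] by (simp add: carrier_B is_chart_def Int_absorb1)
qed (simp_all add: carrier_B B_is_chart)

lemma openin_rescaled_dom: "r > 0 \<Longrightarrow> openin (atlas_topology B) (rescaled_dom r)"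
  by (rule openin_atlas_topology[OF _ open_rescaled_dom_B B_is_chart]) (simp_all add: carrier_B rescaled_dom_def)

section \<open>The rescaled vector fields\<close>

definition XW :: "'p \<times> 'e \<Rightarrow> 'e" where
  "XW = pushforward A B (inv_into W \<Psi>) (\<Psi> ` W) XH"

definition X1 :: "real \<Rightarrow> 'p \<times> 'e \<Rightarrow> 'e" where
  "X1 r = pushforward B B (dilation (1 / r)) W XW"

lemma inv_inv_\<Psi>: "e \<in> W \<Longrightarrow> inv_into (\<Psi> ` W) (inv_into W \<Psi>) e = \<Psi> e"
  using diffeo(3) by (intro inv_into_f_eq) (auto intro!: inj_on_inv_into)

lemma XW_eq: "e \<in> W \<Longrightarrow> XW e = tangent_map A B (inv_into W \<Psi>) (\<Psi> e) (XH (\<Psi> e))"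
  by (simp add: XW_def pushforward_def inv_inv_\<Psi>)

text \<open>This relates the two fields by \<Psi>, via the chain rule for \<Psi> composed with its
  inverse. In this form the Hamiltonian equation can be pulled back.\<close>

lemma tangent_\<Psi>_XW:
  assumes "e \<in> W" shows "tangent_map B A \<Psi> e (XW e) = XH (\<Psi> e)"
proof -
  have "smooth_map A A {p \<in> \<Psi> ` W. inv_into W \<Psi> p \<in> W} (\<Psi> \<circ> inv_into W \<Psi>)"
    by (rule smooth_map_comp[OF diffeo(2,1) smooth_atlas_is_chart[OF atlas_A] B_is_chart])
  from tangent_map_id[OF this _ smooth_atlas_is_chart[OF atlas_A], of "\<Psi> e" "XH (\<Psi> e)"]
  have "tangent_map A A (\<Psi> \<circ> inv_into W \<Psi>) (\<Psi> e) (XH (\<Psi> e)) = XH (\<Psi> e)"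
    using assms diffeo(3) by (auto simp: f_inv_into_f)
  moreover have "tangent_map A A (\<Psi> \<circ> inv_into W \<Psi>) (\<Psi> e) (XH (\<Psi> e)) = tangent_map B A \<Psi> e (XW e)"
    using tangent_map_comp[OF diffeo(2,1) smooth_atlas_is_chart[OF atlas_A] B_is_chart, of "\<Psi> e"] assms diffeo(3)
    by (simp add: XW_eq)
  ultimately show ?thesis by simp
qed

lemma inj_dilation: "r \<noteq> 0 \<Longrightarrow> inj_on (dilation r) T"
  by (rule inj_on_inverseI[of _ "dilation (1 / r)"]) simp

lemma inv_into_dilation:
  assumes "r > 0" "e \<in> rescaled_dom r" shows "inv_into W (dilation (1 / r)) e = dilation r e"
  using assms inj_dilation[of "1 / r" W] by (intro inv_into_f_eq) (auto simp: rescaled_dom_def)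

lemma tangent_dilation_X1:
  assumes "r > 0" "e \<in> rescaled_dom r" shows "tangent_map B B (dilation r) e (X1 r e) = XW (dilation r e)"
proof -
  note m = smooth_map_dilation_rescaled_dom[OF assms(1)]
  have e: "dilation r e \<in> W" "dilation (1 / r) (dilation r e) = e" using assms by (auto simp: rescaled_dom_def)
  have 1: "X1 r e = tangent_map B B (dilation (1 / r)) (dilation r e) (XW (dilation r e))"
    by (simp add: X1_def pushforward_def inv_into_dilation[OF assms])
  have "tangent_map B B (dilation r \<circ> dilation (1 / r)) (dilation r e) (XW (dilation r e)) = tangent_map B B (dilation r) e (X1 r e)"
    using tangent_map_comp[OF m(2,1) B_is_chart B_is_chart e(1)] e(2) assms(2) by (simp add: 1)
  moreover have "tangent_map B B (dilation r \<circ> dilation (1 / r)) (dilation r e) (XW (dilation r e)) = XW (dilation r e)"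
    by (rule tangent_map_id[OF smooth_map_comp[OF m(2,1) B_is_chart B_is_chart] _ B_is_chart])
       (use assms e in \<open>auto simp: rescaled_dom_def\<close>)
  ultimately show ?thesis by simp
qed

lemma differential_scale:
  assumes "smooth_function A h" "p \<in> carrier A"
  shows "differential A (\<lambda>q. h q / k) p v = differential A h p v / k"
proof -
  note c = chart_at_in[OF assms(2)]
  have "(h \<circ> chart_inv (chart_at A p) has_derivative fderiv (h \<circ> chart_inv (chart_at A p)) (pref A p p)) (at (pref A p p))"
    using assms(1) c unfolding smooth_function_def by (intro smooth_on_has_derivative) auto
  from bounded_linear.has_derivative[OF bounded_linear_mult_left[of "1 / k"] this]
  show ?thesis
    unfolding differential_def by (simp add: fderiv_eq o_def)
qed

text \<open>Naturality of the Hamiltonian equation under \<Psi> after dilation; the division by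
  \<open>r\<^sup>2\<close> occurs on both sides.\<close>

lemma rescaled_hamiltonian:
  assumes r: "r > 0" and e: "e \<in> rescaled_dom r"
  shows "pullback_form B B (dilation r) (pullback_form B A \<Psi> \<Omega>) e (X1 r e) u / r\<^sup>2 =
    differential B (\<lambda>e. H (\<Psi> (dilation r e)) / r\<^sup>2) e u"
proof -
  have eW: "dilation r e \<in> W" using e by (simp add: rescaled_dom_def)
  have qN: "\<Psi> (dilation r e) \<in> carrier A" using diffeo(1) eW by (auto simp: smooth_map_def)
  let ?u = "tangent_map B A \<Psi> (dilation r e) (tangent_map B B (dilation r) e u)"
  have "pullback_form B B (dilation r) (pullback_form B A \<Psi> \<Omega>) e (X1 r e) u
    = differential A H (\<Psi> (dilation r e)) ?u"
    using XH qN by (simp add: pullback_form_def tangent_dilation_X1[OF r e] tangent_\<Psi>_XW[OF eW] carrier_A)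
  moreover have "smooth_map B A {p \<in> rescaled_dom r. dilation r p \<in> W} (\<Psi> \<circ> dilation r)"
    by (rule smooth_map_comp[OF smooth_map_dilation_rescaled_dom(1)[OF r] diffeo(1) B_is_chart B_is_chart])
  moreover have h: "smooth_function A (\<lambda>q. H q / r\<^sup>2)"
    unfolding smooth_function_def
  proof
    fix c assume c: "c \<in> A"
    have "open (snd c ` fst c)" "smooth_on (snd c ` fst c) (H \<circ> chart_inv c)"
      using smooth_H smooth_atlas_is_chart[OF atlas_A c] c by (simp_all add: smooth_function_def is_chart_def)
    from smooth_on_linear_compose[OF this(1) bounded_linear_scaleR_right this(2)]
    have "smooth_on (snd c ` fst c) (\<lambda>z. (1 / r\<^sup>2) *\<^sub>R (H \<circ> chart_inv c) z)" .
    then show "smooth_on (snd c ` fst c) ((\<lambda>q. H q / r\<^sup>2) \<circ> chart_inv c)" by (simp add: o_def)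
  qed
  ultimately have "differential B (\<lambda>q. H ((\<Psi> \<circ> dilation r) q) / r\<^sup>2) e u
      = differential A (\<lambda>q. H q / r\<^sup>2) (\<Psi> (dilation r e)) (tangent_map B A (\<Psi> \<circ> dilation r) e u)"
    using differential_comp[OF atlas_B atlas_A _ h, of _ "\<Psi> \<circ> dilation r" e u] e eW by simp
  also have "\<dots> = differential A H (\<Psi> (dilation r e)) ?u / r\<^sup>2"
    using tangent_map_comp[OF smooth_map_dilation_rescaled_dom(1)[OF r] diffeo(1) B_is_chart B_is_chart e eW, of u]
      differential_scale[OF smooth_H qN] by simp
  finally show ?thesis
    using XH qN by (simp add: pullback_form_def tangent_dilation_X1[OF r e] tangent_\<Psi>_XW[OF eW] carrier_A)
qed

lemma smooth_XH: "c \<in> A \<Longrightarrow> smooth_on (snd c ` fst c) (field_in_chart A c XH)"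
  using hamiltonian_smooth[OF atlas_A smooth_H symplectic] XH by (simp add: carrier_A)

lemma smooth_XW: "b \<in> B \<Longrightarrow> smooth_on (snd b ` (W \<inter> fst b)) (field_in_chart B b XW)"
  unfolding XW_def
  by (rule smooth_pushforward[OF atlas_A atlas_B diffeo(2,1)])
     (use diffeo(3) in \<open>auto simp: f_inv_into_f intro: smooth_on_subset[OF smooth_XH]\<close>)

lemma smooth_X1:
  assumes "r > 0" "b \<in> B" shows "smooth_on (snd b ` (rescaled_dom r \<inter> fst b)) (field_in_chart B b (X1 r))"
  unfolding X1_def
  by (rule smooth_pushforward[OF atlas_B atlas_B smooth_map_dilation_rescaled_dom(2,1)[OF assms(1)] rescaled_dom_eq[OF assms(1)] _ smooth_XW assms(2)])
     (use assms(1) in auto)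

text \<open>The inverse dilation is linear in the chart, so it is its own derivative, and the
  pushforward becomes conjugation by a linear map.\<close>

lemma X1_in_chart:
  assumes r: "r > 0" and b: "bundle_chart b c S \<tau>" and z: "z \<in> snd b ` (rescaled_dom r \<inter> fst b)"
  shows "field_in_chart B b (X1 r) z = dil (orth_proj S) (1 / r) (field_in_chart B b XW (dil (orth_proj S) r z))"
proof -
  obtain e where e: "e \<in> rescaled_dom r" "e \<in> fst b" "z = snd b e" using z by auto
  let ?q = "dilation r e"
  have q: "?q \<in> W" "?q \<in> fst b" "dilation (1 / r) ?q = e" using e r bc_dilation(1)[OF b] by (auto simp: rescaled_dom_def)
  note bB = bc_B[OF b]
  have "field_in_chart B b (X1 r) z = fderiv (rep b b (dilation (1 / r))) (snd b ?q) (field_in_chart B b XW (snd b ?q))"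
    using field_in_chart_pushforward[where X = XW, OF atlas_B atlas_B smooth_map_dilation_rescaled_dom(2)[OF r] inj_dilation bB q(2) bB] q e r
    by (simp add: X1_def)
  moreover have "fderiv (rep b b (dilation (1 / r))) (snd b ?q) = dil (orth_proj S) (1 / r)"
  proof (rule fderiv_eq)
    have "open (snd b ` fst b)" using B_is_chart[OF bB] by (simp add: is_chart_def)
    then show "(rep b b (dilation (1 / r)) has_derivative dil (orth_proj S) (1 / r)) (at (snd b ?q))"
      by (rule has_derivative_transform_within_open[OF bounded_linear_imp_has_derivative[OF bounded_linear_dil[OF bc_P(1)[OF b]]]])
         (use q B_is_chart[OF bB] bc_dilation(2)[OF b] in auto)
  qed
  ultimately show ?thesis using bc_dilation(2)[OF b e(2)] e(3) by simp
qed

section \<open>Vanishing along the minimum and convergence of the rescaled fields\<close>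

lemma critical:
  assumes "x \<in> M" "c \<in> A" "x \<in> fst c" shows "fderiv (H \<circ> chart_inv c) (snd c x) = (\<lambda>w. 0)"
proof -
  have ch: "is_chart c" using smooth_atlas_is_chart[OF atlas_A assms(2)] .
  have "(H \<circ> chart_inv c has_derivative fderiv (H \<circ> chart_inv c) (snd c x)) (at (snd c x))"
    using smooth_H assms unfolding smooth_function_def by (intro smooth_on_has_derivative) auto
  then show ?thesis
  proof (rule differential_zero_maxmin[of _ "snd c ` fst c", rotated 2])
    show "snd c x \<in> snd c ` fst c" "open (snd c ` fst c)" using assms ch by (auto simp: is_chart_def)
    have "H x = 0" using assms min by blast
    then have "\<forall>y\<in>snd c ` fst c. (H \<circ> chart_inv c) (snd c x) \<le> (H \<circ> chart_inv c) y"
      using ch assms min(1) chart_subset_carrier[OF assms(2)] by (auto simp: carrier_A)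
    then show "(\<forall>y\<in>snd c ` fst c. (H \<circ> chart_inv c) y \<le> (H \<circ> chart_inv c) (snd c x)) \<or>
        (\<forall>y\<in>snd c ` fst c. (H \<circ> chart_inv c) (snd c x) \<le> (H \<circ> chart_inv c) y)" by blast
  qed
qed

lemma XH_zero:
  assumes "x \<in> M" shows "XH x = 0"
proof -
  have x: "x \<in> carrier A" using assms M_sub carrier_A by blast
  have "differential A H x w = 0" for w
    using critical[OF assms chart_at_in[OF x]] by (simp add: differential_def)
  then show ?thesis using \<Omega>_point(4)[of x "XH x"] XH x by (simp add: carrier_A)
qed

text \<open>A chart point fixed by the projection has vanishing fibre coordinate, so it comes from
  the zero section, which \<Psi> identifies with the critical set \<open>M\<close>.\<close>

lemma XW_zero:
  assumes b: "bundle_chart b c S \<tau>" and z: "orth_proj S z \<in> snd b ` (W \<inter> fst b)"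
  shows "field_in_chart B b XW (orth_proj S z) = 0"
proof -
  obtain e where e: "e \<in> W" "e \<in> fst b" "orth_proj S z = snd b e" using z by auto
  have "snd b e = snd b (fst e, 0)"
    using bc_proj_W(1)[OF b e(2)] bc_P(2)[OF b bc_P(4)[OF b]] e(3) by metis
  moreover have e0: "(fst e, 0) \<in> fst b" using bc_dilation(1)[OF b e(2), of 0] by (simp add: dilation_def split: prod.splits)
  ultimately have "e = (fst e, 0)" using bc_inj[OF b] e(2) by (meson inj_onD)
  moreover have x: "fst e \<in> M" using e bc_fst[OF b] E_base by (metis prod.collapse)
  ultimately have "XH (\<Psi> e) = 0" using zero_section(2) XH_zero by metis
  moreover have "linear (tangent_map A B (inv_into W \<Psi>) (\<Psi> e))"
  proof -
    have "\<Psi> e \<in> carrier A" "e \<in> carrier B" using diffeo(1) e(1) by (auto simp: smooth_map_def)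
    note c = chart_at_in[OF this(1)] chart_at_in[OF this(2)]
    have "linear (fderiv (rep (chart_at A (\<Psi> e)) (chart_at B e) (inv_into W \<Psi>)) (pref A (\<Psi> e) (\<Psi> e)))"
      using e(1) diffeo(3) c by (intro fderiv_rep_linear[OF diffeo(2)]) auto
    then show ?thesis using e(1) diffeo(3) by (simp add: tangent_map_def linear_iff)
  qed
  ultimately have "XW e = 0" using XW_eq[OF e(1)] linear_0 by metis
  then show ?thesis
    using e bc_is_chart[OF b] linear_0[OF linear_vec_to_chart[OF atlas_B bc_B[OF b] e(2)]]
    by (simp add: field_in_chart_def)
qed

text \<open>The linearization of the field at the base point, applied to the fibre coordinate and
  stripped of its component along the slice.\<close>

definition limit_in_chart :: "('p \<times> 'e, 'e) chart \<Rightarrow> 'e set \<Rightarrow> 'e \<Rightarrow> 'e" where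
  "limit_in_chart b S z =
    (let u = fderiv (field_in_chart B b XW) (orth_proj S z) (z - orth_proj S z) in u - orth_proj S u)"

lemma proj_image_W:
  assumes b: "bundle_chart b c S \<tau>" and "K \<subseteq> snd b ` fst b"
  shows "orth_proj S ` K \<subseteq> snd b ` (W \<inter> fst b)"
proof
  fix y assume "y \<in> orth_proj S ` K"
  then obtain e where "e \<in> fst b" "y = orth_proj S (snd b e)" using assms(2) by auto
  then show "y \<in> snd b ` (W \<inter> fst b)" using bc_proj_W[OF b] by simp
qed

text \<open>The chart expression of \<open>X1 r\<close> is the conjugated field only on the rescaled
  domain. That domain is open, so derivatives agree there, and it contains \<open>K\<close> for
  small r.\<close>

lemma uniform_limit_X1:
  assumes b: "bundle_chart b c S \<tau>" and K: "compact K" "K \<subseteq> snd b ` fst b"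
  shows "uniform_limit K (\<lambda>r. iter_deriv vs (field_in_chart B b (X1 r))) (iter_deriv vs (limit_in_chart b S)) (at_right 0)"
    "\<forall>\<^sub>F r in at_right 0. 0 < r \<and> K \<subseteq> snd b ` (rescaled_dom r \<inter> fst b)"
proof -
  let ?P = "orth_proj S" and ?F = "field_in_chart B b XW"
  note bB = bc_B[OF b] and P = bc_P(1)[OF b]
  note PK = proj_image_W[OF b K(2)]
  have ev: "\<forall>\<^sub>F r in at_right 0. 0 < r \<and> (\<forall>z\<in>K. dil ?P r z \<in> snd b ` (W \<inter> fst b))"
    by (rule eventually_dil[OF P K(1) open_W[OF bB] PK])
  then show ev': "\<forall>\<^sub>F r in at_right 0. 0 < r \<and> K \<subseteq> snd b ` (rescaled_dom r \<inter> fst b)"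
    by eventually_elim (auto simp: open_rescaled_dom(1)[OF _ b])
  have lim: "uniform_limit K (\<lambda>r. iter_deriv vs (\<lambda>z. dil ?P (1 / r) (?F (dil ?P r z)))) (iter_deriv vs (limit_in_chart b S)) (at_right 0)"
    unfolding limit_in_chart_def Let_def
    by (rule uniform_limit_iter_deriv_dil_conjugate[OF P K(1) PK open_W[OF bB] smooth_XW[OF bB] XW_zero[OF b]])
  show "uniform_limit K (\<lambda>r. iter_deriv vs (field_in_chart B b (X1 r))) (iter_deriv vs (limit_in_chart b S)) (at_right 0)"
  proof (rule uniform_limit_cong[THEN iffD1, OF _ _ lim])
    show "\<forall>\<^sub>F r in at_right 0. \<forall>z\<in>K. iter_deriv vs (\<lambda>z. dil ?P (1 / r) (?F (dil ?P r z))) z = iter_deriv vs (field_in_chart B b (X1 r)) z"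
      using ev'
    proof (eventually_elim, intro ballI)
      fix r z assume r: "0 < r \<and> K \<subseteq> snd b ` (rescaled_dom r \<inter> fst b)" and z: "z \<in> K"
      show "iter_deriv vs (\<lambda>z. dil ?P (1 / r) (?F (dil ?P r z))) z = iter_deriv vs (field_in_chart B b (X1 r)) z"
        by (rule iter_deriv_cong[symmetric, OF open_rescaled_dom_B[OF _ bB] _ X1_in_chart[OF _ b] smooth_X1[OF _ bB]])
           (use r z in auto)
    qed
  qed simp
qed

lemma smooth_limit_in_chart:
  assumes b: "bundle_chart b c S \<tau>" shows "smooth_on (snd b ` fst b) (limit_in_chart b S)"
proof -
  let ?P = "orth_proj S" and ?F = "field_in_chart B b XW"
  note bB = bc_B[OF b] and P = bc_P(1)[OF b]
  have bQ: "bounded_linear (\<lambda>z. z - ?P z)" by (intro bounded_linear_sub bounded_linear_ident P)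
  have O: "open (snd b ` fst b)" using B_is_chart[OF bB] by (simp add: is_chart_def)
  have "smooth_on (snd b ` fst b) (\<lambda>z. fderiv ?F (?P z) (z - ?P z))"
    by (rule smooth_on_fderiv_apply[OF O open_W[OF bB] smooth_XW[OF bB] smooth_on_bounded_linear[OF P]
          proj_image_W[OF b subset_refl] smooth_on_bounded_linear[OF bQ]])
  from smooth_on_linear_compose[OF O bQ this] show ?thesis
    by (simp add: limit_in_chart_def[abs_def] Let_def)
qed

text \<open>The tangent space at a point is a fixed model space, so a pointwise limit makes sense
  without choosing a chart. Uniqueness of limits then yields the right expression in every bundle
  chart.\<close>

definition X0 :: "'p \<times> 'e \<Rightarrow> 'e" where
  "X0 e = Lim (at_right 0) (\<lambda>r. X1 r e)"

lemma X0_in_chart: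
  assumes b: "bundle_chart b c S \<tau>" and e: "e \<in> fst b"
  shows "field_in_chart B b X0 (snd b e) = limit_in_chart b S (snd b e)"
proof -
  have lim: "((\<lambda>r. vec_to_chart B b e (X1 r e)) \<longlongrightarrow> limit_in_chart b S (snd b e)) (at_right 0)"
    if b: "bundle_chart b c S \<tau>" and e: "e \<in> fst b" for b c S \<tau>
    using tendsto_uniform_limitI[OF uniform_limit_X1(1)[OF b, of "{snd b e}" "[]"], of "snd b e"] e bc_is_chart[OF b]
    by (simp add: field_in_chart_def)
  have eB: "e \<in> carrier B" using e bc_fst[OF b] carrier_B by blast
  note b0 = chart_at_in[OF eB]
  obtain c0 S0 \<tau>0 where bc0: "bundle_chart (chart_at B e) c0 S0 \<tau>0" using bundle_chart_exists[OF b0(1)] .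
  \<comment> \<open>In the preferred chart \<open>vec_to_chart\<close> is the identity, so
    convergence of the chart expression is convergence of the vectors themselves.\<close>
  have "((\<lambda>r. X1 r e) \<longlongrightarrow> limit_in_chart (chart_at B e) S0 (pref B e e)) (at_right 0)"
    using lim[OF bc0 b0(2)] by (simp add: vec_to_chart_pref[OF atlas_B eB])
  then have X0: "((\<lambda>r. X1 r e) \<longlongrightarrow> X0 e) (at_right 0)"
    unfolding X0_def using tendsto_Lim[OF trivial_limit_at_right_real] by metis
  have "bounded_linear (vec_to_chart B b e)"
    using linear_vec_to_chart[OF atlas_B bc_B[OF b] e] linear_conv_bounded_linear by blast
  from tendsto_unique[OF _ bounded_linear.tendsto[OF this X0] lim[OF b e]]
  show ?thesis using e bc_is_chart[OF b] by (simp add: field_in_chart_def)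
qed

lemma smooth_field_X0: "smooth_field B E X0"
  unfolding smooth_field_def
proof (intro conjI ballI openin_E)
  fix b assume bB: "b \<in> B"
  obtain c S \<tau> where b: "bundle_chart b c S \<tau>" using bundle_chart_exists[OF bB] .
  have O: "open (snd b ` fst b)" using B_is_chart[OF bB] by (simp add: is_chart_def)
  have "smooth_on (snd b ` fst b) (field_in_chart B b X0)"
    by (rule smooth_on_cong[OF O _ smooth_limit_in_chart[OF b]]) (use X0_in_chart[OF b] in auto)
  moreover have "fst b \<inter> E = fst b" using bc_fst[OF b] by auto
  ultimately show "smooth_on (snd b ` (fst b \<inter> E)) (field_in_chart B b X0)" by simp
qed

lemma smooth_field_X1: "r > 0 \<Longrightarrow> smooth_field B (rescaled_dom r) (X1 r)"
  using smooth_X1 openin_rescaled_dom by (simp add: smooth_field_def Int_commute)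

lemma Ck_converges_X0: "Ck_converges B k rescaled_dom X1 X0"
  unfolding Ck_converges_def
proof (intro ballI allI impI conjI)
  fix b K assume bB: "b \<in> B" and K: "compact K \<and> K \<subseteq> snd b ` fst b"
  obtain c S \<tau> where b: "bundle_chart b c S \<tau>" using bundle_chart_exists[OF bB] .
  show "\<forall>\<^sub>F r in at_right 0. K \<subseteq> snd b ` (fst b \<inter> rescaled_dom r)"
    using uniform_limit_X1(2)[OF b] K by (simp add: Int_commute eventually_conj_iff)
  fix vs :: "'e list"
  have O: "open (snd b ` fst b)" using B_is_chart[OF bB] by (simp add: is_chart_def)
  show "uniform_limit K (\<lambda>r. iter_deriv vs (field_in_chart B b (X1 r))) (iter_deriv vs (field_in_chart B b X0)) (at_right 0)"
  proof (rule uniform_limit_cong'[THEN iffD1, OF _ _ uniform_limit_X1(1)[OF b]])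
    show "iter_deriv vs (limit_in_chart b S) z = iter_deriv vs (field_in_chart B b X0) z" if "z \<in> K" for z
      by (rule iter_deriv_cong[OF O _ _ smooth_limit_in_chart[OF b]]) (use K that X0_in_chart[OF b] in auto)
  qed (use K in auto)
qed

end

section \<open>The limit field on a fibre\<close>

text \<open>One application of l'Hopital's rule, which is where the factor 1/2 arises. The
  acceleration of \<gamma> does not enter, because the derivative of \<open>k\<close> vanishes at
  its starting point.\<close>

lemma tendsto_second_order:
  fixes k :: "'a::euclidean_space \<Rightarrow> real" and \<gamma> :: "real \<Rightarrow> 'a"
  assumes O: "open D" "smooth_on D k" and I: "open I" "0 \<in> I" and \<gamma>: "smooth_on I \<gamma>" "\<gamma> ` I \<subseteq> D"
    and 0: "k (\<gamma> 0) = 0" "\<And>w. fderiv k (\<gamma> 0) w = 0" and v: "v = fderiv \<gamma> 0 1"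
  shows "((\<lambda>r. k (\<gamma> r) / r\<^sup>2) \<longlongrightarrow> fderiv (\<lambda>y. fderiv k y v) (\<gamma> 0) v / 2) (at_right 0)"
proof -
  define g' where "g' r = fderiv k (\<gamma> r) (fderiv \<gamma> r 1)" for r
  let ?h = "fderiv (\<lambda>y. fderiv k y v) (\<gamma> 0) v"
  have \<gamma>0: "\<gamma> 0 \<in> D" using I \<gamma> by blast
  have D1: "((\<lambda>r. k (\<gamma> r)) has_real_derivative g' r) (at r)" if r: "r \<in> I" for r
  proof -
    have \<gamma>r: "\<gamma> r \<in> D" using r \<gamma> by blast
    have "((\<lambda>r. k (\<gamma> r)) has_derivative (\<lambda>s. fderiv k (\<gamma> r) (fderiv \<gamma> r s))) (at r)"
      by (rule has_derivative_compose[OF smooth_on_has_derivative[OF \<gamma>(1) r] smooth_on_has_derivative[OF O(2) \<gamma>r]])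
    moreover have "fderiv k (\<gamma> r) (fderiv \<gamma> r s) = g' r * s" for s
      using linear_scale[OF smooth_on_linear_fderiv[OF \<gamma>(1) r], of s 1]
        linear_scale[OF smooth_on_linear_fderiv[OF O(2) \<gamma>r]] by (simp add: g'_def)
    ultimately show ?thesis by (simp add: has_field_derivative_def)
  qed
  have D2: "(g' has_real_derivative ?h) (at 0)"
  proof -
    \<comment> \<open>The gradient of \<open>k\<close> along the curve. It vanishes at time 0, so
      the product rule at a zero applies with the velocity of \<gamma> as the other factor.\<close>
    define F where "F r = (\<Sum>b\<in>Basis. fderiv k (\<gamma> r) b *\<^sub>R b)" for r
    define F' where "F' s = (\<Sum>b\<in>Basis. fderiv (\<lambda>y. fderiv k y b) (\<gamma> 0) (fderiv \<gamma> 0 s) *\<^sub>R b)" for s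
    have "((\<lambda>r. fderiv k (\<gamma> r) b) has_derivative (\<lambda>s. fderiv (\<lambda>y. fderiv k y b) (\<gamma> 0) (fderiv \<gamma> 0 s))) (at 0)" for b
      by (rule has_derivative_compose[where g = "\<lambda>y. fderiv k y b",
            OF smooth_on_has_derivative[OF \<gamma>(1) I(2)] smooth_on_has_derivative[OF smooth_on_fderiv[OF O(2)] \<gamma>0]])
    then have "(F has_derivative F') (at 0)"
      unfolding F_def F'_def by (intro has_derivative_sum has_derivative_scaleR_left)
    moreover have "F 0 = 0" by (simp add: F_def 0)
    moreover have "isCont (\<lambda>r. b \<bullet> fderiv \<gamma> r 1) 0" for b
      using smooth_on_continuous[OF smooth_on_fderiv[OF \<gamma>(1)]] I continuous_on_eq_continuous_at
      by (intro continuous_intros) blast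
    ultimately have "((\<lambda>r. F r \<bullet> fderiv \<gamma> r 1) has_derivative (\<lambda>s. F' s \<bullet> fderiv \<gamma> 0 1)) (at 0)"
      using I by (intro has_derivative_apply_at_zero[where \<Lambda> = "\<lambda>r u. u \<bullet> fderiv \<gamma> r 1" and U = I])
        (auto simp: linear_iff inner_left_distrib)
    moreover have "F r \<bullet> fderiv \<gamma> r 1 = g' r" if "r \<in> I" for r
    proof -
      have "linear (fderiv k (\<gamma> r))" using that \<gamma> by (intro smooth_on_linear_fderiv[OF O(2)]) blast
      from linear_basis_expansion[OF this, of "fderiv \<gamma> r 1"] show ?thesis
        by (simp add: F_def g'_def inner_sum_left inner_commute[of "fderiv \<gamma> r 1"] mult.commute)
    qed
    ultimately have "(g' has_derivative (\<lambda>s. F' s \<bullet> fderiv \<gamma> 0 1)) (at 0)"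
      using has_derivative_transform_within_open[OF _ I] by blast
    moreover have "F' s \<bullet> fderiv \<gamma> 0 1 = ?h * s" for s
    proof -
      have sv: "fderiv \<gamma> 0 s = s *\<^sub>R v"
        using linear_scale[OF smooth_on_linear_fderiv[OF \<gamma>(1) I(2)], of s 1] by (simp add: v)
      note sym = second_derivative_symmetric_real[OF O(1) \<gamma>0 O(2)]
      note lin = smooth_on_linear_fderiv[OF smooth_on_fderiv[OF O(2)] \<gamma>0]
      have "F' s \<bullet> v = (\<Sum>b\<in>Basis. (v \<bullet> b) *\<^sub>R fderiv (\<lambda>y. fderiv k y b) (\<gamma> 0) (s *\<^sub>R v))"
        by (simp add: F'_def inner_sum_left sv inner_commute[of v] mult.commute)
      also have "\<dots> = (\<Sum>b\<in>Basis. (v \<bullet> b) *\<^sub>R fderiv (\<lambda>y. fderiv k y (s *\<^sub>R v)) (\<gamma> 0) b)"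
        by (simp only: sym[of _ "s *\<^sub>R v"])
      also have "\<dots> = fderiv (\<lambda>y. fderiv k y (s *\<^sub>R v)) (\<gamma> 0) v"
        by (rule linear_basis_expansion[OF lin, symmetric])
      also have "\<dots> = fderiv (\<lambda>y. fderiv k y v) (\<gamma> 0) (s *\<^sub>R v)" by (rule sym)
      also have "\<dots> = ?h * s" using linear_scale[OF lin, of v s v] by simp
      finally show ?thesis by (simp add: v)
    qed
    ultimately show ?thesis by (simp add: has_field_derivative_def)
  qed
  have "((\<lambda>r. g' r / r) \<longlongrightarrow> ?h) (at 0)"
    using D2 by (simp add: has_field_derivative_iff g'_def 0)
  then have "((\<lambda>r. g' r / r / 2) \<longlongrightarrow> ?h / 2) (at_right 0)"
    by (intro tendsto_divide tendsto_const) (auto elim: tendsto_within_subset)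
  then have lim: "((\<lambda>r. g' r / (2 * r)) \<longlongrightarrow> ?h / 2) (at_right 0)"
    by (simp add: mult.commute)
  have evI: "\<forall>\<^sub>F r in at_right 0. r \<in> I"
    using I eventually_at_topological by blast
  have pos: "\<forall>\<^sub>F r in at_right 0. (0::real) < r"
    by (rule eventually_at_right_less)
  show ?thesis
  proof (rule lhopital_right_0[OF _ _ _ _ _ _ lim])
    have "isCont (\<lambda>r. k (\<gamma> r)) 0" using D1[OF I(2)] DERIV_isCont by blast
    then show "((\<lambda>r. k (\<gamma> r)) \<longlongrightarrow> 0) (at_right 0)"
      using 0 by (auto simp: isCont_def elim: tendsto_within_subset)
    show "((\<lambda>r::real. r\<^sup>2) \<longlongrightarrow> 0) (at_right 0)" by (auto intro!: tendsto_eq_intros)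
    show "\<forall>\<^sub>F r in at_right 0. r\<^sup>2 \<noteq> (0::real)" using pos by eventually_elim simp
    show "\<forall>\<^sub>F r in at_right 0. 2 * r \<noteq> (0::real)" using pos by eventually_elim simp
    show "\<forall>\<^sub>F r in at_right 0. ((\<lambda>r. k (\<gamma> r)) has_real_derivative g' r) (at r)"
      using evI by eventually_elim (rule D1)
    show "\<forall>\<^sub>F r in at_right 0. ((\<lambda>r. r\<^sup>2) has_real_derivative 2 * r) (at (r::real))"
      by (intro always_eventually allI) (auto intro!: derivative_eq_intros)
  qed
qed

lemma open_affine_vimage:
  fixes y u :: "'a::real_normed_vector"
  shows "open U \<Longrightarrow> open {t::real. y + t *\<^sub>R u \<in> U}"
  using open_vimage[of U "\<lambda>t. y + t *\<^sub>R u"] by (simp add: vimage_def continuous_intros)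

lemma smooth_on_affine:
  fixes y u :: "'a::real_normed_vector"
  assumes "open I" shows "smooth_on I (\<lambda>t::real. y + t *\<^sub>R u)"
  by (intro smooth_on_add assms smooth_on_const smooth_on_bounded_linear bounded_linear_scaleR_left)

lemma has_derivative_affine:
  fixes y u :: "'a::real_normed_vector"
  shows "((\<lambda>t::real. y + t *\<^sub>R u) has_derivative (\<lambda>s. s *\<^sub>R u)) (at t)"
  by (auto intro!: derivative_eq_intros)

context bott_minimum
begin

section \<open>Vertical vectors in bundle charts\<close>

lemma E_add: "(x, v) \<in> E \<Longrightarrow> (x, w) \<in> E \<Longrightarrow> (x, v + w) \<in> E"
  using subspace_add[OF subspace_fibre, of x v w] E_base by simp

lemma E_scale: "(x, v) \<in> E \<Longrightarrow> (x, r *\<^sub>R v) \<in> E"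
  using subspace_scale[OF subspace_fibre, of x v r] E_base by simp

text \<open>Bundle charts are affine on fibres, so a line in the fibre becomes a line whose
  direction is the fibre coordinate of \<open>u\<close>.\<close>

lemma vertical_eq:
  assumes b: "bundle_chart (chart_at B (x, v)) c S \<tau>" and v: "(x, v) \<in> E" "u \<in> fibre E x"
  shows "vertical B (x, v) u = \<tau> x u"
proof -
  note bx = chart_at_in(2)[of "(x, v)" B, unfolded carrier_B, OF v(1)]
  have "pref B (x, v) (x, v + t *\<^sub>R u) = (snd c x + \<tau> x v) + t *\<^sub>R \<tau> x u" for t
  proof -
    have "v + t *\<^sub>R u \<in> fibre E x"
      using v by (simp add: E_add E_scale)
    then have "(x, v + t *\<^sub>R u) \<in> fst (chart_at B (x, v))" using bx bc_fst[OF b] by simp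
    then show ?thesis
      using bc_snd[OF b] bc_linear[OF b bx] by (simp add: linear_add linear_scale)
  qed
  then have "((\<lambda>t. pref B (x, v) (x, v + t *\<^sub>R u)) has_vector_derivative \<tau> x u) (at 0)"
    using has_derivative_affine[of "snd c x + \<tau> x v" "\<tau> x u"] by (simp add: has_vector_derivative_def)
  then show ?thesis by (simp add: vertical_def vector_derivative_at)
qed

text \<open>The line \<open>v + t *\<^sub>R u\<close> is affine both in the preferred chart and in
  \<open>b\<close>, so the derivative of the transition map carries one direction to the
  other.\<close>

lemma vertical_in_chart:
  assumes b: "bundle_chart b c S \<tau>" and v: "(x, v) \<in> fst b" "u \<in> fibre E x"
  shows "vec_to_chart B b (x, v) (vertical B (x, v) u) = \<tau> x u"
proof -
  have E: "(x, v) \<in> E" using v bc_fst[OF b] by blast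
  then have cB: "(x, v) \<in> carrier B" by (simp add: carrier_B)
  let ?b = "chart_at B (x, v)"
  note b' = chart_at_in[OF cB]
  obtain c' S' \<tau>' where bc': "bundle_chart ?b c' S' \<tau>'" using bundle_chart_exists[OF b'(1)] .
  have in_fibre: "v + t *\<^sub>R u \<in> fibre E x" for t
    using v E by (simp add: E_add E_scale)
  have eq: "snd b (x, v + t *\<^sub>R u) = snd b (x, v) + t *\<^sub>R \<tau> x u" "(x, v + t *\<^sub>R u) \<in> fst b"
    if b: "bundle_chart b c S \<tau>" and v: "(x, v) \<in> fst b" for b c S \<tau> t
  proof -
    show "(x, v + t *\<^sub>R u) \<in> fst b" using in_fibre v bc_fst[OF b] by simp
    then show "snd b (x, v + t *\<^sub>R u) = snd b (x, v) + t *\<^sub>R \<tau> x u"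
      using bc_snd[OF b] v bc_linear[OF b v] by (simp add: linear_add linear_scale)
  qed
  have "(rep ?b b id has_derivative fderiv (rep ?b b id) (snd ?b (x, v))) (at (snd ?b (x, v)))"
    by (rule smooth_on_has_derivative[OF smooth_mapD(2)[OF smooth_map_id_E b'(1) bc_B[OF b]]]) (use E v b'(2) in auto)
  then have "((\<lambda>t. rep ?b b id (snd ?b (x, v) + t *\<^sub>R \<tau>' x u)) has_derivative
      (\<lambda>s. fderiv (rep ?b b id) (snd ?b (x, v)) (s *\<^sub>R \<tau>' x u))) (at 0)"
    by (intro has_derivative_compose[where g = "rep ?b b id", OF has_derivative_affine])
       (simp only: scaleR_zero_left add_0_right)
  moreover have "rep ?b b id (snd ?b (x, v) + t *\<^sub>R \<tau>' x u) = snd b (x, v) + t *\<^sub>R \<tau> x u" for t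
    using eq[OF bc' b'(2), of t] eq[OF b v(1), of t] bc_is_chart[OF bc'] by (simp flip: eq(1)[OF bc' b'(2)])
  ultimately have "(\<lambda>s. fderiv (rep ?b b id) (snd ?b (x, v)) (s *\<^sub>R \<tau>' x u)) = (\<lambda>s. s *\<^sub>R \<tau> x u)"
    using has_derivative_unique[OF _ has_derivative_affine] by simp
  from fun_cong[OF this, of 1] show ?thesis
    by (simp add: vertical_eq[OF bc' E v(2)] vec_to_chart_rep[OF atlas_B])
qed

section \<open>The Hessian and the linearized Hamiltonian field at a point of
  \<open>M\<close>\<close>

context
  fixes x assumes x: "x \<in> M"
begin

lemma xN: "x \<in> N" "x \<in> carrier A"
  using x M_sub carrier_A by auto

abbreviation "cN \<equiv> chart_at A x"

lemma cN: "cN \<in> A" "x \<in> fst cN" "is_chart cN" "open (snd cN ` fst cN)" "snd cN x \<in> snd cN ` fst cN"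
proof -
  show "cN \<in> A" "x \<in> fst cN" using chart_at_in[OF xN(2)] .
  then show "is_chart cN" using smooth_atlas_is_chart[OF atlas_A] by blast
  then show "open (snd cN ` fst cN)" by (simp add: is_chart_def)
  show "snd cN x \<in> snd cN ` fst cN" using \<open>x \<in> fst cN\<close> by blast
qed

lemma smooth_H_chart: "smooth_on (snd cN ` fst cN) (H \<circ> chart_inv cN)"
  using smooth_H cN by (simp add: smooth_function_def)

lemma H_chart_0: "(H \<circ> chart_inv cN) (snd cN x) = 0" "fderiv (H \<circ> chart_inv cN) (snd cN x) w = 0"
  using critical[OF x cN(1,2)] cN x min by auto

lemma hessian_sym: "hessian A H x u w = hessian A H x w u"
  unfolding hessian_def by (rule second_derivative_symmetric_real[OF cN(4,5) smooth_H_chart])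

lemma hessian_bilinear: "bilinear (hessian A H x)"
proof -
  have "linear (hessian A H x u)" for u
    unfolding hessian_def by (rule smooth_on_linear_fderiv[OF smooth_on_fderiv[OF smooth_H_chart] cN(5)])
  then show ?thesis using hessian_sym by (simp add: bilinear_def)
qed

text \<open>Half the Hessian is a limit of the quotients of the nonnegative function
  \<open>H\<close> by \<open>r\<^sup>2\<close> along a line in the chart.\<close>

lemma hessian_psd: "0 \<le> hessian A H x u u"
proof -
  let ?I = "{t::real. snd cN x + t *\<^sub>R u \<in> snd cN ` fst cN}"
  have I: "open ?I" "0 \<in> ?I" using open_affine_vimage[OF cN(4)] cN(5) by auto
  have "fderiv (\<lambda>t. snd cN x + t *\<^sub>R u) 0 1 = u" for t :: real
    using fderiv_eq[OF has_derivative_affine, of "snd cN x" u 0] by simp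
  then have lim: "((\<lambda>r. (H \<circ> chart_inv cN) (snd cN x + r *\<^sub>R u) / r\<^sup>2) \<longlongrightarrow> hessian A H x u u / 2) (at_right 0)"
    using tendsto_second_order[OF cN(4) smooth_H_chart I smooth_on_affine[OF I(1)] _ _ _ refl, of "snd cN x" u] H_chart_0
    by (auto simp: hessian_def)
  have "\<forall>\<^sub>F r in at_right 0. r \<in> ?I" using I eventually_at_topological by blast
  then have "\<forall>\<^sub>F r in at_right 0. 0 \<le> (H \<circ> chart_inv cN) (snd cN x + r *\<^sub>R u) / r\<^sup>2"
  proof eventually_elim
    case (elim r)
    then obtain q where q: "q \<in> fst cN" "snd cN x + r *\<^sub>R u = snd cN q" by auto
    then have "q \<in> N" using chart_subset_carrier[OF cN(1)] carrier_A by blast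
    then show ?case using q cN(3) min by simp
  qed
  from tendsto_lowerbound[OF lim this] show ?thesis by simp
qed

text \<open>A nonzero vector orthogonal to the tangent space of \<open>M\<close> cannot be tangent,
  because the form is nondegenerate on that space. Bott nondegeneracy keeps it out of the radical of
  the Hessian, and for a semidefinite form this means that it is not a null vector.\<close>

lemma hessian_pos:
  assumes "v \<in> fibre E x" "v \<noteq> 0" shows "0 < hessian A H x v v"
proof -
  have "linear_symplectic (tangent_space A M x) (\<Omega> x)"
    using sub x by (simp add: symplectic_submanifold_def)
  then have "v \<notin> tangent_space A M x"
    using assms x unfolding fibre_eq linear_symplectic_def by auto
  then obtain w where w: "hessian A H x v w \<noteq> 0"
    using bott x unfolding bott_nondegenerate_def by blast
  have "hessian A H x v v \<noteq> 0"
    using psd_null_vector[OF subspace_UNIV hessian_bilinear hessian_sym hessian_psd, of v w] w by auto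
  then show ?thesis using hessian_psd[of v] by simp
qed

text \<open>The field vanishes at \<open>x\<close>, so differentiating the Hamiltonian equation in
  the chart produces no term with derivatives of the form.\<close>

lemma \<Omega>_linearization: "\<Omega> x (fderiv (field_in_chart A cN XH) (snd cN x) u) w = hessian A H x w u"
proof -
  let ?F = "field_in_chart A cN XH"
  have "?F (snd cN x) = 0"
    using cN XH_zero[OF x] linear_0[OF linear_vec_to_chart[OF atlas_A cN(1,2)]] by (simp add: field_in_chart_def)
  have \<Omega>N: "\<forall>p\<in>carrier A. linear_symplectic UNIV (\<Omega> p)" using symplectic by (simp add: symplectic_form_def)
  have "((\<lambda>y. form_in_chart A cN \<Omega> y (?F y) w) has_derivative (\<lambda>u. form_in_chart A cN \<Omega> (snd cN x) (fderiv ?F (snd cN x) u) w)) (at (snd cN x))"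
  proof (rule has_derivative_apply_at_zero[where \<Lambda> = "\<lambda>y u. form_in_chart A cN \<Omega> y u w", OF smooth_on_has_derivative[OF smooth_XH[OF cN(1)] cN(5)] _ cN(4,5)])
    show "?F (snd cN x) = 0" by fact
    show "linear (\<lambda>u. form_in_chart A cN \<Omega> y u w)" if "y \<in> snd cN ` fst cN" for y
      by (rule linear_form_in_chart(1)[OF atlas_A \<Omega>N cN(1) that])
    show "isCont (\<lambda>y. form_in_chart A cN \<Omega> y u w) (snd cN x)" for u
      using symplectic cN(1,4,5) continuous_on_eq_continuous_at smooth_on_continuous
      unfolding symplectic_form_def by blast
  qed
  then have "((\<lambda>y. fderiv (H \<circ> chart_inv cN) y w) has_derivative (\<lambda>u. form_in_chart A cN \<Omega> (snd cN x) (fderiv ?F (snd cN x) u) w)) (at (snd cN x))"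
    by (rule has_derivative_transform_within_open[OF _ cN(4,5)])
       (rule hamiltonian_in_chart[where \<Omega> = \<Omega>, OF atlas_A smooth_H XH[folded carrier_A] cN(1)])
  from fderiv_eq[OF this] have "hessian A H x w u = form_in_chart A cN \<Omega> (snd cN x) (fderiv ?F (snd cN x) u) w"
    by (simp add: hessian_def)
  then show ?thesis using cN by (simp add: form_in_chart_def vec_from_chart_pref[OF atlas_A xN(2)])
qed

section \<open>The differential of \<Psi> at a zero vector and the linear map on the fibre\<close>

context
  fixes c S \<tau> assumes bc: "bundle_chart (chart_at B (x, 0)) c S \<tau>"
begin

abbreviation "cE \<equiv> chart_at B (x, 0)"
abbreviation "\<phi> \<equiv> rep cE cN \<Psi>"
abbreviation "U \<equiv> rep_dom cE cN W \<Psi>"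
abbreviation "z0 \<equiv> snd c x"

lemma cE: "(x, 0) \<in> fst cE" "is_chart cE" "cE \<in> B"
  using chart_at_in[of "(x, 0)" B] zero_in_E[OF x] carrier_B bc_is_chart[OF bc] by simp_all

lemma in_b: "(x, v) \<in> fst cE \<longleftrightarrow> v \<in> fibre E x"
  using cE(1) bc_fst[OF bc] by auto

lemmas \<tau>_linear = bc_linear[OF bc cE(1)]

lemma \<tau>_bij: "bij_betw (\<tau> x) (fibre E x) (S\<^sup>\<bottom>)"
  by (rule bc_bij[OF bc cE(1)])

lemma snd_b: "v \<in> fibre E x \<Longrightarrow> snd cE (x, v) = z0 + \<tau> x v" "snd cE (x, 0) = z0"
  using bc_snd[OF bc] in_b cE(1) linear_0[OF \<tau>_linear] by auto

lemma U: "open U" "smooth_on U \<phi>" "z0 \<in> U"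
proof -
  show "open U" "smooth_on U \<phi>" using smooth_mapD[OF diffeo(1) cE(3) cN(1)] .
  have "snd cE (x, 0) \<in> U" using zero_section[OF x] cE cN by (intro imageI) auto
  then show "z0 \<in> U" by (simp add: snd_b)
qed

lemma \<phi>_z0: "\<phi> z0 = snd cN x"
  using cE zero_section[OF x] by (simp flip: snd_b(2))

lemmas T_deriv = smooth_on_has_derivative[OF U(2,3)]

lemma T_linear: "linear (fderiv \<phi> z0)"
  by (rule smooth_on_linear_fderiv[OF U(2,3)])

lemma T_fibre:
  assumes "u \<in> fibre E x" shows "fderiv \<phi> z0 (\<tau> x u) = u"
proof -
  have "tangent_map B A \<Psi> (x, 0) (vertical B (x, 0) u) = u"
    using weinstein x assms by (auto simp: weinstein_neighbourhood_def)
  then show ?thesis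
    using vertical_eq[OF bc zero_in_E[OF x] assms] zero_section(2)[OF x] by (simp add: tangent_map_def snd_b)
qed

text \<open>A line in the slice through \<open>z0\<close> runs in the zero section, which \<Psi>
  maps onto \<open>M\<close>; its image is a smooth curve in \<open>M\<close> with the required
  velocity.\<close>

lemma T_tangent:
  assumes s: "s \<in> S" shows "fderiv \<phi> z0 s \<in> tangent_space A M x"
proof -
  let ?I = "{t::real. z0 + t *\<^sub>R s \<in> U}"
  have I: "open ?I" "0 \<in> ?I" using open_affine_vimage[OF U(1)] U(3) by auto
  then obtain \<delta> where \<delta>: "\<delta> > 0" "ball 0 \<delta> \<subseteq> ?I" using open_contains_ball by blast
  have \<delta>I: "{- \<delta><..<\<delta>} \<subseteq> ?I" using \<delta>(2) by (auto simp: dist_real_def subset_iff abs_less_iff)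
  define \<gamma> where "\<gamma> t = \<Psi> (chart_inv cE (z0 + t *\<^sub>R s))" for t
  have \<gamma>_eq: "pref A x (\<gamma> t) = \<phi> (z0 + t *\<^sub>R s)" for t by (simp add: \<gamma>_def)
  have "\<gamma> t \<in> M \<inter> fst cN" if "t \<in> ?I" for t
  proof -
    obtain e where e: "e \<in> W" "e \<in> fst cE" "\<Psi> e \<in> fst cN" "z0 + t *\<^sub>R s = snd cE e" using \<open>t \<in> ?I\<close> by auto
    have "snd cE e \<in> S"
      using s bc_base[OF bc cE(1)] bc_subspace[OF bc] by (simp flip: e(4) add: subspace_add subspace_scale)
    then have "snd cE e = snd cE (fst e, 0)"
      using bc_proj_W(1)[OF bc e(2)] bc_P(2)[OF bc] by metis
    moreover have "(fst e, 0) \<in> fst cE" using bc_dilation(1)[OF bc e(2), of 0] by (simp add: dilation_def split: prod.splits)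
    ultimately have e0: "e = (fst e, 0)" using bc_inj[OF bc] e(2) by (meson inj_onD)
    have "fst e \<in> M" using e(1) W_sub E_base by (metis prod.collapse subsetD)
    then have "\<Psi> e \<in> M" using e0 zero_section(2) by metis
    then show ?thesis using e cE(2) by (simp add: \<gamma>_def)
  qed
  moreover have "\<gamma> 0 = x" using cE zero_section(2)[OF x] by (simp add: \<gamma>_def flip: snd_b(2))
  moreover have "smooth_on {- \<delta><..<\<delta>} (\<lambda>t. pref A x (\<gamma> t))"
    unfolding \<gamma>_eq
    by (rule smooth_on_compose[OF _ U(1) smooth_on_affine U(2)]) (use \<delta>I in auto)
  moreover have "((\<lambda>t. pref A x (\<gamma> t)) has_vector_derivative fderiv \<phi> z0 s) (at 0)"
  proof -
    have "((\<lambda>t. \<phi> (z0 + t *\<^sub>R s)) has_derivative (\<lambda>r. fderiv \<phi> z0 (r *\<^sub>R s))) (at 0)"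
      by (rule has_derivative_compose[where g = \<phi>, OF has_derivative_affine])
      (use T_deriv in \<open>simp only: scaleR_zero_left add_0_right\<close>)
    then show ?thesis
      unfolding \<gamma>_eq has_vector_derivative_def by (simp add: linear_scale[OF T_linear])
  qed
  ultimately show ?thesis
    unfolding tangent_space_def using \<delta>(1) \<delta>I by blast
qed

text \<open>The relation between the two fields is differentiated at \<open>z0\<close>, where the
  field on \<open>W\<close> vanishes, so the second derivative of the coordinate change drops
  out.\<close>

lemma linearization_conjugate:
  "fderiv (field_in_chart A cN XH) (snd cN x) (fderiv \<phi> z0 u) = fderiv \<phi> z0 (fderiv (field_in_chart B cE XW) z0 u)"
proof -
  let ?F = "field_in_chart B cE XW" and ?G = "field_in_chart A cN XH"
  have z0W: "z0 \<in> snd cE ` (W \<inter> fst cE)" using U(3) by auto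
  have "orth_proj S z0 = z0" using bc_P(2)[OF bc bc_base[OF bc cE(1)]] .
  then have F0: "?F z0 = 0" using XW_zero[OF bc, of z0] z0W by simp
  have 1: "((\<lambda>z. fderiv \<phi> z (?F z)) has_derivative (\<lambda>u. fderiv \<phi> z0 (fderiv ?F z0 u))) (at z0)"
  proof (rule has_derivative_apply_at_zero[where \<Lambda> = "fderiv \<phi>", OF smooth_on_has_derivative[OF smooth_XW[OF cE(3)] z0W] F0 U(1,3)])
    show "linear (fderiv \<phi> z)" if "z \<in> U" for z by (rule smooth_on_linear_fderiv[OF U(2) that])
    show "isCont (\<lambda>z. fderiv \<phi> z u) z0" for u
      using smooth_on_continuous[OF smooth_on_fderiv[OF U(2)]] U(1,3) continuous_on_eq_continuous_at by blast
  qed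
  have 2: "((\<lambda>z. fderiv \<phi> z (?F z)) has_derivative (\<lambda>u. fderiv ?G (snd cN x) (fderiv \<phi> z0 u))) (at z0)"
  proof (rule has_derivative_transform_within_open[OF _ U(1,3)])
    have "(?G has_derivative fderiv ?G (snd cN x)) (at (\<phi> z0))"
      unfolding \<phi>_z0 by (rule smooth_on_has_derivative[OF smooth_XH[OF cN(1)] cN(5)])
    from has_derivative_compose[OF T_deriv this]
    show "((\<lambda>z. ?G (\<phi> z)) has_derivative (\<lambda>u. fderiv ?G (snd cN x) (fderiv \<phi> z0 u))) (at z0)" .
    fix z assume "z \<in> U"
    then obtain e where e: "e \<in> W" "e \<in> fst cE" "\<Psi> e \<in> fst cN" "z = snd cE e" by auto
    show "?G (\<phi> z) = fderiv \<phi> z (?F z)"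
      using vec_to_chart_tangent_map[OF atlas_B atlas_A diffeo(1) cE(3) e(2) cN(1) e(3) e(1), of "XW e"] e cN(3) cE(2)
      by (simp add: field_in_chart_def tangent_\<Psi>_XW[OF e(1)])
  qed
  show ?thesis by (rule fun_cong[OF has_derivative_unique[OF 2 1]])
qed

text \<open>The chart around the zero vector contains the whole fibre over \<open>x\<close>, and all
  its points project to \<open>z0\<close>. A single linearization therefore describes the limit
  field on the entire fibre.\<close>

lemma fibre_map_chart:
  obtains Y where "linear Y" "Y ` fibre E x \<subseteq> fibre E x"
    "\<And>v. v \<in> fibre E x \<Longrightarrow> X0 (x, v) = vertical B (x, v) (Y v)"
    "\<And>v w. v \<in> fibre E x \<Longrightarrow> w \<in> fibre E x \<Longrightarrow> \<Omega> x (Y v) w = hessian A H x w v"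
proof -
  let ?F = "field_in_chart B cE XW" and ?P = "orth_proj S"
  define q where "q u = fderiv ?F z0 u - ?P (fderiv ?F z0 u)" for u
  have z0W: "z0 \<in> snd cE ` (W \<inter> fst cE)" using U(3) by auto
  have lF: "linear (fderiv ?F z0)" by (rule smooth_on_linear_fderiv[OF smooth_XW[OF cE(3)] z0W])
  have lP: "linear ?P" using bounded_linear.linear[OF bc_P(1)[OF bc]] .
  \<comment> \<open>A left inverse of \<open>\<tau> x\<close> that is linear on the whole model
    space; it makes \<open>Y\<close> linear there, as the construction of the flow expects.\<close>
  obtain g where g: "linear g" "\<And>v. v \<in> fibre E x \<Longrightarrow> g (\<tau> x v) = v"
    using linear_exists_left_inverse_on[OF \<tau>_linear subspace_fibre[OF x] bij_betw_imp_inj_on[OF \<tau>_bij]] by blast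
  define Y where "Y v = g (q (\<tau> x v))" for v
  have q_eq: "\<exists>y\<in>fibre E x. q u = \<tau> x y" for u
  proof -
    have "q u \<in> S\<^sup>\<bottom>" unfolding q_def by (rule bc_P(5)[OF bc])
    then show ?thesis using \<tau>_bij by (auto simp: bij_betw_def)
  qed
  have YE: "Y v \<in> fibre E x" "\<tau> x (Y v) = q (\<tau> x v)" for v
    using q_eq[of "\<tau> x v"] g(2) by (auto simp: Y_def)
  show ?thesis
  proof
    show "linear Y"
      unfolding Y_def q_def using \<tau>_linear g(1) lF lP
      by (auto intro!: linearI simp: linear_add linear_scale linear_diff algebra_simps)
    show "Y ` fibre E x \<subseteq> fibre E x" using YE(1) by blast
    fix v assume v: "v \<in> fibre E x"
    have xv: "(x, v) \<in> fst cE" using v in_b by simp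
    have "field_in_chart B cE X0 (snd cE (x, v)) = \<tau> x (Y v)"
      using X0_in_chart[OF bc xv] bc_proj[OF bc xv] by (simp add: limit_in_chart_def Let_def YE(2) q_def)
    then have "vec_to_chart B cE (x, v) (X0 (x, v)) = vec_to_chart B cE (x, v) (vertical B (x, v) (Y v))"
      using vertical_in_chart[OF bc xv YE(1)] cE(2) xv by (simp add: field_in_chart_def)
    then show "X0 (x, v) = vertical B (x, v) (Y v)"
      using vec_chart_inverse(2)[OF atlas_B cE(3) xv] by metis
    fix w assume w: "w \<in> fibre E x"
    let ?p = "?P (fderiv ?F z0 (\<tau> x v))"
    have split: "fderiv ?F z0 (\<tau> x v) = \<tau> x (Y v) + ?p" by (simp add: YE(2) q_def)
    have "fderiv (field_in_chart A cN XH) (snd cN x) v = fderiv \<phi> z0 (fderiv ?F z0 (\<tau> x v))"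
      using linearization_conjugate[of "\<tau> x v"] T_fibre[OF v] by simp
    also have "\<dots> = fderiv \<phi> z0 (\<tau> x (Y v) + ?p)" by (rule arg_cong[OF split])
    also have "\<dots> = Y v + fderiv \<phi> z0 ?p" by (simp only: linear_add[OF T_linear] T_fibre[OF YE(1)])
    finally have "fderiv (field_in_chart A cN XH) (snd cN x) v = Y v + fderiv \<phi> z0 ?p" .
    moreover have "\<Omega> x (fderiv \<phi> z0 ?p) w = 0"
    proof -
      have "\<Omega> x w (fderiv \<phi> z0 ?p) = 0"
        using w T_tangent[OF bc_P(4)[OF bc]] x unfolding fibre_eq by simp
      then show ?thesis using \<Omega>_point(3)[OF xN(1), of "fderiv \<phi> z0 ?p" w] by simp
    qed
    ultimately show "\<Omega> x (Y v) w = hessian A H x w v"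
      using \<Omega>_linearization[of v w] bilinear_ladd[OF \<Omega>_point(1)[OF xN(1)]] by simp
  qed
qed

text \<open>By the normalization of \<Psi> at the zero section, the ray through \<open>v\<close>
  becomes a curve in the manifold with initial velocity \<open>v\<close>, and the second order
  expansion of \<open>H\<close> along it gives half the Hessian.\<close>

lemma normal_hessian_chart:
  assumes v: "v \<in> fibre E x" shows "normal_hessian H \<Psi> (x, v) = hessian A H x v v / 2"
proof -
  let ?I = "{t::real. z0 + t *\<^sub>R \<tau> x v \<in> U}"
  have I: "open ?I" "0 \<in> ?I" using open_affine_vimage[OF U(1)] U(3) by auto
  define \<gamma> where "\<gamma> t = \<phi> (z0 + t *\<^sub>R \<tau> x v)" for t
  have \<gamma>: "smooth_on ?I \<gamma>"
    unfolding \<gamma>_def by (rule smooth_on_compose[OF I(1) U(1) smooth_on_affine[OF I(1)] U(2)]) auto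
  have \<gamma>I: "\<gamma> ` ?I \<subseteq> snd cN ` fst cN"
    using cE(2) by (auto simp: \<gamma>_def)
  have \<gamma>0: "\<gamma> 0 = snd cN x" using \<phi>_z0 by (simp add: \<gamma>_def)
  have "(\<gamma> has_derivative (\<lambda>s. fderiv \<phi> z0 (s *\<^sub>R \<tau> x v))) (at 0)"
    unfolding \<gamma>_def by (rule has_derivative_compose[where g = \<phi>, OF has_derivative_affine])
      (use T_deriv in \<open>simp only: scaleR_zero_left add_0_right\<close>)
  from fderiv_eq[OF this] have "v = fderiv \<gamma> 0 1" using T_fibre[OF v] by simp
  from tendsto_second_order[OF cN(4) smooth_H_chart I \<gamma> \<gamma>I _ _ this]
  have lim: "((\<lambda>r. (H \<circ> chart_inv cN) (\<gamma> r) / r\<^sup>2) \<longlongrightarrow> hessian A H x v v / 2) (at_right 0)"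
    using H_chart_0 by (simp add: \<gamma>0 hessian_def)
  have "\<forall>\<^sub>F r in at_right 0. r \<in> ?I" using I eventually_at_topological by blast
  then have "\<forall>\<^sub>F r in at_right 0. (H \<circ> chart_inv cN) (\<gamma> r) / r\<^sup>2 = H (\<Psi> (dilation r (x, v))) / r\<^sup>2"
  proof eventually_elim
    case (elim r)
    then obtain e where e: "e \<in> W" "e \<in> fst cE" "\<Psi> e \<in> fst cN" "z0 + r *\<^sub>R \<tau> x v = snd cE e" by auto
    have rv: "r *\<^sub>R v \<in> fibre E x" using subspace_scale[OF subspace_fibre[OF x] v] .
    then have "snd cE (x, r *\<^sub>R v) = snd cE e" by (simp only: snd_b(1)[OF rv] linear_scale[OF \<tau>_linear] e(4))
    then have "e = (x, r *\<^sub>R v)" using bc_inj[OF bc] e(2) rv in_b by (metis inj_onD)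
    then show ?case using e cN(3) cE(2) by (simp add: \<gamma>_def dilation_def)
  qed
  then have "((\<lambda>r. H (\<Psi> (dilation r (x, v))) / r\<^sup>2) \<longlongrightarrow> hessian A H x v v / 2) (at_right 0)"
    using lim by (rule Lim_transform_eventually[rotated])
  then show ?thesis
    unfolding normal_hessian_def by (rule tendsto_Lim[OF trivial_limit_at_right_real])
qed

end

lemma normal_hessian_eq: "v \<in> fibre E x \<Longrightarrow> normal_hessian H \<Psi> (x, v) = hessian A H x v v / 2"
  using normal_hessian_chart bundle_chart_exists chart_at_in(1)[of "(x, 0)" B] zero_in_E[OF x] carrier_B by metis

lemma fibre_map:
  obtains Y where "linear Y" "Y ` fibre E x \<subseteq> fibre E x"
    "\<And>v. v \<in> fibre E x \<Longrightarrow> X0 (x, v) = vertical B (x, v) (Y v)"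
    "\<And>v w. v \<in> fibre E x \<Longrightarrow> w \<in> fibre E x \<Longrightarrow> \<Omega> x (Y v) w = hessian A H x w v"
proof -
  have "chart_at B (x, 0) \<in> B" using chart_at_in(1)[of "(x, 0)" B] zero_in_E[OF x] carrier_B by simp
  then obtain c S \<tau> where "bundle_chart (chart_at B (x, 0)) c S \<tau>" by (rule bundle_chart_exists)
  from fibre_map_chart[OF this] that show ?thesis by blast
qed

text \<open>The constant form can be read off at the zero vector, where the differential of \<Psi>
  is the identity on the fibre.\<close>

lemma \<Omega>F_eq:
  assumes "u \<in> fibre E x" "w \<in> fibre E x" shows "\<Omega>F x u w = \<Omega> x u w"
proof -
  have "tangent_map B A \<Psi> (x, 0) (vertical B (x, 0) u) = u" if "u \<in> fibre E x" for u
    using weinstein x that by (auto simp: weinstein_neighbourhood_def)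
  moreover have "pullback_form B A \<Psi> \<Omega> (x, 0) (vertical B (x, 0) u) (vertical B (x, 0) w) = \<Omega>F x u w"
    using weinstein zero_section(1)[OF x] assms unfolding weinstein_neighbourhood_def by blast
  ultimately show ?thesis using assms zero_section(2)[OF x] by (simp add: pullback_form_def)
qed

lemma fibre_hamiltonian_X0:
  assumes "r > 0"
  shows "fibre_hamiltonian B E x (\<lambda>u w. \<Omega>F x (r *\<^sub>R u) (r *\<^sub>R w) / r\<^sup>2) (normal_hessian H \<Psi>) X0"
  unfolding fibre_hamiltonian_def
proof
  fix v assume v: "v \<in> fibre E x"
  obtain Y where "linear Y" and Y: "Y ` fibre E x \<subseteq> fibre E x"
    "\<And>v. v \<in> fibre E x \<Longrightarrow> X0 (x, v) = vertical B (x, v) (Y v)"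
    "\<And>v w. v \<in> fibre E x \<Longrightarrow> w \<in> fibre E x \<Longrightarrow> \<Omega> x (Y v) w = hessian A H x w v"
    by (rule fibre_map) (rule that)
  have Yv: "Y v \<in> fibre E x" using Y(1) v by blast
  note h = hessian_bilinear and \<Omega> = \<Omega>_point(1)[OF xN(1)]
  have "((\<lambda>t. normal_hessian H \<Psi> (x, v + t *\<^sub>R w)) has_real_derivative \<Omega>F x (r *\<^sub>R Y v) (r *\<^sub>R w) / r\<^sup>2) (at 0)"
    if w: "w \<in> fibre E x" for w
  proof -
    \<comment> \<open>The coefficient of t loses its 1/2 because the two mixed terms coincide by
      symmetry; the rescaling by r in the form cancels by bilinearity.\<close>
    have "normal_hessian H \<Psi> (x, v + t *\<^sub>R w) =
        hessian A H x v v / 2 + t * hessian A H x w v + t\<^sup>2 * hessian A H x w w / 2" for t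
      using normal_hessian_eq[of "v + t *\<^sub>R w"] v w hessian_sym[of v w]
      by (simp add: E_add E_scale bilinear_ladd[OF h] bilinear_radd[OF h] bilinear_lmul[OF h] bilinear_rmul[OF h]
        power2_eq_square algebra_simps add_divide_distrib)
    moreover have "\<Omega>F x (r *\<^sub>R Y v) (r *\<^sub>R w) / r\<^sup>2 = hessian A H x w v"
      using \<Omega>F_eq[of "r *\<^sub>R Y v" "r *\<^sub>R w"] Y(3)[OF v w] Yv w assms
      by (simp add: E_scale bilinear_lmul[OF \<Omega>] bilinear_rmul[OF \<Omega>] power2_eq_square)
    ultimately show ?thesis by (auto intro!: derivative_eq_intros)
  qed
  then show "\<exists>y\<in>fibre E x. X0 (x, v) = vertical B (x, v) y \<and>
      (\<forall>w\<in>fibre E x. ((\<lambda>t. normal_hessian H \<Psi> (x, v + t *\<^sub>R w)) has_real_derivative \<Omega>F x (r *\<^sub>R y) (r *\<^sub>R w) / r\<^sup>2) (at 0))"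
    using Y(2)[OF v] Yv by blast
qed

text \<open>The preferred chart changes along the curve, but each one is a bundle chart containing
  the whole fibre, in which the curve is an affine image of \<theta>.\<close>

lemma integral_curve_X0:
  assumes Y: "\<And>v. v \<in> fibre E x \<Longrightarrow> X0 (x, v) = vertical B (x, v) (Y v)" "Y ` fibre E x \<subseteq> fibre E x"
    and \<theta>: "\<And>t. \<theta> t \<in> fibre E x" "\<And>t. (\<theta> has_vector_derivative Y (\<theta> t)) (at t)"
  shows "integral_curve B X0 (\<lambda>t. (x, \<theta> t))"
  unfolding integral_curve_def
proof (intro allI conjI)
  fix t
  show cB: "(x, \<theta> t) \<in> carrier B" using \<theta>(1) by (simp add: carrier_B)
  note b = chart_at_in[OF cB]
  obtain c S \<tau> where bc: "bundle_chart (chart_at B (x, \<theta> t)) c S \<tau>" using bundle_chart_exists[OF b(1)] .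
  have in_b: "(x, \<theta> s) \<in> fst (chart_at B (x, \<theta> t))" for s
    using b(2) \<theta>(1) bc_fst[OF bc] by simp
  then show "\<forall>\<^sub>F s in nhds t. (x, \<theta> s) \<in> fst (chart_at B (x, \<theta> t))" by simp
  have "bounded_linear (\<tau> x)" using bc_linear[OF bc b(2)] linear_conv_bounded_linear by blast
  from has_vector_derivative_add[OF has_vector_derivative_const bounded_linear.has_vector_derivative[OF this \<theta>(2)]]
  have "((\<lambda>s. snd c x + \<tau> x (\<theta> s)) has_vector_derivative \<tau> x (Y (\<theta> t))) (at t)" by simp
  moreover have "X0 (x, \<theta> t) = \<tau> x (Y (\<theta> t))"
    using Y \<theta>(1) by (simp add: image_subset_iff vertical_eq[OF bc])
  ultimately show "((\<lambda>s. pref B (x, \<theta> t) (x, \<theta> s)) has_vector_derivative X0 (x, \<theta> t)) (at t)"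
    by (simp add: bc_snd[OF bc in_b])
qed

end

lemma fibrewise_X0: "fibrewise_field B E X0"
  unfolding fibrewise_field_def
proof (clarify)
  fix x v assume v: "(x, v) \<in> E"
  obtain Y where "linear Y" "Y ` fibre E x \<subseteq> fibre E x"
    "\<And>v. v \<in> fibre E x \<Longrightarrow> X0 (x, v) = vertical B (x, v) (Y v)"
    "\<And>v w. v \<in> fibre E x \<Longrightarrow> w \<in> fibre E x \<Longrightarrow> \<Omega> x (Y v) w = hessian A H x w v"
    by (rule fibre_map[OF E_base[OF v]]) (rule that)
  then show "X0 (x, v) \<in> vertical B (x, v) ` fibre E x" using v by blast
qed

lemma quasiperiodic_X0: "quasiperiodic_field B E M X0"
  unfolding quasiperiodic_field_def
proof
  fix x assume x: "x \<in> M"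
  obtain Y where Y: "linear Y" "Y ` fibre E x \<subseteq> fibre E x"
    "\<And>v. v \<in> fibre E x \<Longrightarrow> X0 (x, v) = vertical B (x, v) (Y v)"
    "\<And>v w. v \<in> fibre E x \<Longrightarrow> w \<in> fibre E x \<Longrightarrow> \<Omega> x (Y v) w = hessian A H x w v"
    by (rule fibre_map[OF x]) (rule that)
  let ?h = "hessian A H x"
  have YE: "Y v \<in> fibre E x" if "v \<in> fibre E x" for v using Y(2) that by blast
  \<comment> \<open>The Hessian of \<open>Y u\<close> and \<open>v\<close> is the form evaluated on
    \<open>Y v\<close> and \<open>Y u\<close>, which is antisymmetric in \<open>u\<close> and
    \<open>v\<close>.\<close>
  have skew: "?h (Y u) v = - ?h u (Y v)" if "u \<in> fibre E x" "v \<in> fibre E x" for u v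
  proof -
    have "?h (Y u) v = \<Omega> x (Y v) (Y u)" using Y(4) that YE by simp
    also have "\<dots> = - \<Omega> x (Y u) (Y v)" using \<Omega>_point(3) x M_sub by blast
    also have "\<dots> = - ?h (Y v) u" using Y(4) that YE by simp
    finally show ?thesis using hessian_sym[OF x] by simp
  qed
  \<comment> \<open>A kernel vector of \<open>Y\<close> would make its own Hessian value zero,
    against positive definiteness.\<close>
  have inj: "v = 0" if v: "v \<in> fibre E x" "Y v = 0" for v
  proof (rule ccontr)
    assume "v \<noteq> 0"
    have "?h v v = \<Omega> x 0 v" using Y(4)[OF v(1) v(1)] v(2) by simp
    also have "\<dots> = 0" using bilinear_lzero \<Omega>_point(1) x M_sub by blast
    finally show False using hessian_pos[OF x v(1) \<open>v \<noteq> 0\<close>] by simp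
  qed
  obtain k :: nat and \<zeta> :: "nat \<Rightarrow> 'e \<Rightarrow> complex" and \<omega> :: "nat \<Rightarrow> real" and \<theta> :: "real \<Rightarrow> 'e \<Rightarrow> 'e" where
    flow: "\<forall>i<k. linear (\<zeta> i)" "bij_betw (\<lambda>v. \<lambda>i\<in>{..<k}. \<zeta> i v) (fibre E x) ({..<k} \<rightarrow>\<^sub>E UNIV)"
      "\<forall>v\<in>fibre E x. \<theta> 0 v = v \<and> (\<forall>t. \<theta> t v \<in> fibre E x) \<and>
       (\<forall>t. ((\<lambda>t. \<theta> t v) has_vector_derivative Y (\<theta> t v)) (at t)) \<and>
       (\<forall>t. \<forall>i<k. \<zeta> i (\<theta> t v) = cis (\<omega> i * t) * \<zeta> i v)"
    using skew_flow[OF subspace_fibre[OF x] hessian_bilinear[OF x] hessian_sym[OF x] hessian_pos[OF x] Y(1,2) skew inj]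
    by blast
  have "integral_curve B X0 (\<lambda>t. (x, \<theta> t v))" if "v \<in> fibre E x" for v
    using integral_curve_X0[OF x Y(3) Y(2), of "\<lambda>t. \<theta> t v"] flow(3) that by blast
  then show "\<exists>(k::nat) (\<zeta> :: nat \<Rightarrow> 'e \<Rightarrow> complex) (\<omega> :: nat \<Rightarrow> real) (\<theta> :: real \<Rightarrow> 'e \<Rightarrow> 'e).
        (\<forall>i<k. linear (\<zeta> i)) \<and>
        bij_betw (\<lambda>v. \<lambda>i\<in>{..<k}. \<zeta> i v) (fibre E x) ({..<k} \<rightarrow>\<^sub>E UNIV) \<and>
        (\<forall>v\<in>fibre E x. \<theta> 0 v = v \<and> (\<forall>t. \<theta> t v \<in> fibre E x) \<and>
           integral_curve B X0 (\<lambda>t. (x, \<theta> t v)) \<and>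
           (\<forall>t. \<forall>i<k. \<zeta> i (\<theta> t v) = cis (\<omega> i * t) * \<zeta> i v))"
    using flow by (intro exI[of _ k] exI[of _ \<zeta>] exI[of _ \<omega>] exI[of _ \<theta>]) blast
qed

end

text \<open>The rescaled fields of the theorem are prescribed for positive parameters, and the limit
  sees no others.\<close>

lemma Ck_converges_cong:
  assumes "Ck_converges B k D X X0" "\<And>r. r > 0 \<Longrightarrow> X r = X' r"
  shows "Ck_converges B k D X' X0"
  unfolding Ck_converges_def
proof (intro ballI allI impI conjI)
  fix c K assume c: "c \<in> B" and K: "compact K \<and> K \<subseteq> snd c ` fst c"
  note conv = assms(1)[unfolded Ck_converges_def, rule_format, OF c K]
  show "\<forall>\<^sub>F r in at_right 0. K \<subseteq> snd c ` (fst c \<inter> D r)" using conv by blast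
  fix vs :: "'b list" assume "length vs \<le> k"
  then have lim: "uniform_limit K (\<lambda>r. iter_deriv vs (field_in_chart B c (X r))) (iter_deriv vs (field_in_chart B c X0)) (at_right 0)"
    using conv by blast
  have ev: "\<forall>\<^sub>F r in at_right 0. \<forall>z\<in>K. iter_deriv vs (field_in_chart B c (X r)) z = iter_deriv vs (field_in_chart B c (X' r)) z"
    using eventually_at_right_less[of 0] by eventually_elim (simp add: assms(2))
  show "uniform_limit K (\<lambda>r. iter_deriv vs (field_in_chart B c (X' r))) (iter_deriv vs (field_in_chart B c X0)) (at_right 0)"
    by (rule uniform_limit_cong[THEN iffD1, OF ev _ lim]) simp
qed

theorem lemma3p1:
  fixes N :: "'p set" and A :: "('p, 'e::euclidean_space) chart set"
    and \<Omega> :: "'p \<Rightarrow> 'e \<Rightarrow> 'e \<Rightarrow> real" and H :: "'p \<Rightarrow> real" and X\<^sub>H :: "'p \<Rightarrow> 'e"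
    and n m :: nat and M :: "'p set"
    and E W :: "('p \<times> 'e) set" and B :: "('p \<times> 'e, 'e) chart set" and \<Psi> :: "'p \<times> 'e \<Rightarrow> 'p"
    and \<Omega>F :: "'p \<Rightarrow> 'e \<Rightarrow> 'e \<Rightarrow> real"
    and X\<^sub>W :: "'p \<times> 'e \<Rightarrow> 'e" and X\<^sub>1 :: "real \<Rightarrow> 'p \<times> 'e \<Rightarrow> 'e"
    and \<Omega>t :: "real \<Rightarrow> 'p \<times> 'e \<Rightarrow> 'e \<Rightarrow> 'e \<Rightarrow> real"
    and \<Omega>tF :: "real \<Rightarrow> 'p \<Rightarrow> 'e \<Rightarrow> 'e \<Rightarrow> real"
  assumes N: "smooth_manifold N A" "DIM('e) = 2 * n" "symplectic_form A \<Omega>"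
    and H: "smooth_function A H" "proper_function A H"
    and min: "M \<noteq> {}" "\<forall>p\<in>N. 0 \<le> H p" "M = {p \<in> N. H p = 0}"
    and M: "compactin (atlas_topology A) M" "symplectic_submanifold A \<Omega> M (2 * m)"
      "bott_nondegenerate A H M"
    and X\<^sub>H: "\<forall>p\<in>N. \<forall>w. \<Omega> p (X\<^sub>H p) w = differential A H p w"
    and E: "E = symplectic_normal_bundle A \<Omega> M" "B = bundle_atlas A M (2 * m) E"
    and W: "weinstein_neighbourhood A \<Omega> M B E W \<Psi> \<Omega>F"
    and X\<^sub>W: "X\<^sub>W = pushforward A B (inv_into W \<Psi>) (\<Psi> ` W) X\<^sub>H"
    and X\<^sub>1: "\<forall>\<epsilon>>0. X\<^sub>1 \<epsilon> = pushforward B B (inv (dilation \<epsilon>)) W X\<^sub>W"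
    and \<Omega>t: "\<forall>\<epsilon>>0. \<forall>e u w.
      \<Omega>t \<epsilon> e u w = pullback_form B B (dilation \<epsilon>) (pullback_form B A \<Psi> \<Omega>) e u w / \<epsilon>\<^sup>2"
    and \<Omega>tF: "\<forall>\<epsilon>>0. \<forall>x u w. \<Omega>tF \<epsilon> x u w = \<Omega>F x (\<epsilon> *\<^sub>R u) (\<epsilon> *\<^sub>R w) / \<epsilon>\<^sup>2"
  shows "(\<forall>\<epsilon>>0. \<forall>e\<in>E. dilation \<epsilon> e \<in> W \<longrightarrow>
            (\<forall>u. \<Omega>t \<epsilon> e (X\<^sub>1 \<epsilon> e) u = differential B (\<lambda>e. H (\<Psi> (dilation \<epsilon> e)) / \<epsilon>\<^sup>2) e u)) \<and>
         (\<forall>\<epsilon>>0. smooth_field B {e \<in> E. dilation \<epsilon> e \<in> W} (X\<^sub>1 \<epsilon>)) \<and>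
         (\<exists>X\<^sub>0. smooth_field B E X\<^sub>0 \<and>
            (\<forall>k. Ck_converges B k (\<lambda>\<epsilon>. {e \<in> E. dilation \<epsilon> e \<in> W}) X\<^sub>1 X\<^sub>0) \<and>
            fibrewise_field B E X\<^sub>0 \<and>
            quasiperiodic_field B E M X\<^sub>0 \<and>
            (\<forall>x\<in>M. \<forall>\<epsilon>>0. fibre_hamiltonian B E x (\<Omega>tF \<epsilon> x) (normal_hessian H \<Psi>) X\<^sub>0))"
proof -
  interpret bott_minimum N A \<Omega> H X\<^sub>H "2 * m" M E W B \<Psi> \<Omega>F
    using N H(1) min(2,3) M(2,3) X\<^sub>H E W by unfold_locales
  have XW: "X\<^sub>W = XW" by (simp add: X\<^sub>W XW_def)
  have X1: "X\<^sub>1 r = X1 r" if "r > 0" for r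
    using X\<^sub>1 that by (simp add: X1_def XW inv_dilation)
  have rescaled_dom: "{e \<in> E. dilation r e \<in> W} = rescaled_dom r" for r by (simp add: rescaled_dom_def)
  show ?thesis
  proof (intro conjI exI[of _ X0] allI impI ballI)
    show "\<Omega>t r e (X\<^sub>1 r e) u = differential B (\<lambda>e. H (\<Psi> (dilation r e)) / r\<^sup>2) e u"
      if "r > 0" "e \<in> E" "dilation r e \<in> W" for r e u
      using rescaled_hamiltonian[of r e u] that
      by (simp only: \<Omega>t[rule_format, OF that(1)] X1[OF that(1)]) (simp add: rescaled_dom_def)
    show "smooth_field B {e \<in> E. dilation r e \<in> W} (X\<^sub>1 r)" if "r > 0" for r
      using smooth_field_X1[OF that] X1[OF that] by (simp add: rescaled_dom)
    show "smooth_field B E X0" by (rule smooth_field_X0)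
    show "Ck_converges B k (\<lambda>r. {e \<in> E. dilation r e \<in> W}) X\<^sub>1 X0" for k
      unfolding rescaled_dom by (rule Ck_converges_cong[OF Ck_converges_X0]) (simp add: X1)
    show "fibrewise_field B E X0" by (rule fibrewise_X0)
    show "quasiperiodic_field B E M X0" by (rule quasiperiodic_X0)
    show "fibre_hamiltonian B E x (\<Omega>tF r x) (normal_hessian H \<Psi>) X0" if "x \<in> M" "r > 0" for x r
    proof -
      have "\<Omega>tF r x = (\<lambda>u w. \<Omega>F x (r *\<^sub>R u) (r *\<^sub>R w) / r\<^sup>2)" using \<Omega>tF that(2) by (simp add: fun_eq_iff)
      then show ?thesis using fibre_hamiltonian_X0[OF that] by simp
    qed
  qed
qed

end
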